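(* Let $\nabla$ be an $A$-anisotropic connection on $M$ and let $P$, $\mathcal T$ and $R$ be its vertical derivative, torsion and curvature tensor, respectively. For every $v\in A$ and $u,w,z,b\in T_{\pi(v)}M$, $$(\partial^\nu R)_v(u,w,z,b)=(\nabla_uP)_v(w,z,b)-(\nabla_wP)_v(u,z,b)+P_v(\mathcal T_v(u,w),z,b)-P_v(w,z,P_v(u,v,b))+P_v(u,z,P_v(w,v,b)).$$
   Context: $M$ is a smooth manifold, $\pi:TM\to M$ its tangent bundle, $A\subset TM$ an open subset with $\pi(A)=M$, $\mathcal F(\cdot)$ denotes smooth real functions, $\mathfrak X(\cdot)$ smooth vector fields. $\mathfrak T^1_0(M,A)$ is the set of smooth maps $v\in A\mapsto\mathcal X_v\in T_{\pi(v)}M$; vector fields $X$ on $M$ are regarded as such maps via $v\mapsto X_{\pi(v)}$. An $A$-anisotropic tensor (of type $(1,s)$) is an $\mathcal F(A)$-multilinear map $T:\mathfrak T^1_0(M,A)^s\to\mathfrak T^1_0(M,A)$; it amounts to multilinear maps $T_v:(T_{\pi(v)}M)^s\to T_{\pi(v)}M$ depending smoothly on $v\in A$. Its vertical derivative is $(\partial^\nu T)_v(x_1,\ldots,x_s,z)=\frac{d}{dt}T_{v+tz}(x_1,\ldots,x_s)|_{t=0}$; in particular $(\partial^\nu R)_v(u,w,z,b)=\frac{d}{dt}R_{v+tb}(u,w)z|_{t=0}$. A vector field $V$ on an open $\Omega\subset M$ is $A$-admissible if $V_p\in A$ for all $p\in\Omega$; it extends $v$ if $V_{\pi(v)}=v$;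 $(\mathcal Y_V)_p=\mathcal Y_{V_p}$. An $A$-anisotropic connection is a map $\nabla:A\times\mathfrak X(M)\times\mathfrak X(M)\to TM$, $(v,X,Y)\mapsto\nabla^v_XY\in T_{\pi(v)}M$, additive in $Y$, with $\nabla^v_X(fY)=X_{\pi(v)}(f)Y_{\pi(v)}+f(\pi(v))\nabla^v_XY$, $\nabla^v_{fX+hY}Z=f(\pi(v))\nabla^v_XZ+h(\pi(v))\nabla^v_YZ$ for $f,h\in\mathcal F(M)$, and with $\nabla_XY\in\mathfrak T^1_0(M,A)$ (smoothness in $v$). For $\mathcal Y\in\mathfrak T^1_0(M,A)$, $\nabla^v_X\mathcal Y=\nabla^v_X(\mathcal Y_V)-(\partial^\nu\mathcal Y)_v(\nabla^v_XV)$ for any local $A$-admissible extension $V$ of $v$ (independent of $V$). For an anisotropic tensor $T$ of type $(1,s)$, $(\nabla_XT)(X_1,\ldots,X_s)=\nabla_X(T(X_1,\ldots,X_s))-\sum_jT(X_1,\ldots,\nabla_XX_j,\ldots,X_s)$; $(\nabla_XT)_v$ depends only on $X_{\pi(v)}$, so $(\nabla_uT)_v$ makes sense for $u\in T_{\pi(v)}M$. Torsion: $\mathcal T_v(X,Y)=\nabla^v_XY-\nabla^v_YX-[X,Y]_{\pi(v)}$. Vertical derivative of $\nabla$: $P_v(X,Y,Z)=\frac{\partial}{\partial t}\big(\nabla^{v+tZ}_XY\big)|_{t=0}$. Curvature tensor: $R_v(X,Y)Z=\nabla^v_X(\nabla_YZ)-\nabla^v_Y(\nabla_XZ)-\nabla^v_{[X,Y]}Z$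 for $X,Y,Z\in\mathfrak X(M)$. These are $A$-anisotropic tensors. *)

theory Defs
  imports "HOL-Analysis.Analysis" "HOL-Library.Function_Algebras"
begin

text \<open>Tangent vectors are families of components indexed by charts; they are added and scaled
  pointwise.\<close>

instantiation "fun" :: (type, real_vector) real_vector
begin

definition scaleR_fun :: "real \<Rightarrow> ('a \<Rightarrow> 'b) \<Rightarrow> 'a \<Rightarrow> 'b"
  where "scaleR_fun r f = (\<lambda>x. r *\<^sub>R f x)"

instance
  by standard (simp_all add: scaleR_fun_def plus_fun_def scaleR_add_right scaleR_add_left)

end

primrec Ck_on :: "nat \<Rightarrow> 'a::euclidean_space set \<Rightarrow> ('a \<Rightarrow> 'b::euclidean_space) \<Rightarrow> bool"
  where
    "Ck_on 0 S f \<longleftrightarrow> continuous_on S f"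
  | "Ck_on (Suc k) S f \<longleftrightarrow> (\<forall>x\<in>S. f differentiable (at x)) \<and>
      (\<forall>h. Ck_on k S (\<lambda>x. frechet_derivative f (at x) h))"

text \<open>Derivatives are taken with respect to the whole space, so this is used for open \<open>S\<close> only.\<close>

definition smooth_on :: "'a::euclidean_space set \<Rightarrow> ('a \<Rightarrow> 'b::euclidean_space) \<Rightarrow> bool"
  where "smooth_on S f \<longleftrightarrow> (\<forall>k. Ck_on k S f)"

text \<open>The manifold is the whole type \<open>'m\<close>; a chart is a pair of its domain and its coordinate map.\<close>

type_synonym ('m, 'e) chart = "'m set \<times> ('m \<Rightarrow> 'e)"

abbreviation dom_chart :: "('m, 'e) chart \<Rightarrow> 'm set"
  where "dom_chart c \<equiv> fst c"

abbreviation coord :: "('m, 'e) chart \<Rightarrow> 'm \<Rightarrow> 'e"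
  where "coord c \<equiv> snd c"

definition image_chart :: "('m, 'e) chart \<Rightarrow> 'e set"
  where "image_chart c = coord c ` dom_chart c"

definition param :: "('m, 'e) chart \<Rightarrow> 'e \<Rightarrow> 'm"
  where "param c = inv_into (dom_chart c) (coord c)"

definition transition :: "('m, 'e) chart \<Rightarrow> ('m, 'e) chart \<Rightarrow> 'e \<Rightarrow> 'e"
  where "transition c d = coord d \<circ> param c"

definition smooth_atlas ::
  "('m::{t2_space, second_countable_topology}, 'e::euclidean_space) chart set \<Rightarrow> bool"
  where "smooth_atlas \<Phi> \<longleftrightarrow>
    (\<Union>c\<in>\<Phi>. dom_chart c) = UNIV \<and>
    (\<forall>c\<in>\<Phi>. open (dom_chart c) \<and> open (image_chart c) \<and>
      homeomorphism (dom_chart c) (image_chart c) (coord c) (param c)) \<and>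
    (\<forall>c\<in>\<Phi>. \<forall>d\<in>\<Phi>. smooth_on (coord c ` (dom_chart c \<inter> dom_chart d)) (transition c d))"

definition smooth_functions ::
  "('m::{t2_space, second_countable_topology}, 'e::euclidean_space) chart set \<Rightarrow> ('m \<Rightarrow> real) set"
  where "smooth_functions \<Phi> = {f. \<forall>c\<in>\<Phi>. smooth_on (image_chart c) (f \<circ> param c)}"

text \<open>A tangent vector at \<open>p\<close> is the family of its components in all charts around \<open>p\<close>, related by
  the derivatives of the transition maps; the entries at all other indices are \<open>0\<close>.  A point of the
  tangent bundle is a pair \<open>(p, y)\<close> with \<open>y\<close> a tangent vector at \<open>p\<close>, so the bundle projection is
  \<open>fst\<close>, and \<open>snd v\<close> is \<open>v\<close> regarded as an element of the vector space \<open>tspace \<Phi> (fst v)\<close>.\<close>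

type_synonym ('m, 'e) tvec = "('m, 'e) chart \<Rightarrow> 'e"

definition tspace ::
  "('m, 'e::euclidean_space) chart set \<Rightarrow> 'm \<Rightarrow> ('m, 'e) tvec set"
  where "tspace \<Phi> p = {y.
    (\<forall>c\<in>\<Phi>. \<forall>d\<in>\<Phi>. p \<in> dom_chart c \<inter> dom_chart d \<longrightarrow>
      y d = frechet_derivative (transition c d) (at (coord c p)) (y c)) \<and>
    (\<forall>c. \<not> (c \<in> \<Phi> \<and> p \<in> dom_chart c) \<longrightarrow> y c = 0)}"

definition tangent_bundle ::
  "('m, 'e::euclidean_space) chart set \<Rightarrow> ('m \<times> ('m, 'e) tvec) set"
  where "tangent_bundle \<Phi> = Sigma UNIV (tspace \<Phi>)"

text \<open>The inverse of the natural chart \<open>(p, y) \<mapsto> (coord c p, y c)\<close> of the tangent bundle.\<close>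

definition tparam ::
  "('m, 'e::euclidean_space) chart set \<Rightarrow> ('m, 'e) chart \<Rightarrow> 'e \<times> 'e \<Rightarrow> 'm \<times> ('m, 'e) tvec"
  where "tparam \<Phi> c = (\<lambda>(x, a). (param c x,
    \<lambda>d. if d \<in> \<Phi> \<and> param c x \<in> dom_chart d
        then frechet_derivative (transition c d) (at x) a else 0))"

definition in_chart ::
  "('m, 'e::euclidean_space) chart set \<Rightarrow> ('m, 'e) chart \<Rightarrow> ('m \<times> ('m, 'e) tvec) set \<Rightarrow> ('e \<times> 'e) set"
  where "in_chart \<Phi> c A = {\<xi> \<in> image_chart c \<times> UNIV. tparam \<Phi> c \<xi> \<in> A}"

definition open_in_TM ::
  "('m, 'e::euclidean_space) chart set \<Rightarrow> ('m \<times> ('m, 'e) tvec) set \<Rightarrow> bool"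
  where "open_in_TM \<Phi> A \<longleftrightarrow> A \<subseteq> tangent_bundle \<Phi> \<and> (\<forall>c\<in>\<Phi>. open (in_chart \<Phi> c A))"

definition vector_fields_on ::
  "('m::{t2_space, second_countable_topology}, 'e::euclidean_space) chart set \<Rightarrow> 'm set \<Rightarrow>
    ('m \<Rightarrow> ('m, 'e) tvec) set"
  where "vector_fields_on \<Phi> \<Omega> = {X.
    (\<forall>p\<in>\<Omega>. X p \<in> tspace \<Phi> p) \<and>
    (\<forall>c\<in>\<Phi>. smooth_on (coord c ` (dom_chart c \<inter> \<Omega>)) (\<lambda>x. X (param c x) c))}"

abbreviation vector_fields ::
  "('m::{t2_space, second_countable_topology}, 'e::euclidean_space) chart set \<Rightarrow>
    ('m \<Rightarrow> ('m, 'e) tvec) set"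
  where "vector_fields \<Phi> \<equiv> vector_fields_on \<Phi> UNIV"

text \<open>\<open>dir_deriv \<Phi> p x f\<close> is \<open>x(f)\<close> for a tangent vector \<open>x\<close> at \<open>p\<close>; any chart around \<open>p\<close> gives the
  same value.\<close>

definition dir_deriv ::
  "('m, 'e::euclidean_space) chart set \<Rightarrow> 'm \<Rightarrow> ('m, 'e) tvec \<Rightarrow> ('m \<Rightarrow> real) \<Rightarrow> real"
  where "dir_deriv \<Phi> p x f =
    (let c = (SOME c. c \<in> \<Phi> \<and> p \<in> dom_chart c)
     in frechet_derivative (f \<circ> param c) (at (coord c p)) (x c))"

text \<open>The coordinate form, in every chart, of the derivation \<open>f \<mapsto> X (Y f) - Y (X f)\<close>.\<close>

definition lie_bracket ::
  "('m, 'e::euclidean_space) chart set \<Rightarrow> ('m \<Rightarrow> ('m, 'e) tvec) \<Rightarrow> ('m \<Rightarrow> ('m, 'e) tvec) \<Rightarrow>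
    'm \<Rightarrow> ('m, 'e) tvec"
  where "lie_bracket \<Phi> X Y p = (\<lambda>c.
    if c \<in> \<Phi> \<and> p \<in> dom_chart c
    then frechet_derivative (\<lambda>x. Y (param c x) c) (at (coord c p)) (X p c)
       - frechet_derivative (\<lambda>x. X (param c x) c) (at (coord c p)) (Y p c)
    else 0)"

definition field_ext ::
  "('m::{t2_space, second_countable_topology}, 'e::euclidean_space) chart set \<Rightarrow> 'm \<Rightarrow>
    ('m, 'e) tvec \<Rightarrow> 'm \<Rightarrow> ('m, 'e) tvec"
  where "field_ext \<Phi> p x = (SOME X. X \<in> vector_fields \<Phi> \<and> X p = x)"

definition aniso_fields ::
  "('m::{t2_space, second_countable_topology}, 'e::euclidean_space) chart set \<Rightarrow>
    ('m \<times> ('m, 'e) tvec) set \<Rightarrow> ('m \<times> ('m, 'e) tvec \<Rightarrow> ('m, 'e) tvec) set"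
  where "aniso_fields \<Phi> A = {\<Y>.
    (\<forall>v\<in>A. \<Y> v \<in> tspace \<Phi> (fst v)) \<and>
    (\<forall>c\<in>\<Phi>. smooth_on (in_chart \<Phi> c A) (\<lambda>\<xi>. \<Y> (tparam \<Phi> c \<xi>) c))}"

text \<open>The derivative at \<open>t = 0\<close> of the curve \<open>t \<mapsto> F (v + t z)\<close> in the tangent space at \<open>fst v\<close>,
  taken componentwise.\<close>

definition vert_deriv ::
  "('m \<times> ('m, 'e::euclidean_space) tvec \<Rightarrow> ('m, 'e) tvec) \<Rightarrow> 'm \<times> ('m, 'e) tvec \<Rightarrow>
    ('m, 'e) tvec \<Rightarrow> ('m, 'e) tvec"
  where "vert_deriv F v z =
    (\<lambda>c. vector_derivative (\<lambda>t. F (fst v, snd v + t *\<^sub>R z) c) (at 0))"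

type_synonym ('m, 'e) aconn =
  "'m \<times> ('m, 'e) tvec \<Rightarrow> ('m \<Rightarrow> ('m, 'e) tvec) \<Rightarrow> ('m \<Rightarrow> ('m, 'e) tvec) \<Rightarrow> ('m, 'e) tvec"

definition anisotropic_connection ::
  "('m::{t2_space, second_countable_topology}, 'e::euclidean_space) chart set \<Rightarrow>
    ('m \<times> ('m, 'e) tvec) set \<Rightarrow> ('m, 'e) aconn \<Rightarrow> bool"
  where "anisotropic_connection \<Phi> A nab \<longleftrightarrow>
    (\<forall>v\<in>A. \<forall>X\<in>vector_fields \<Phi>. \<forall>Y\<in>vector_fields \<Phi>. \<forall>Z\<in>vector_fields \<Phi>.
      nab v X (Y + Z) = nab v X Y + nab v X Z) \<and>
    (\<forall>v\<in>A. \<forall>X\<in>vector_fields \<Phi>. \<forall>Y\<in>vector_fields \<Phi>. \<forall>f\<in>smooth_functions \<Phi>.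
      nab v X (\<lambda>p. f p *\<^sub>R Y p) =
        dir_deriv \<Phi> (fst v) (X (fst v)) f *\<^sub>R Y (fst v) + f (fst v) *\<^sub>R nab v X Y) \<and>
    (\<forall>v\<in>A. \<forall>X\<in>vector_fields \<Phi>. \<forall>Y\<in>vector_fields \<Phi>. \<forall>Z\<in>vector_fields \<Phi>.
      \<forall>f\<in>smooth_functions \<Phi>. \<forall>h\<in>smooth_functions \<Phi>.
      nab v (\<lambda>p. f p *\<^sub>R X p + h p *\<^sub>R Y p) Z =
        f (fst v) *\<^sub>R nab v X Z + h (fst v) *\<^sub>R nab v Y Z) \<and>
    (\<forall>X\<in>vector_fields \<Phi>. \<forall>Y\<in>vector_fields \<Phi>. (\<lambda>v. nab v X Y) \<in> aniso_fields \<Phi> A)"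

text \<open>A connection is local in its last argument, so it applies to fields that are smooth only near
  \<open>fst v\<close>, through any global field with the same germ at \<open>fst v\<close>.\<close>

definition nab_local ::
  "('m::{t2_space, second_countable_topology}, 'e::euclidean_space) chart set \<Rightarrow>
    ('m, 'e) aconn \<Rightarrow> ('m, 'e) aconn"
  where "nab_local \<Phi> nab v X Y =
    nab v X (SOME Y'. Y' \<in> vector_fields \<Phi> \<and>
      (\<exists>N. open N \<and> fst v \<in> N \<and> (\<forall>q\<in>N. Y' q = Y q)))"

definition admissible_extension ::
  "('m::{t2_space, second_countable_topology}, 'e::euclidean_space) chart set \<Rightarrow>
    ('m \<times> ('m, 'e) tvec) set \<Rightarrow> 'm \<times> ('m, 'e) tvec \<Rightarrow> 'm set \<Rightarrow> ('m \<Rightarrow> ('m, 'e) tvec) \<Rightarrow> bool"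
  where "admissible_extension \<Phi> A v \<Omega> V \<longleftrightarrow>
    open \<Omega> \<and> fst v \<in> \<Omega> \<and> V \<in> vector_fields_on \<Phi> \<Omega> \<and> (\<forall>p\<in>\<Omega>. (p, V p) \<in> A) \<and>
    V (fst v) = snd v"

text \<open>The covariant derivative of an anisotropic field; it does not depend on the extension \<open>V\<close>.\<close>

definition nab_aniso ::
  "('m::{t2_space, second_countable_topology}, 'e::euclidean_space) chart set \<Rightarrow>
    ('m \<times> ('m, 'e) tvec) set \<Rightarrow> ('m, 'e) aconn \<Rightarrow> 'm \<times> ('m, 'e) tvec \<Rightarrow>
    ('m \<Rightarrow> ('m, 'e) tvec) \<Rightarrow> ('m \<times> ('m, 'e) tvec \<Rightarrow> ('m, 'e) tvec) \<Rightarrow> ('m, 'e) tvec"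
  where "nab_aniso \<Phi> A nab v X \<Y> =
    (let V = (SOME V. \<exists>\<Omega>. admissible_extension \<Phi> A v \<Omega> V)
     in nab_local \<Phi> nab v X (\<lambda>p. \<Y> (p, V p)) - vert_deriv \<Y> v (nab_local \<Phi> nab v X V))"

text \<open>Each of these is an anisotropic tensor, so its value on tangent vectors is obtained from
  arbitrary vector fields extending them.\<close>

definition torsion ::
  "('m::{t2_space, second_countable_topology}, 'e::euclidean_space) chart set \<Rightarrow>
    ('m, 'e) aconn \<Rightarrow> 'm \<times> ('m, 'e) tvec \<Rightarrow> ('m, 'e) tvec \<Rightarrow> ('m, 'e) tvec \<Rightarrow> ('m, 'e) tvec"
  where "torsion \<Phi> nab v x y =
    (let X = field_ext \<Phi> (fst v) x; Y = field_ext \<Phi> (fst v) y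
     in nab v X Y - nab v Y X - lie_bracket \<Phi> X Y (fst v))"

definition conn_vert_deriv ::
  "('m::{t2_space, second_countable_topology}, 'e::euclidean_space) chart set \<Rightarrow>
    ('m, 'e) aconn \<Rightarrow> 'm \<times> ('m, 'e) tvec \<Rightarrow>
    ('m, 'e) tvec \<Rightarrow> ('m, 'e) tvec \<Rightarrow> ('m, 'e) tvec \<Rightarrow> ('m, 'e) tvec"
  where "conn_vert_deriv \<Phi> nab v x y z =
    (let X = field_ext \<Phi> (fst v) x; Y = field_ext \<Phi> (fst v) y
     in vert_deriv (\<lambda>v'. nab v' X Y) v z)"

definition curvature ::
  "('m::{t2_space, second_countable_topology}, 'e::euclidean_space) chart set \<Rightarrow>
    ('m \<times> ('m, 'e) tvec) set \<Rightarrow> ('m, 'e) aconn \<Rightarrow> 'm \<times> ('m, 'e) tvec \<Rightarrow>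
    ('m, 'e) tvec \<Rightarrow> ('m, 'e) tvec \<Rightarrow> ('m, 'e) tvec \<Rightarrow> ('m, 'e) tvec"
  where "curvature \<Phi> A nab v x y z =
    (let X = field_ext \<Phi> (fst v) x; Y = field_ext \<Phi> (fst v) y; Z = field_ext \<Phi> (fst v) z
     in nab_aniso \<Phi> A nab v X (\<lambda>v'. nab v' Y Z) - nab_aniso \<Phi> A nab v Y (\<lambda>v'. nab v' X Z)
        - nab v (lie_bracket \<Phi> X Y) Z)"

text \<open>A tensor \<open>T\<close> is given by its values \<open>T v x1 x2 x3\<close> on tangent vectors at \<open>fst v\<close>.\<close>

type_synonym ('m, 'e) tensor13 =
  "'m \<times> ('m, 'e) tvec \<Rightarrow> ('m, 'e) tvec \<Rightarrow> ('m, 'e) tvec \<Rightarrow> ('m, 'e) tvec \<Rightarrow> ('m, 'e) tvec"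

definition tensor_vert_deriv ::
  "('m, 'e::euclidean_space) tensor13 \<Rightarrow> 'm \<times> ('m, 'e) tvec \<Rightarrow>
    ('m, 'e) tvec \<Rightarrow> ('m, 'e) tvec \<Rightarrow> ('m, 'e) tvec \<Rightarrow> ('m, 'e) tvec \<Rightarrow> ('m, 'e) tvec"
  where "tensor_vert_deriv T v x1 x2 x3 z = vert_deriv (\<lambda>v'. T v' x1 x2 x3) v z"

definition tensor_cov_deriv ::
  "('m::{t2_space, second_countable_topology}, 'e::euclidean_space) chart set \<Rightarrow>
    ('m \<times> ('m, 'e) tvec) set \<Rightarrow> ('m, 'e) aconn \<Rightarrow> ('m, 'e) tensor13 \<Rightarrow>
    'm \<times> ('m, 'e) tvec \<Rightarrow> ('m, 'e) tvec \<Rightarrow>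
    ('m, 'e) tvec \<Rightarrow> ('m, 'e) tvec \<Rightarrow> ('m, 'e) tvec \<Rightarrow> ('m, 'e) tvec"
  where "tensor_cov_deriv \<Phi> A nab T v x x1 x2 x3 =
    (let X = field_ext \<Phi> (fst v) x;
         X1 = field_ext \<Phi> (fst v) x1;
         X2 = field_ext \<Phi> (fst v) x2;
         X3 = field_ext \<Phi> (fst v) x3
     in nab_aniso \<Phi> A nab v X (\<lambda>v'. T v' (X1 (fst v')) (X2 (fst v')) (X3 (fst v')))
        - T v (nab v X X1) x2 x3 - T v x1 (nab v X X2) x3 - T v x1 x2 (nab v X X3))"

end

theory Submission
  imports Defs
begin

text \<open>In a chart, \<open>\<nabla>\<^sub>X Y = DY(X) + \<Gamma>(x, y)(X, Y)\<close> with Christoffel symbols \<open>\<Gamma>\<close> that are smooth in the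
  point \<open>(x, y)\<close> of \<open>A\<close> and bilinear in \<open>(X, Y)\<close>.  Then \<open>P(X, Y, Z) = D\<^sub>2\<Gamma>[Z](X, Y)\<close>, the torsion is the
  antisymmetrisation of \<open>\<Gamma>\<close>, and \<open>R(u, w)z\<close> is the antisymmetrisation in \<open>u, w\<close> of
  \<open>D\<^sub>1\<Gamma>[u](w, z) - D\<^sub>2\<Gamma>[\<Gamma>(u, y)](w, z) + \<Gamma>(u, \<Gamma>(w, z))\<close>.  Differentiating the latter in the
  vertical direction \<open>b\<close> and expanding \<open>\<nabla>P\<close>, the identity reduces to the symmetry of the second
  derivatives of \<open>\<Gamma>\<close>.  All computations are done for one component of a tangent vector at a time.\<close>

subsection \<open>Derivatives\<close>

text \<open>A tangent vector is a family indexed by all charts, so the identity is proved index by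
  index: at a chart around the point with the Christoffel symbols of that chart, at any other index
  because both sides vanish there. The latter is why every quantity must be shown to be tangent. The
  obstacle is that a connection acts on global fields only, while \<open>P\<close>,
  \<open>\<T>\<close>, \<open>R\<close> and \<open>\<nabla>P\<close> are defined through extensions
  selected by \<open>SOME\<close>. The selection is made anew at each base point, with no continuity
  between neighbouring points, so none of these quantities can be differentiated from its
  definition. Bump functions show that the extensions exist; then each quantity receives a component
  formula from which the derivatives of the selected fields have disappeared, and only this formula
  is differentiated further. Symmetry of second derivatives enters three times: for transition maps
  (the Lie bracket is tangent), for components of vector fields (the curvature depends on values
  only), and for \<open>\<Gamma>\<close> itself.\<close>

abbreviation FD :: "('a::real_normed_vector \<Rightarrow> 'b::real_normed_vector) \<Rightarrow> 'a \<Rightarrow> 'a \<Rightarrow> 'b"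
  where "FD f x \<equiv> frechet_derivative f (at x)"

lemma has_derivative_FD:
  "f differentiable at x \<Longrightarrow> (f has_derivative FD f x) (at x)"
  by (simp add: frechet_derivative_works)

lemma FD_eqI: "(f has_derivative D) (at x) \<Longrightarrow> FD f x = D"
  using frechet_derivative_at by metis

lemma has_derivative_cong_open:
  assumes "open S" "x \<in> S" "\<And>y. y \<in> S \<Longrightarrow> f y = g y"
  shows "(f has_derivative D) (at x) \<longleftrightarrow> (g has_derivative D) (at x)"
  using assms by (metis has_derivative_transform_within_open)

lemma FD_cong:
  assumes "open S" "x \<in> S" "\<And>y. y \<in> S \<Longrightarrow> f y = g y"
  shows "FD f x = FD g x"
  unfolding frechet_derivative_def using has_derivative_cong_open[OF assms] by presburger

lemma differentiable_cong_open:
  assumes "open S" "x \<in> S" "\<And>y. y \<in> S \<Longrightarrow> f y = g y"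
  shows "f differentiable at x \<longleftrightarrow> g differentiable at x"
  unfolding differentiable_def by (simp add: has_derivative_cong_open[OF assms])

lemma linear_Basis_expand:
  fixes L :: "'a::euclidean_space \<Rightarrow> 'b::real_vector"
  assumes "linear L"
  shows "L a = (\<Sum>i\<in>Basis. (a \<bullet> i) *\<^sub>R L i)"
proof -
  have "L a = L (\<Sum>i\<in>Basis. (a \<bullet> i) *\<^sub>R i)" by (simp add: euclidean_representation)
  also have "\<dots> = (\<Sum>i\<in>Basis. (a \<bullet> i) *\<^sub>R L i)"
    by (simp only: linear_sum[OF assms] linear_cmul[OF assms])
  finally show ?thesis .
qed

text \<open>Multilinear families are differentiated by applying this one slot at a time.\<close>

lemma has_derivative_linear_family:
  fixes M :: "'s::real_normed_vector \<Rightarrow> 'a::euclidean_space \<Rightarrow> 'b::real_normed_vector"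
  assumes S: "open S" "s \<in> S" and lin: "\<And>s. s \<in> S \<Longrightarrow> linear (M s)"
    and D: "\<And>a. ((\<lambda>s. M s a) has_derivative D a) (at s)"
    and g: "(g has_derivative g') (at s)"
  shows "((\<lambda>s. M s (g s)) has_derivative (\<lambda>d. D (g s) d + M s (g' d))) (at s)"
proof -
  \<comment> \<open>The hypotheses do not say that the derivative \<open>D a\<close> is linear in
    \<open>a\<close>; this follows from uniqueness of derivatives, and it lets the final sum over
    the basis be folded back into \<open>D (g s) d\<close>.\<close>
  have "D a = (\<lambda>d. \<Sum>i\<in>Basis. (a \<bullet> i) *\<^sub>R D i d)" for a
  proof (rule has_derivative_unique[OF D])
    have "((\<lambda>s. \<Sum>i\<in>Basis. (a \<bullet> i) *\<^sub>R M s i) has_derivative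
        (\<lambda>d. \<Sum>i\<in>Basis. (a \<bullet> i) *\<^sub>R D i d)) (at s)"
      by (intro has_derivative_sum has_derivative_scaleR_right D)
    then show "((\<lambda>s. M s a) has_derivative (\<lambda>d. \<Sum>i\<in>Basis. (a \<bullet> i) *\<^sub>R D i d)) (at s)"
      by (rule has_derivative_transform_within_open[OF _ S])
         (simp flip: linear_Basis_expand[OF lin])
  qed
  then have Dg: "D (g s) d = (\<Sum>i\<in>Basis. (g s \<bullet> i) *\<^sub>R D i d)" for d by metis
  have "((\<lambda>s. \<Sum>i\<in>Basis. (g s \<bullet> i) *\<^sub>R M s i) has_derivative
      (\<lambda>d. \<Sum>i\<in>Basis. (g s \<bullet> i) *\<^sub>R D i d + (g' d \<bullet> i) *\<^sub>R M s i)) (at s)"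
    by (intro has_derivative_sum has_derivative_scaleR has_derivative_inner_left D g)
  then have "((\<lambda>s. M s (g s)) has_derivative
      (\<lambda>d. \<Sum>i\<in>Basis. (g s \<bullet> i) *\<^sub>R D i d + (g' d \<bullet> i) *\<^sub>R M s i)) (at s)"
    by (rule has_derivative_transform_within_open[OF _ S])
       (simp flip: linear_Basis_expand[OF lin])
  then show ?thesis
    by (simp add: sum.distrib Dg flip: linear_Basis_expand[OF lin[OF S(2)]])
qed

subsection \<open>Smooth functions\<close>

lemma Ck_on_cong:
  assumes "open S" "\<And>x. x \<in> S \<Longrightarrow> f x = g x"
  shows "Ck_on k S f \<longleftrightarrow> Ck_on k S g"
  using assms(2)
proof (induction k arbitrary: f g)
  case 0 then show ?case by (simp cong: continuous_on_cong)
next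
  case (Suc k)
  have "Ck_on k S (\<lambda>x. FD f x h) \<longleftrightarrow> Ck_on k S (\<lambda>x. FD g x h)" for h
    by (rule Suc.IH) (simp add: FD_cong[OF assms(1) _ Suc.prems])
  then show ?case
    using differentiable_cong_open[OF assms(1) _ Suc.prems] by auto
qed

lemma Ck_on_subset: "Ck_on k T f \<Longrightarrow> S \<subseteq> T \<Longrightarrow> Ck_on k S f"
  by (induction k arbitrary: f) (auto intro: continuous_on_subset)

lemma Ck_on_continuous: "Ck_on k S f \<Longrightarrow> continuous_on S f"
  by (cases k) (auto intro!: continuous_at_imp_continuous_on differentiable_imp_continuous_within)

text \<open>Level \<open>Suc k\<close> speaks of the derivatives only, so the descent is an
  induction whose base case is that differentiability implies continuity.\<close>

lemma Ck_on_SucD: "Ck_on (Suc k) S f \<Longrightarrow> Ck_on k S f"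
proof (induction k arbitrary: f)
  case 0 then show ?case using Ck_on_continuous[of "Suc 0"] by simp
qed auto

text \<open>Lets the derivative be supplied in whatever form the product or chain rule produces. The
  closure properties below are inductions on \<open>k\<close> through this rule.\<close>

lemma Ck_on_SucI:
  assumes "open S" "\<And>x. x \<in> S \<Longrightarrow> (f has_derivative D x) (at x)" "\<And>h. Ck_on k S (\<lambda>x. D x h)"
  shows "Ck_on (Suc k) S f"
proof -
  have "Ck_on k S (\<lambda>x. FD f x h)" for h
    using assms(3)[of h] Ck_on_cong[OF assms(1), of "\<lambda>x. FD f x h" "\<lambda>x. D x h"]
    by (simp add: FD_eqI[OF assms(2)])
  then show ?thesis using assms(2) by (auto simp: differentiable_def)
qed

text \<open>Derivatives are those of the whole space and hence do not see the set; locality has to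
  be argued only for continuity at level 0. Smoothness is later glued from neighbourhoods in this
  way.\<close>

lemma Ck_on_local:
  assumes "\<And>x. x \<in> S \<Longrightarrow> \<exists>U. open U \<and> x \<in> U \<and> Ck_on k (U \<inter> S) f"
  shows "Ck_on k S f"
  using assms
proof (induction k arbitrary: f)
  case 0
  show ?case unfolding Ck_on.simps continuous_on_eq_continuous_within
  proof
    fix x assume "x \<in> S"
    then obtain U where "open U" "x \<in> U" "continuous_on (U \<inter> S) f" using 0 by force
    then have "continuous (at x within U \<inter> S) f"
      using \<open>x \<in> S\<close> by (simp add: continuous_on_eq_continuous_within)
    moreover have "at x within U \<inter> S = at x within S"
      using \<open>open U\<close> \<open>x \<in> U\<close> by (intro at_within_nhd[of x U]) auto
    ultimately show "continuous (at x within S) f" by simp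
  qed
next
  case (Suc k)
  show ?case unfolding Ck_on.simps
  proof (intro conjI ballI allI)
    show "f differentiable at x" if "x \<in> S" for x using Suc.prems[OF that] that by auto
    show "Ck_on k S (\<lambda>x. FD f x h)" for h
      by (rule Suc.IH) (use Suc.prems in \<open>simp, blast\<close>)
  qed
qed

lemma Ck_on_const: "open S \<Longrightarrow> Ck_on k S (\<lambda>x. c)"
  by (induction k arbitrary: c) auto

lemma Ck_on_bounded_linear:
  assumes S: "open S" and L: "bounded_linear L" and f: "Ck_on k S f"
  shows "Ck_on k S (\<lambda>x. L (f x))"
  using f
proof (induction k arbitrary: f)
  case 0 then show ?case
    using linear_continuous_on_compose[of S f L] bounded_linear.linear[OF L]
    by (simp add: L bounded_linear.continuous_on)
next
  case (Suc k)
  show ?case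
  proof (rule Ck_on_SucI[OF S])
    show "((\<lambda>x. L (f x)) has_derivative (\<lambda>h. L (FD f x h))) (at x)" if "x \<in> S" for x
      using Suc.prems that by (intro bounded_linear.has_derivative[OF L] has_derivative_FD) auto
    show "Ck_on k S (\<lambda>x. L (FD f x h))" for h using Suc by auto
  qed
qed

lemma Ck_on_add:
  assumes S: "open S" and "Ck_on k S f" "Ck_on k S g"
  shows "Ck_on k S (\<lambda>x. f x + g x)"
  using assms(2-)
proof (induction k arbitrary: f g)
  case 0 then show ?case by (simp add: continuous_on_add)
next
  case (Suc k)
  show ?case
  proof (rule Ck_on_SucI[OF S])
    show "((\<lambda>x. f x + g x) has_derivative (\<lambda>h. FD f x h + FD g x h)) (at x)" if "x \<in> S" for x
      using Suc.prems that by (intro has_derivative_add has_derivative_FD) auto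
    show "Ck_on k S (\<lambda>x. FD f x h + FD g x h)" for h using Suc by auto
  qed
qed

lemma Ck_on_scaleR:
  fixes f :: "'a::euclidean_space \<Rightarrow> real"
  assumes S: "open S" and "Ck_on k S f" "Ck_on k S g"
  shows "Ck_on k S (\<lambda>x. f x *\<^sub>R g x)"
  using assms(2-)
proof (induction k arbitrary: f g)
  case 0 then show ?case by (simp add: continuous_on_scaleR)
next
  case (Suc k)
  show ?case
  proof (rule Ck_on_SucI[OF S])
    show "((\<lambda>x. f x *\<^sub>R g x) has_derivative (\<lambda>h. f x *\<^sub>R FD g x h + FD f x h *\<^sub>R g x)) (at x)"
      if "x \<in> S" for x
      using Suc.prems that by (intro has_derivative_scaleR has_derivative_FD) auto
    have "Ck_on k S (\<lambda>x. FD f x h)" "Ck_on k S (\<lambda>x. FD g x h)" for h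
      using Suc.prems by auto
    then show "Ck_on k S (\<lambda>x. f x *\<^sub>R FD g x h + FD f x h *\<^sub>R g x)" for h
      using Suc.prems[THEN Ck_on_SucD] by (intro Ck_on_add[OF S] Suc.IH)
  qed
qed

lemma Ck_on_sum:
  assumes "open S" "\<And>i. i \<in> I \<Longrightarrow> Ck_on k S (f i)"
  shows "Ck_on k S (\<lambda>x. \<Sum>i\<in>I. f i x)"
  using assms(2)
  by (induction I rule: infinite_finite_induct)
     (auto intro!: Ck_on_const Ck_on_add \<open>open S\<close>)

text \<open>In \<open>FD g (f x) (FD f x h)\<close> the direction varies with \<open>x\<close>,
  whereas the induction hypothesis covers fixed directions. Expanding the direction in the basis
  leaves products of scalar functions with derivatives of \<open>g\<close> in fixed
  directions.\<close>

lemma Ck_on_compose: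
  assumes S: "open S" and T: "open T" and f: "Ck_on k S f" and fST: "f ` S \<subseteq> T"
    and g: "Ck_on k T g"
  shows "Ck_on k S (\<lambda>x. g (f x))"
  using f g
proof (induction k arbitrary: g)
  case 0 then show ?case using fST by (auto intro: continuous_on_compose2)
next
  case (Suc k)
  have fk: "Ck_on k S f" using Ck_on_SucD Suc.prems(1) by blast
  have dg: "g differentiable at (f x)" if "x \<in> S" for x using Suc.prems(2) fST that by auto
  show ?case
  proof (rule Ck_on_SucI[OF S])
    show "((\<lambda>x. g (f x)) has_derivative
        (\<lambda>h. \<Sum>i\<in>Basis. (FD f x h \<bullet> i) *\<^sub>R FD g (f x) i)) (at x)" if "x \<in> S" for x
    proof -
      have "((\<lambda>x. g (f x)) has_derivative (\<lambda>h. FD g (f x) (FD f x h))) (at x)"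
        using Suc.prems(1) that
        by (intro has_derivative_compose[where f = f and g = g] has_derivative_FD dg[OF that]) auto
      then show ?thesis
        using linear_Basis_expand[OF linear_frechet_derivative[OF dg[OF that]], of "FD f x _"]
        by (simp cong: if_cong)
    qed
    have "Ck_on k S (\<lambda>x. FD f x h \<bullet> i)" for h i
      using Suc.prems(1) by (intro Ck_on_bounded_linear[OF S bounded_linear_inner_left]) auto
    moreover have "Ck_on k S (\<lambda>x. FD g (f x) i)" for i
      using Suc.prems(2) by (intro Suc.IH fk) auto
    ultimately show "Ck_on k S (\<lambda>x. \<Sum>i\<in>Basis. (FD f x h \<bullet> i) *\<^sub>R FD g (f x) i)" for h
      by (intro Ck_on_sum Ck_on_scaleR S)
  qed
qed

lemma smooth_onI:
  assumes "open S" "\<And>x. x \<in> S \<Longrightarrow> (f has_derivative D x) (at x)" "\<And>h. smooth_on S (\<lambda>x. D x h)"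
  shows "smooth_on S f"
  unfolding smooth_on_def
proof
  fix k
  have "Ck_on (Suc k) S f"
    using assms by (intro Ck_on_SucI) (auto simp: smooth_on_def)
  then show "Ck_on k S f" by (rule Ck_on_SucD)
qed

lemma smooth_on_differentiable: "smooth_on S f \<Longrightarrow> x \<in> S \<Longrightarrow> f differentiable at x"
  unfolding smooth_on_def by (metis Ck_on.simps(2))

lemma smooth_on_has_derivative: "smooth_on S f \<Longrightarrow> x \<in> S \<Longrightarrow> (f has_derivative FD f x) (at x)"
  by (simp add: has_derivative_FD smooth_on_differentiable)

lemma smooth_on_FD: "smooth_on S f \<Longrightarrow> smooth_on S (\<lambda>x. FD f x h)"
  unfolding smooth_on_def by (metis Ck_on.simps(2))

lemma smooth_on_continuous_on: "smooth_on S f \<Longrightarrow> continuous_on S f"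
  unfolding smooth_on_def by (metis Ck_on.simps(1))

lemma smooth_on_cong:
  "open S \<Longrightarrow> (\<And>x. x \<in> S \<Longrightarrow> f x = g x) \<Longrightarrow> smooth_on S f \<longleftrightarrow> smooth_on S g"
  unfolding smooth_on_def using Ck_on_cong by blast

lemma smooth_on_subset: "smooth_on T f \<Longrightarrow> S \<subseteq> T \<Longrightarrow> smooth_on S f"
  unfolding smooth_on_def using Ck_on_subset by blast

lemma smooth_on_local:
  assumes "\<And>x. x \<in> S \<Longrightarrow> \<exists>U. open U \<and> x \<in> U \<and> smooth_on U f"
  shows "smooth_on S f"
  unfolding smooth_on_def
proof
  fix k
  have "\<exists>U. open U \<and> x \<in> U \<and> Ck_on k (U \<inter> S) f" if "x \<in> S" for x
    using assms[OF that] Ck_on_subset[of k _ f] unfolding smooth_on_def by (metis inf_le1)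
  then show "Ck_on k S f" by (rule Ck_on_local)
qed

lemma smooth_on_const: "open S \<Longrightarrow> smooth_on S (\<lambda>x. c)"
  by (simp add: smooth_on_def Ck_on_const)

lemma smooth_on_ident: "open S \<Longrightarrow> smooth_on S (\<lambda>x. x)"
  by (rule smooth_onI[where D = "\<lambda>x h. h"]) (auto intro: smooth_on_const)

lemma smooth_on_bounded_linear:
  "open S \<Longrightarrow> bounded_linear L \<Longrightarrow> smooth_on S f \<Longrightarrow> smooth_on S (\<lambda>x. L (f x))"
  by (simp add: smooth_on_def Ck_on_bounded_linear)

lemma smooth_on_inner: "open S \<Longrightarrow> smooth_on S f \<Longrightarrow> smooth_on S (\<lambda>x. f x \<bullet> a)"
  by (rule smooth_on_bounded_linear[OF _ bounded_linear_inner_left])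

lemma smooth_on_add:
  "open S \<Longrightarrow> smooth_on S f \<Longrightarrow> smooth_on S g \<Longrightarrow> smooth_on S (\<lambda>x. f x + g x)"
  by (simp add: smooth_on_def Ck_on_add)

lemma smooth_on_scaleR:
  "open S \<Longrightarrow> smooth_on S f \<Longrightarrow> smooth_on S g \<Longrightarrow> smooth_on S (\<lambda>x. f x *\<^sub>R g x)"
  by (simp add: smooth_on_def Ck_on_scaleR)

lemma smooth_on_mult:
  fixes f g :: "'a::euclidean_space \<Rightarrow> real"
  shows "open S \<Longrightarrow> smooth_on S f \<Longrightarrow> smooth_on S g \<Longrightarrow> smooth_on S (\<lambda>x. f x * g x)"
  using smooth_on_scaleR[of S f g] by simp

lemma smooth_on_diff:
  assumes "open S" "smooth_on S f" "smooth_on S g"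
  shows "smooth_on S (\<lambda>x. f x - g x)"
proof -
  have "smooth_on S (\<lambda>x. f x + (- 1) *\<^sub>R g x)"
    by (intro smooth_on_add smooth_on_scaleR smooth_on_const assms)
  then show ?thesis by simp
qed

lemma smooth_on_sum:
  "open S \<Longrightarrow> (\<And>i. i \<in> I \<Longrightarrow> smooth_on S (f i)) \<Longrightarrow> smooth_on S (\<lambda>x. \<Sum>i\<in>I. f i x)"
  by (simp add: smooth_on_def Ck_on_sum)

lemma smooth_on_compose:
  "open S \<Longrightarrow> open T \<Longrightarrow> smooth_on S f \<Longrightarrow> f ` S \<subseteq> T \<Longrightarrow> smooth_on T g \<Longrightarrow>
    smooth_on S (\<lambda>x. g (f x))"
  unfolding smooth_on_def using Ck_on_compose by blast

lemma smooth_on_Pair: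
  fixes f :: "'a::euclidean_space \<Rightarrow> 'b::euclidean_space"
    and g :: "'a::euclidean_space \<Rightarrow> 'c::euclidean_space"
  assumes "open S" "smooth_on S f" "smooth_on S g"
  shows "smooth_on S (\<lambda>x. (f x, g x))"
proof -
  have "smooth_on S (\<lambda>x. (f x, 0::'c) + (0::'b, g x))"
    by (intro smooth_on_add assms smooth_on_bounded_linear[of S "\<lambda>y. (y, 0)"]
        smooth_on_bounded_linear[of S "\<lambda>y. (0, y)"])
       (auto intro: bounded_linear_Pair bounded_linear_ident bounded_linear_zero)
  then show ?thesis by simp
qed

lemma smooth_on_fst:
  fixes f :: "'a::euclidean_space \<Rightarrow> 'b::euclidean_space \<times> 'c::euclidean_space"
  shows "open S \<Longrightarrow> smooth_on S f \<Longrightarrow> smooth_on S (\<lambda>x. fst (f x))"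
  by (rule smooth_on_bounded_linear[OF _ bounded_linear_fst])

text \<open>Smoothness for each fixed argument suffices because a linear map is determined by its
  finitely many values on the basis.\<close>

lemma smooth_on_linear_family:
  fixes M :: "'s::euclidean_space \<Rightarrow> 'a::euclidean_space \<Rightarrow> 'b::euclidean_space"
  assumes S: "open S" and M: "\<And>a. smooth_on S (\<lambda>s. M s a)"
    and lin: "\<And>s. s \<in> S \<Longrightarrow> linear (M s)" and g: "smooth_on S g"
  shows "smooth_on S (\<lambda>s. M s (g s))"
proof -
  have "smooth_on S (\<lambda>s. \<Sum>i\<in>Basis. (g s \<bullet> i) *\<^sub>R M s i)"
    by (intro smooth_on_sum smooth_on_scaleR smooth_on_inner S M g)
  then show ?thesis
    by (subst smooth_on_cong[OF S, of _ "\<lambda>s. \<Sum>i\<in>Basis. (g s \<bullet> i) *\<^sub>R M s i"])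
       (auto intro: linear_Basis_expand lin)
qed

lemma smooth_on_FD_app:
  assumes S: "open S" and f: "smooth_on S f" and g: "smooth_on S g"
  shows "smooth_on S (\<lambda>x. FD f x (g x))"
  by (rule smooth_on_linear_family[OF S smooth_on_FD[OF f] _ g])
     (simp add: linear_frechet_derivative smooth_on_differentiable[OF f])

lemma linear_FD: "smooth_on S f \<Longrightarrow> x \<in> S \<Longrightarrow> linear (FD f x)"
  by (simp add: linear_frechet_derivative smooth_on_differentiable)

subsection \<open>Symmetry of second derivatives\<close>

text \<open>The mean value theorem is used twice, along \<open>h\<close> and then along
  \<open>k\<close>. The left-hand side is symmetric in \<open>h\<close> and \<open>k\<close>, while
  the right-hand side differentiates in a definite order; comparing both orders gives the symmetry
  of second derivatives.\<close>

lemma second_difference_mvt: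
  fixes f :: "'a::euclidean_space \<Rightarrow> real"
  assumes f: "smooth_on S f" and e: "0 < e"
    and sub: "\<And>s t. 0 \<le> s \<Longrightarrow> s \<le> e \<Longrightarrow> 0 \<le> t \<Longrightarrow> t \<le> e \<Longrightarrow> x + s *\<^sub>R h + t *\<^sub>R k \<in> S"
  shows "\<exists>s t. 0 \<le> s \<and> s \<le> e \<and> 0 \<le> t \<and> t \<le> e \<and>
    f (x + e *\<^sub>R h + e *\<^sub>R k) - f (x + e *\<^sub>R h) - f (x + e *\<^sub>R k) + f x
      = e * (e * FD (\<lambda>y. FD f y h) (x + s *\<^sub>R h + t *\<^sub>R k) k)"
proof -
  have D: "((\<lambda>r. g (a + r *\<^sub>R d)) has_real_derivative FD g (a + r *\<^sub>R d) d) (at r)"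
    if "smooth_on S g" "a + r *\<^sub>R d \<in> S" for g :: "'a \<Rightarrow> real" and a d r
  proof -
    have "((\<lambda>r. g (a + r *\<^sub>R d)) has_derivative (\<lambda>u. FD g (a + r *\<^sub>R d) (u *\<^sub>R d))) (at r)"
      by (rule has_derivative_compose[where g = g and f = "\<lambda>r. a + r *\<^sub>R d", OF _ smooth_on_has_derivative[OF that]])
         (auto intro!: derivative_eq_intros)
    then show ?thesis
      by (simp add: has_field_derivative_def linear_cmul[OF linear_FD[OF that]] mult_commute_abs)
  qed
  \<comment> \<open>The second difference is the increment from 0 to \<open>e\<close> of this first
    difference in the direction \<open>k\<close>.\<close>
  let ?\<phi> = "\<lambda>s. f (x + s *\<^sub>R h + e *\<^sub>R k) - f (x + s *\<^sub>R h)"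
  have "\<exists>s>0. s < e \<and> ?\<phi> e - ?\<phi> 0
      = (e - 0) * (FD f (x + s *\<^sub>R h + e *\<^sub>R k) h - FD f (x + s *\<^sub>R h) h)"
  proof (rule MVT2[OF e])
    fix s assume s: "0 \<le> s" "s \<le> e"
    have "((\<lambda>s. f ((x + e *\<^sub>R k) + s *\<^sub>R h)) has_real_derivative
        FD f ((x + e *\<^sub>R k) + s *\<^sub>R h) h) (at s)"
      using sub[of s e] s e by (intro D f) (simp add: add_ac)
    moreover have "((\<lambda>s. f (x + s *\<^sub>R h)) has_real_derivative FD f (x + s *\<^sub>R h) h) (at s)"
      using sub[of s 0] s e by (intro D f) simp
    ultimately show "(?\<phi> has_real_derivative
        FD f (x + s *\<^sub>R h + e *\<^sub>R k) h - FD f (x + s *\<^sub>R h) h) (at s)"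
      by (auto intro!: DERIV_diff simp: add_ac)
  qed
  then obtain s where s: "0 < s" "s < e"
    and 1: "?\<phi> e - ?\<phi> 0 = e * (FD f (x + s *\<^sub>R h + e *\<^sub>R k) h - FD f (x + s *\<^sub>R h) h)" by auto
  have "\<exists>t>0. t < e \<and> FD f (x + s *\<^sub>R h + e *\<^sub>R k) h - FD f (x + s *\<^sub>R h + 0 *\<^sub>R k) h
      = (e - 0) * FD (\<lambda>y. FD f y h) (x + s *\<^sub>R h + t *\<^sub>R k) k"
    using s sub by (intro MVT2[OF e] D[of "\<lambda>y. FD f y h"] smooth_on_FD f) auto
  then obtain t where t: "0 < t" "t < e"
    and 2: "FD f (x + s *\<^sub>R h + e *\<^sub>R k) h - FD f (x + s *\<^sub>R h) h
      = e * FD (\<lambda>y. FD f y h) (x + s *\<^sub>R h + t *\<^sub>R k) k" by auto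
  from 1 2 s t show ?thesis by (intro exI[of _ s] exI[of _ t]) auto
qed

lemma FD_inner:
  assumes "f differentiable at x"
  shows "FD (\<lambda>y. f y \<bullet> i) x h = FD f x h \<bullet> i"
  by (subst FD_eqI[OF has_derivative_inner_left[OF has_derivative_FD[OF assms]]]) simp

text \<open>Both mixed derivatives, each at some point of a small parallelogram, equal the same
  second difference divided by \<open>e * e\<close>. By continuity each is within
  \<open>\<epsilon> / 2\<close> of its value at \<open>x\<close>.\<close>

lemma second_FD_symmetric_real:
  fixes f :: "'a::euclidean_space \<Rightarrow> real"
  assumes S: "open S" and f: "smooth_on S f" and x: "x \<in> S"
  shows "FD (\<lambda>y. FD f y h) x k = FD (\<lambda>y. FD f y k) x h"
proof -
  let ?F = "\<lambda>h k y. FD (\<lambda>y. FD f y h) y k"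
  have le: "\<bar>?F h k x - ?F k h x\<bar> \<le> \<epsilon>" if \<epsilon>: "0 < \<epsilon>" for \<epsilon>
  proof -
    have near: "\<exists>\<delta>>0. \<forall>y. dist y x < \<delta> \<longrightarrow> y \<in> S \<and> \<bar>?F h k y - ?F h k x\<bar> < \<epsilon> / 2" for h k
    proof -
      have "isCont (?F h k) x"
        using smooth_on_continuous_on[OF smooth_on_FD[OF smooth_on_FD[OF f]]] S x
        by (simp add: continuous_on_eq_continuous_at)
      then obtain \<delta>1 where "\<delta>1 > 0" "\<forall>y. dist y x < \<delta>1 \<longrightarrow> \<bar>?F h k y - ?F h k x\<bar> < \<epsilon> / 2"
        using half_gt_zero[OF \<epsilon>] unfolding continuous_at_eps_delta dist_real_def by blast
      moreover obtain \<delta>2 where "\<delta>2 > 0" "\<forall>y. dist y x < \<delta>2 \<longrightarrow> y \<in> S"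
        using S x unfolding open_dist by blast
      ultimately show ?thesis by (intro exI[of _ "min \<delta>1 \<delta>2"]) auto
    qed
    obtain \<delta>1 \<delta>2 where \<delta>: "\<delta>1 > 0" "\<delta>2 > 0"
      and \<delta>1: "\<And>y. dist y x < \<delta>1 \<Longrightarrow> y \<in> S \<and> \<bar>?F h k y - ?F h k x\<bar> < \<epsilon> / 2"
      and \<delta>2: "\<And>y. dist y x < \<delta>2 \<Longrightarrow> y \<in> S \<and> \<bar>?F k h y - ?F k h x\<bar> < \<epsilon> / 2"
      using near[of h k] near[of k h] by auto
    \<comment> \<open>This size keeps the whole parallelogram within
      \<open>min \<delta>1 \<delta>2\<close> of \<open>x\<close>. The summand 1 prevents a zero
      denominator and makes the distance estimate strict.\<close>
    define e where "e = min \<delta>1 \<delta>2 / (norm h + norm k + 1)"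
    have e: "0 < e" unfolding e_def using \<delta> by (intro divide_pos_pos) (auto simp: add_nonneg_pos)
    have close: "dist (x + s *\<^sub>R a + t *\<^sub>R b) x < min \<delta>1 \<delta>2"
      if "0 \<le> s" "s \<le> e" "0 \<le> t" "t \<le> e" "norm a + norm b = norm h + norm k" for s t a b
    proof -
      have "dist (x + s *\<^sub>R a + t *\<^sub>R b) x \<le> s * norm a + t * norm b"
        using norm_triangle_ineq[of "s *\<^sub>R a" "t *\<^sub>R b"] that by (simp add: dist_norm add.assoc)
      also have "\<dots> \<le> e * norm a + e * norm b"
        using that by (intro add_mono mult_right_mono) auto
      also have "\<dots> < e * (norm h + norm k + 1)"
        using e that(5) by (simp flip: distrib_left)
      also have "\<dots> = min \<delta>1 \<delta>2"
        unfolding e_def using norm_ge_zero[of h] norm_ge_zero[of k] by (simp add: add_nonneg_eq_0_iff)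
      finally show ?thesis .
    qed
    have inS: "x + s *\<^sub>R a + t *\<^sub>R b \<in> S"
      if "0 \<le> s" "s \<le> e" "0 \<le> t" "t \<le> e" "norm a + norm b = norm h + norm k" for s t a b
      using \<delta>1 close[OF that] by simp
    obtain s t where st: "0 \<le> s" "s \<le> e" "0 \<le> t" "t \<le> e" and
      1: "f (x + e *\<^sub>R h + e *\<^sub>R k) - f (x + e *\<^sub>R h) - f (x + e *\<^sub>R k) + f x
        = e * (e * ?F h k (x + s *\<^sub>R h + t *\<^sub>R k))"
      using second_difference_mvt[OF f e inS[OF _ _ _ _ refl]] by blast
    obtain s' t' where st': "0 \<le> s'" "s' \<le> e" "0 \<le> t'" "t' \<le> e" and
      2: "f (x + e *\<^sub>R k + e *\<^sub>R h) - f (x + e *\<^sub>R k) - f (x + e *\<^sub>R h) + f x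
        = e * (e * ?F k h (x + s' *\<^sub>R k + t' *\<^sub>R h))"
      using second_difference_mvt[OF f e inS[OF _ _ _ _ add.commute]] by blast
    have "e * (e * ?F h k (x + s *\<^sub>R h + t *\<^sub>R k)) = e * (e * ?F k h (x + s' *\<^sub>R k + t' *\<^sub>R h))"
      unfolding 1[symmetric] 2[symmetric] by (simp add: add_ac)
    then have "?F h k (x + s *\<^sub>R h + t *\<^sub>R k) = ?F k h (x + s' *\<^sub>R k + t' *\<^sub>R h)"
      using e by simp
    moreover have "\<bar>?F h k (x + s *\<^sub>R h + t *\<^sub>R k) - ?F h k x\<bar> < \<epsilon> / 2"
      using \<delta>1 close[OF st refl] by simp
    moreover have "\<bar>?F k h (x + s' *\<^sub>R k + t' *\<^sub>R h) - ?F k h x\<bar> < \<epsilon> / 2"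
      using \<delta>2 close[OF st', of k h] by simp
    ultimately show ?thesis by linarith
  qed
  have "d \<le> 0" if "\<And>\<epsilon>. 0 < \<epsilon> \<Longrightarrow> d \<le> \<epsilon>" for d :: real
    using that[of "d / 2"] by (cases "0 < d") auto
  from this[OF le] show ?thesis by simp
qed

text \<open>The mean value argument is real-valued, so it is applied to each coordinate of
  \<open>f\<close>.\<close>

lemma second_FD_symmetric:
  fixes f :: "'a::euclidean_space \<Rightarrow> 'b::euclidean_space"
  assumes S: "open S" and f: "smooth_on S f" and x: "x \<in> S"
  shows "FD (\<lambda>y. FD f y h) x k = FD (\<lambda>y. FD f y k) x h"
proof (rule euclidean_eqI)
  fix i :: 'b assume "i \<in> Basis"
  have comp: "FD (\<lambda>y. FD f y h) x k \<bullet> i = FD (\<lambda>y. FD (\<lambda>y. f y \<bullet> i) y h) x k" for h k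
  proof -
    have "FD (\<lambda>y. FD f y h) x k \<bullet> i = FD (\<lambda>y. FD f y h \<bullet> i) x k"
      by (rule FD_inner[symmetric]) (rule smooth_on_differentiable[OF smooth_on_FD[OF f] x])
    also have "\<dots> = FD (\<lambda>y. FD (\<lambda>y. f y \<bullet> i) y h) x k"
      by (subst FD_cong[OF S x]) (auto simp: FD_inner smooth_on_differentiable[OF f])
    finally show ?thesis .
  qed
  show "FD (\<lambda>y. FD f y h) x k \<bullet> i = FD (\<lambda>y. FD f y k) x h \<bullet> i"
    unfolding comp by (rule second_FD_symmetric_real[OF S smooth_on_inner[OF S f] x])
qed

subsection \<open>Bump functions\<close>

text \<open>For \<open>n = 0\<close> this is the classical smooth function that vanishes to infinite
  order at 0. The powers of \<open>1 / t\<close> are included because derivatives of members are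
  linear combinations of members, so that smoothness can be proved for all \<open>n\<close> at
  once.\<close>

definition flat :: "nat \<Rightarrow> real \<Rightarrow> real"
  where "flat n t = (if t \<le> 0 then 0 else (1 / t) ^ n * exp (- (1 / t)))"

text \<open>With \<open>s = 1 / t\<close> tending to infinity, the exponential dominates every power
  of \<open>s\<close>.\<close>

lemma flat_tendsto_0: "(flat n \<longlongrightarrow> 0) (at 0)"
proof (rule filterlim_split_at)
  show "(flat n \<longlongrightarrow> 0) (at_left 0)"
    by (rule tendsto_eventually) (auto simp: eventually_at_filter flat_def)
  have "((\<lambda>t. inverse t ^ n / exp (inverse t)) \<longlongrightarrow> 0) (at_right (0::real))"
    by (rule filterlim_compose[OF tendsto_power_div_exp_0 filterlim_inverse_at_top_right])
  then show "(flat n \<longlongrightarrow> 0) (at_right 0)"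
    by (rule Lim_transform_eventually)
       (auto simp: eventually_at_filter flat_def field_simps exp_minus)
qed

lemma flat_has_derivative:
  "(flat n has_real_derivative (flat (n + 2) t - real n * flat (n + 1) t)) (at t)"
proof -
  consider "t < 0" | "t > 0" | "t = 0" by linarith
  then show ?thesis
  proof cases
    case 1
    have "((\<lambda>t. 0) has_real_derivative flat (n + 2) t - real n * flat (n + 1) t) (at t)"
      using 1 by (simp add: flat_def)
    then show ?thesis
      by (rule has_field_derivative_transform_within_open[of _ _ _ "{..<0}"])
         (use 1 in \<open>auto simp: flat_def\<close>)
  next
    case 2
    define w where "w = 1 / t"
    have w: "((\<lambda>t. 1 / t) has_real_derivative - (w * w)) (at t)"
      using 2 by (auto intro!: derivative_eq_intros simp: w_def)
    have "((\<lambda>t. (1 / t) ^ n * exp (- (1 / t))) has_real_derivative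
        (real n * (1 / t) ^ (n - 1) * - (w * w)) * exp (- (1 / t)) +
        exp (- (1 / t)) * (w * w) * (1 / t) ^ n) (at t)"
      by (rule derivative_eq_intros w refl | simp)+
    also have "(real n * (1 / t) ^ (n - 1) * - (w * w)) * exp (- (1 / t)) +
        exp (- (1 / t)) * (w * w) * (1 / t) ^ n = flat (n + 2) t - real n * flat (n + 1) t"
      \<comment> \<open>The case split handles the truncated exponent \<open>n - 1\<close>, which
        for \<open>n = 0\<close> occurs with the factor 0.\<close>
      using 2 by (cases n) (simp_all add: flat_def algebra_simps flip: w_def)
    finally show ?thesis
      by (rule has_field_derivative_transform_within_open[of _ _ _ "{0<..}"])
         (use 2 in \<open>auto simp: flat_def\<close>)
  next
    case 3
    \<comment> \<open>The difference quotient of \<open>flat n\<close> at 0 is again a member of the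
      family, so its limit is already known.\<close>
    have "flat (Suc n) = (\<lambda>h. flat n h / h)"
      by (auto simp: flat_def fun_eq_iff)
    then have "((\<lambda>h. flat n h / h) \<longlongrightarrow> 0) (at 0)"
      using flat_tendsto_0[of "Suc n"] by simp
    then show ?thesis using 3 by (simp add: DERIV_def flat_def)
  qed
qed

lemma smooth_on_flat: "smooth_on UNIV (flat n)"
  unfolding smooth_on_def
proof
  fix k show "Ck_on k UNIV (flat n)"
  proof (induction k arbitrary: n)
    case 0
    show ?case
      by (auto intro!: continuous_at_imp_continuous_on DERIV_isCont[OF flat_has_derivative])
  next
    case (Suc k)
    show ?case
    proof (rule Ck_on_SucI)
      show "(flat n has_derivative (\<lambda>h. h *\<^sub>R (flat (n + 2) t + (- real n) *\<^sub>R flat (n + 1) t))) (at t)" for t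
        using flat_has_derivative[of n t] by (simp add: has_field_derivative_def mult_commute_abs)
      show "Ck_on k UNIV (\<lambda>t. h *\<^sub>R (flat (n + 2) t + (- real n) *\<^sub>R flat (n + 1) t))" for h
        by (intro Ck_on_scaleR Ck_on_add Ck_on_const Suc.IH open_UNIV)
    qed simp
  qed
qed

text \<open>For \<open>\<theta> = flat 0\<close>, the function \<open>t \<mapsto> \<theta> (\<theta> 1 - \<theta> (t - 1)) / \<theta> (\<theta> 1)\<close> equals \<open>1\<close> for \<open>t \<le> 1\<close> and
  \<open>0\<close> for \<open>t \<ge> 2\<close>; it is evaluated at a multiple of the squared distance.\<close>

lemma bump_exists:
  fixes x :: "'a::euclidean_space"
  assumes "0 < r"
  shows "\<exists>f. smooth_on UNIV f \<and> (\<exists>e>0. \<forall>y\<in>ball x e. f y = 1) \<and> (\<forall>y. y \<notin> cball x r \<longrightarrow> f y = (0::real))"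
proof -
  \<comment> \<open>The factor is chosen so that \<open>q\<close> is at most \<open>1 / 2\<close> on
    the ball of radius \<open>r / 2\<close> and at least 2 outside the ball of radius
    \<open>r\<close>; the profile is constant in both ranges.\<close>
  define q where "q = (\<lambda>y. (2 / r\<^sup>2) * ((y - x) \<bullet> (y - x)))"
  define f where "f = (\<lambda>y. (1 / flat 0 (flat 0 1)) * flat 0 (flat 0 1 - flat 0 (q y - 1)))"
  have "smooth_on UNIV (\<lambda>y. (y - x) \<bullet> (y - x))"
  proof (rule smooth_on_linear_family[where M = "\<lambda>y a. (y - x) \<bullet> a"])
    show "smooth_on UNIV (\<lambda>y. (y - x) \<bullet> a)" for a
      by (intro smooth_on_inner smooth_on_diff smooth_on_ident smooth_on_const open_UNIV)
    show "smooth_on UNIV (\<lambda>y. y - x)"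
      by (intro smooth_on_diff smooth_on_ident smooth_on_const open_UNIV)
  qed (auto intro: bounded_linear.linear bounded_linear_inner_right)
  then have q: "smooth_on UNIV q"
    unfolding q_def by (intro smooth_on_mult smooth_on_const open_UNIV)
  have flat_smooth: "smooth_on UNIV (\<lambda>y. flat 0 (g y))" if "smooth_on UNIV g" for g :: "'a \<Rightarrow> real"
    using smooth_on_compose[OF _ _ that _ smooth_on_flat[of 0]] by auto
  have "smooth_on UNIV f"
    unfolding f_def
    by (intro smooth_on_mult smooth_on_diff smooth_on_const flat_smooth q open_UNIV)
  moreover have "f y = 1" if "y \<in> ball x (r / 2)" for y
  proof -
    have "(y - x) \<bullet> (y - x) \<le> (r / 2)\<^sup>2"
      using that unfolding dot_square_norm
      by (intro power_mono) (auto simp: dist_norm norm_minus_commute)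
    then have "q y \<le> (2 / r\<^sup>2) * (r / 2)\<^sup>2"
      unfolding q_def by (intro mult_left_mono) auto
    then have "q y \<le> 1" using assms by (simp add: power2_eq_square)
    then have "flat 0 (q y - 1) = 0" by (simp add: flat_def)
    moreover have "flat 0 (flat 0 1) \<noteq> 0" by (simp add: flat_def)
    ultimately show ?thesis by (simp add: f_def)
  qed
  moreover have "f y = 0" if "y \<notin> cball x r" for y
  proof -
    have "(y - x) \<bullet> (y - x) \<ge> r\<^sup>2"
      using that assms unfolding dot_square_norm
      by (intro power_mono) (auto simp: dist_norm norm_minus_commute)
    then have "q y \<ge> 2" unfolding q_def using assms by (simp add: field_simps)
    \<comment> \<open>Since \<open>flat 0\<close> is increasing on the positive axis, the argument
      of the outer \<open>flat 0\<close> is now at most 0, where it vanishes.\<close>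
    then have "flat 0 (q y - 1) \<ge> flat 0 1" by (simp add: flat_def)
    then show ?thesis by (simp add: f_def flat_def[of 0 "_ - _"])
  qed
  ultimately show ?thesis using assms by (intro exI[of _ f] conjI exI[of _ "r / 2"]) auto
qed

section \<open>Charts, changes of coordinates, tangent spaces and vector fields\<close>

locale smooth_manifold =
  fixes \<Phi> :: "('m::{t2_space, second_countable_topology}, 'e::euclidean_space) chart set"
  assumes atlas: "smooth_atlas \<Phi>"
begin

lemma chart_exists: "\<exists>c\<in>\<Phi>. q \<in> dom_chart c"
  using atlas unfolding smooth_atlas_def by blast

lemma open_dom_chart: "c \<in> \<Phi> \<Longrightarrow> open (dom_chart c)"
  and open_image_chart: "c \<in> \<Phi> \<Longrightarrow> open (image_chart c)"
  and chart_homeomorphism: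
    "c \<in> \<Phi> \<Longrightarrow> homeomorphism (dom_chart c) (image_chart c) (coord c) (param c)"
  and smooth_on_transition:
    "c \<in> \<Phi> \<Longrightarrow> d \<in> \<Phi> \<Longrightarrow> smooth_on (coord c ` (dom_chart c \<inter> dom_chart d)) (transition c d)"
  using atlas unfolding smooth_atlas_def by blast+

lemma param_coord [simp]: "c \<in> \<Phi> \<Longrightarrow> q \<in> dom_chart c \<Longrightarrow> param c (coord c q) = q"
  and coord_param [simp]: "c \<in> \<Phi> \<Longrightarrow> x \<in> image_chart c \<Longrightarrow> coord c (param c x) = x"
  and param_in_dom [simp]: "c \<in> \<Phi> \<Longrightarrow> x \<in> image_chart c \<Longrightarrow> param c x \<in> dom_chart c"
  and coord_in_image [simp]: "c \<in> \<Phi> \<Longrightarrow> q \<in> dom_chart c \<Longrightarrow> coord c q \<in> image_chart c"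
  using chart_homeomorphism unfolding homeomorphism_def by blast+

lemma mem_coord_image:
  "c \<in> \<Phi> \<Longrightarrow> x \<in> coord c ` (dom_chart c \<inter> N) \<longleftrightarrow> x \<in> image_chart c \<and> param c x \<in> N"
  by (force simp: image_iff image_chart_def)

lemma mem_param_image:
  assumes "c \<in> \<Phi>" "U \<subseteq> image_chart c"
  shows "q \<in> param c ` U \<longleftrightarrow> q \<in> dom_chart c \<and> coord c q \<in> U"
proof
  assume "q \<in> param c ` U"
  then show "q \<in> dom_chart c \<and> coord c q \<in> U" using assms by auto
next
  assume "q \<in> dom_chart c \<and> coord c q \<in> U"
  then show "q \<in> param c ` U" using assms(1) image_eqI[of q "param c" "coord c q" U] by simp
qed

lemma open_coord_image:
  assumes "c \<in> \<Phi>" "open N"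
  shows "open (coord c ` (dom_chart c \<inter> N))"
proof -
  have "coord c ` (dom_chart c \<inter> N) = image_chart c \<inter> param c -` N"
    using mem_coord_image[OF assms(1)] by blast
  moreover have "continuous_on (image_chart c) (param c)"
    using chart_homeomorphism[OF assms(1)] by (rule homeomorphism_cont2)
  ultimately show ?thesis
    using continuous_open_preimage[OF _ open_image_chart[OF assms(1)] assms(2)] by simp
qed

lemma open_param_image:
  assumes "c \<in> \<Phi>" "open U" "U \<subseteq> image_chart c"
  shows "open (param c ` U)"
proof -
  have "param c ` U = dom_chart c \<inter> coord c -` U"
    using mem_param_image[OF assms(1,3)] by blast
  moreover have "continuous_on (dom_chart c) (coord c)"
    using chart_homeomorphism[OF assms(1)] by (rule homeomorphism_cont1)
  ultimately show ?thesis
    using continuous_open_preimage[OF _ open_dom_chart[OF assms(1)] assms(2)] by simp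
qed

lemma open_overlap:
  "c \<in> \<Phi> \<Longrightarrow> d \<in> \<Phi> \<Longrightarrow> open (coord c ` (dom_chart c \<inter> dom_chart d))"
  by (simp add: open_coord_image open_dom_chart)

text \<open>Compact sets are closed because the manifold is Hausdorff. The complement is therefore
  open, which is what extension by 0 requires.\<close>

lemma closed_param_image:
  assumes "c \<in> \<Phi>" "compact K" "K \<subseteq> image_chart c"
  shows "closed (param c ` K)"
proof -
  have "continuous_on K (param c)"
    using chart_homeomorphism[OF assms(1)] assms(3)
    by (intro continuous_on_subset[OF homeomorphism_cont2])
  then show ?thesis by (intro compact_imp_closed compact_continuous_image assms)
qed

definition jac where "jac c d q = FD (transition c d) (coord c q)"

lemma transition_coord: "c \<in> \<Phi> \<Longrightarrow> q \<in> dom_chart c \<Longrightarrow> transition c d (coord c q) = coord d q"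
  by (simp add: transition_def)

lemma transition_has_derivative:
  assumes "c \<in> \<Phi>" "d \<in> \<Phi>" "q \<in> dom_chart c" "q \<in> dom_chart d"
  shows "(transition c d has_derivative jac c d q) (at (coord c q))"
  unfolding jac_def using assms by (intro smooth_on_has_derivative[OF smooth_on_transition]) auto

lemma linear_jac:
  "c \<in> \<Phi> \<Longrightarrow> d \<in> \<Phi> \<Longrightarrow> q \<in> dom_chart c \<Longrightarrow> q \<in> dom_chart d \<Longrightarrow> linear (jac c d q)"
  using transition_has_derivative has_derivative_linear by blast

text \<open>The chain rule for \<open>transition c e\<close> as a composition through
  \<open>d\<close>. The composition formula holds only on the triple overlap, which suffices because
  derivatives depend on germs.\<close>

lemma jac_cocycle:
  assumes "c \<in> \<Phi>" "d \<in> \<Phi>" "e \<in> \<Phi>" "q \<in> dom_chart c" "q \<in> dom_chart d" "q \<in> dom_chart e"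
  shows "jac c e q a = jac d e q (jac c d q a)"
proof -
  let ?U = "coord c ` (dom_chart c \<inter> (dom_chart d \<inter> dom_chart e))"
  have "((\<lambda>x. transition d e (transition c d x)) has_derivative (\<lambda>a. jac d e q (jac c d q a))) (at (coord c q))"
    using assms transition_coord[OF assms(1,4)]
    by (intro has_derivative_compose[where g = "transition d e" and f = "transition c d"]
        transition_has_derivative) (auto intro: transition_has_derivative)
  moreover have "transition c e x = transition d e (transition c d x)" if "x \<in> ?U" for x
    using that assms by (auto simp: transition_coord)
  moreover have "open ?U" "coord c q \<in> ?U"
    using assms by (auto intro!: open_coord_image open_dom_chart)
  ultimately have "(transition c e has_derivative (\<lambda>a. jac d e q (jac c d q a))) (at (coord c q))"
    using has_derivative_cong_open[of ?U "coord c q" "transition c e"] by simp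
  then show ?thesis by (simp add: jac_def FD_eqI)
qed

lemma jac_refl:
  assumes "c \<in> \<Phi>" "q \<in> dom_chart c"
  shows "jac c c q a = a"
proof -
  have "FD (transition c c) (coord c q) = FD (\<lambda>x. x) (coord c q)"
    using assms
    by (intro FD_cong[of "image_chart c"]) (auto simp: open_image_chart transition_def)
  then show ?thesis by (simp add: jac_def)
qed

lemma tspace_transform:
  "y \<in> tspace \<Phi> q \<Longrightarrow> c \<in> \<Phi> \<Longrightarrow> d \<in> \<Phi> \<Longrightarrow> q \<in> dom_chart c \<Longrightarrow> q \<in> dom_chart d \<Longrightarrow>
    y d = jac c d q (y c)"
  unfolding tspace_def jac_def by blast

lemma tspace_zero: "y \<in> tspace \<Phi> q \<Longrightarrow> \<not> (c \<in> \<Phi> \<and> q \<in> dom_chart c) \<Longrightarrow> y c = 0"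
  unfolding tspace_def by blast

lemma tspaceI:
  assumes "\<And>c d. c \<in> \<Phi> \<Longrightarrow> d \<in> \<Phi> \<Longrightarrow> q \<in> dom_chart c \<Longrightarrow> q \<in> dom_chart d \<Longrightarrow> y d = jac c d q (y c)"
    and "\<And>c. \<not> (c \<in> \<Phi> \<and> q \<in> dom_chart c) \<Longrightarrow> y c = 0"
  shows "y \<in> tspace \<Phi> q"
  using assms unfolding tspace_def jac_def by blast

text \<open>The component in one chart determines those in all other charts around the point, and
  the remaining entries are 0.\<close>

lemma tspace_eqI:
  assumes "y \<in> tspace \<Phi> q" "y' \<in> tspace \<Phi> q" "c \<in> \<Phi>" "q \<in> dom_chart c" "y c = y' c"
  shows "y = y'"
proof
  fix d show "y d = y' d"
    using tspace_zero[OF assms(1), of d] tspace_zero[OF assms(2), of d]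
      tspace_transform[OF assms(1,3) _ assms(4), of d] tspace_transform[OF assms(2,3) _ assms(4), of d]
      assms(5) by (cases "d \<in> \<Phi> \<and> q \<in> dom_chart d") auto
qed

lemma tspace_0: "0 \<in> tspace \<Phi> q"
  by (rule tspaceI) (auto simp: zero_fun_def linear_0[OF linear_jac])

lemma tspace_add:
  assumes y: "y \<in> tspace \<Phi> q" and z: "z \<in> tspace \<Phi> q"
  shows "y + z \<in> tspace \<Phi> q"
proof (rule tspaceI)
  fix c d assume cd: "c \<in> \<Phi>" "d \<in> \<Phi>" "q \<in> dom_chart c" "q \<in> dom_chart d"
  show "(y + z) d = jac c d q ((y + z) c)"
    using tspace_transform[OF y cd] tspace_transform[OF z cd] by (simp add: linear_add[OF linear_jac[OF cd]])
qed (simp add: tspace_zero[OF y] tspace_zero[OF z])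

lemma tspace_scaleR:
  assumes y: "y \<in> tspace \<Phi> q"
  shows "r *\<^sub>R y \<in> tspace \<Phi> q"
proof (rule tspaceI)
  fix c d assume cd: "c \<in> \<Phi>" "d \<in> \<Phi>" "q \<in> dom_chart c" "q \<in> dom_chart d"
  show "(r *\<^sub>R y) d = jac c d q ((r *\<^sub>R y) c)"
    using tspace_transform[OF y cd] by (simp add: scaleR_fun_def linear_cmul[OF linear_jac[OF cd]])
qed (simp add: scaleR_fun_def tspace_zero[OF y])

lemma tspace_diff: "y \<in> tspace \<Phi> q \<Longrightarrow> z \<in> tspace \<Phi> q \<Longrightarrow> y - z \<in> tspace \<Phi> q"
  using tspace_add[OF _ tspace_scaleR[of z q "- 1"], of y] by simp

text \<open>This is the inverse of \<open>y \<mapsto> y c\<close> on the tangent space at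
  \<open>q\<close>, that is, the fibre part of \<open>tparam\<close> with the point itself as an
  argument.\<close>

definition lift where
  "lift c q a = (\<lambda>d. if d \<in> \<Phi> \<and> q \<in> dom_chart d then jac c d q a else 0)"

lemma lift_in_tspace:
  assumes "c \<in> \<Phi>" "q \<in> dom_chart c"
  shows "lift c q a \<in> tspace \<Phi> q"
proof (rule tspaceI)
  fix d e assume de: "d \<in> \<Phi>" "e \<in> \<Phi>" "q \<in> dom_chart d" "q \<in> dom_chart e"
  show "lift c q a e = jac d e q (lift c q a d)"
    using de jac_cocycle[OF assms(1) de(1,2) assms(2) de(3,4)] by (simp add: lift_def)
qed (auto simp: lift_def)

lemma lift_self: "c \<in> \<Phi> \<Longrightarrow> q \<in> dom_chart c \<Longrightarrow> lift c q a c = a"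
  by (simp add: lift_def jac_refl)

lemma lift_component: "y \<in> tspace \<Phi> q \<Longrightarrow> c \<in> \<Phi> \<Longrightarrow> q \<in> dom_chart c \<Longrightarrow> lift c q (y c) = y"
  by (rule tspace_eqI[OF lift_in_tspace]) (auto simp: lift_self)

lemma tparam_eq: "c \<in> \<Phi> \<Longrightarrow> x \<in> image_chart c \<Longrightarrow> tparam \<Phi> c (x, a) = (param c x, lift c (param c x) a)"
  by (auto simp: tparam_def lift_def jac_def)

lemma tparam_coord:
  "y \<in> tspace \<Phi> q \<Longrightarrow> c \<in> \<Phi> \<Longrightarrow> q \<in> dom_chart c \<Longrightarrow> tparam \<Phi> c (coord c q, y c) = (q, y)"
  by (simp add: tparam_eq lift_component)

lemma mem_vector_fields:
  "X \<in> vector_fields \<Phi> \<longleftrightarrow> (\<forall>p. X p \<in> tspace \<Phi> p) \<and>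
    (\<forall>c\<in>\<Phi>. smooth_on (image_chart c) (\<lambda>x. X (param c x) c))"
  by (simp add: vector_fields_on_def image_chart_def)

lemma vector_field_tspace: "X \<in> vector_fields \<Phi> \<Longrightarrow> X p \<in> tspace \<Phi> p"
  and vector_field_smooth:
    "X \<in> vector_fields \<Phi> \<Longrightarrow> c \<in> \<Phi> \<Longrightarrow> smooth_on (image_chart c) (\<lambda>x. X (param c x) c)"
  by (simp_all add: mem_vector_fields)

lemma smooth_functions_const: "(\<lambda>q. r) \<in> smooth_functions \<Phi>"
  by (simp add: smooth_functions_def o_def smooth_on_const open_image_chart)

lemma vector_fields_0: "(\<lambda>q. 0) \<in> vector_fields \<Phi>"
  unfolding mem_vector_fields
  by (auto simp: smooth_on_const open_image_chart intro: tspace_0)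

lemma vector_fields_add:
  assumes "X \<in> vector_fields \<Phi>" "Y \<in> vector_fields \<Phi>"
  shows "(\<lambda>q. X q + Y q) \<in> vector_fields \<Phi>"
  using assms unfolding mem_vector_fields
  by (auto intro!: tspace_add smooth_on_add open_image_chart)

lemma vector_fields_scaleR:
  assumes "f \<in> smooth_functions \<Phi>" "X \<in> vector_fields \<Phi>"
  shows "(\<lambda>q. f q *\<^sub>R X q) \<in> vector_fields \<Phi>"
proof -
  have "smooth_on (image_chart c) (\<lambda>x. f (param c x) *\<^sub>R X (param c x) c)" if "c \<in> \<Phi>" for c
    using assms that
    by (intro smooth_on_scaleR open_image_chart vector_field_smooth)
       (auto simp: smooth_functions_def o_def)
  then have "smooth_on (image_chart c) (\<lambda>x. (f (param c x) *\<^sub>R X (param c x)) c)" if "c \<in> \<Phi>" for c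
    using that by (simp add: scaleR_fun_def)
  then show ?thesis
    using vector_field_tspace[OF assms(2)] by (simp add: mem_vector_fields tspace_scaleR)
qed

lemma vector_fields_sum:
  assumes "finite I" "\<And>i. i \<in> I \<Longrightarrow> g i \<in> smooth_functions \<Phi>" "\<And>i. i \<in> I \<Longrightarrow> F i \<in> vector_fields \<Phi>"
  shows "(\<lambda>q. \<Sum>i\<in>I. g i q *\<^sub>R F i q) \<in> vector_fields \<Phi>"
  using assms
  by (induction I rule: finite_induct) (simp_all add: vector_fields_0 vector_fields_add vector_fields_scaleR)

lemma sum_component: "(\<Sum>i\<in>I. y i) c = (\<Sum>i\<in>I. y i c)" for y :: "'i \<Rightarrow> ('m, 'e) tvec"
  by (induction I rule: infinite_finite_induct) simp_all

lemma tspace_sum: "(\<And>i. i \<in> I \<Longrightarrow> y i \<in> tspace \<Phi> q) \<Longrightarrow> (\<Sum>i\<in>I. y i) \<in> tspace \<Phi> q"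
  by (induction I rule: infinite_finite_induct) (simp_all add: tspace_0 tspace_add)

subsection \<open>Extension of local fields\<close>

text \<open>Two open sets cover the image of \<open>d\<close>: the part lying over \<open>U\<close>,
  where \<open>G\<close> is smooth by assumption, and the part off the closed set over
  \<open>K\<close>, where \<open>G\<close> is 0.\<close>

lemma smooth_on_extend_by_0:
  assumes c: "c \<in> \<Phi>" and d: "d \<in> \<Phi>" and U: "open U" "U \<subseteq> image_chart c"
    and K: "compact K" "K \<subseteq> U"
    and G: "smooth_on (coord d ` (dom_chart d \<inter> param c ` U)) G"
    and G0: "\<And>x. x \<in> image_chart d \<Longrightarrow> param d x \<notin> param c ` K \<Longrightarrow> G x = 0"
  shows "smooth_on (image_chart d) G"
proof (rule smooth_on_local)
  fix x assume x: "x \<in> image_chart d"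
  show "\<exists>V. open V \<and> x \<in> V \<and> smooth_on V G"
  proof (cases "param d x \<in> param c ` K")
    case True
    then have "x \<in> coord d ` (dom_chart d \<inter> param c ` U)"
      unfolding mem_coord_image[OF d] using x K by blast
    then show ?thesis
      using G open_coord_image[OF d open_param_image[OF c U]] by blast
  next
    case False
    let ?V = "coord d ` (dom_chart d \<inter> - param c ` K)"
    have "closed (param c ` K)"
      by (rule closed_param_image[OF c K(1) order_trans[OF K(2) U(2)]])
    then have V: "open ?V" by (intro open_coord_image d) (simp add: open_Compl)
    have "G y = 0" if "y \<in> ?V" for y
      using that unfolding mem_coord_image[OF d] by (intro G0) simp_all
    then have "smooth_on ?V G"
      using smooth_on_const[OF V, of 0] smooth_on_cong[OF V, of G "\<lambda>_. 0"] by simp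
    moreover have "x \<in> ?V" unfolding mem_coord_image[OF d] using x False by simp
    ultimately show ?thesis using V by blast
  qed
qed

text \<open>Smoothness of \<open>g\<close> is asked for on the overlap only, because for vector
  fields \<open>g\<close> contains the derivative of \<open>transition c d\<close>.\<close>

lemma smooth_on_transition_compose:
  assumes "c \<in> \<Phi>" "d \<in> \<Phi>" "open U" "U \<subseteq> image_chart c" "smooth_on (U \<inter> coord c ` (dom_chart c \<inter> dom_chart d)) g"
  shows "smooth_on (coord d ` (dom_chart d \<inter> param c ` U)) (\<lambda>x. g (coord c (param d x)))"
proof -
  let ?V = "coord d ` (dom_chart d \<inter> param c ` U)"
  have V: "x \<in> image_chart d \<and> param d x \<in> dom_chart c \<and> coord c (param d x) \<in> U" if "x \<in> ?V" for x
    using that unfolding mem_coord_image[OF assms(2)] mem_param_image[OF assms(1,4)] by blast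
  have oV: "open ?V" using assms by (intro open_coord_image open_param_image)
  have "?V \<subseteq> coord d ` (dom_chart d \<inter> dom_chart c)"
    using V unfolding mem_coord_image[OF assms(2)] subset_iff by blast
  then have "smooth_on ?V (transition d c)"
    by (rule smooth_on_subset[OF smooth_on_transition[OF assms(2,1)]])
  moreover have "transition d c ` ?V \<subseteq> U \<inter> coord c ` (dom_chart c \<inter> dom_chart d)"
    using V assms(1,2) by (force simp: transition_def)
  moreover have "open (U \<inter> coord c ` (dom_chart c \<inter> dom_chart d))"
    using assms by (intro open_Int open_overlap)
  ultimately have "smooth_on ?V (\<lambda>x. g (transition d c x))"
    using assms(5) oV by (intro smooth_on_compose[where f = "transition d c" and g = g])
  then show ?thesis by (simp add: transition_def)
qed

lemma extend_function:
  assumes c: "c \<in> \<Phi>" and U: "open U" "U \<subseteq> image_chart c" and K: "compact K" "K \<subseteq> U"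
    and g: "smooth_on U g" and g0: "\<And>x. x \<in> U \<Longrightarrow> x \<notin> K \<Longrightarrow> g x = 0"
  shows "(\<lambda>q. if q \<in> param c ` U then g (coord c q) else 0) \<in> smooth_functions \<Phi>"
  unfolding smooth_functions_def
proof (intro CollectI ballI)
  fix d assume d: "d \<in> \<Phi>"
  let ?G = "(\<lambda>q. if q \<in> param c ` U then g (coord c q) else 0) \<circ> param d"
  let ?V = "coord d ` (dom_chart d \<inter> param c ` U)"
  have "smooth_on ?V (\<lambda>x. g (coord c (param d x)))"
    by (intro smooth_on_transition_compose c d U smooth_on_subset[OF g]) auto
  then have "smooth_on ?V ?G"
    by (subst smooth_on_cong[of _ _ "\<lambda>x. g (coord c (param d x))"])
       (auto simp: mem_coord_image[OF d] intro!: open_coord_image open_param_image c d U)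
  then show "smooth_on (image_chart d) ?G"
    by (rule smooth_on_extend_by_0[OF c d U K])
       (use g0 K in \<open>auto simp: mem_param_image[OF c U(2)] mem_param_image[OF c order_trans[OF K(2) U(2)]]\<close>)
qed

lemma extend_field:
  assumes c: "c \<in> \<Phi>" and U: "open U" "U \<subseteq> image_chart c" and K: "compact K" "K \<subseteq> U"
    and h: "smooth_on U h" and h0: "\<And>x. x \<in> U \<Longrightarrow> x \<notin> K \<Longrightarrow> h x = 0"
  shows "(\<lambda>q. if q \<in> param c ` U then lift c q (h (coord c q)) else 0) \<in> vector_fields \<Phi>"
    (is "?X \<in> _")
  unfolding mem_vector_fields
proof (intro conjI allI ballI)
  show "?X q \<in> tspace \<Phi> q" for q
    using mem_param_image[OF c U(2)] by (auto simp: tspace_0 intro!: lift_in_tspace c)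
next
  fix d assume d: "d \<in> \<Phi>"
  let ?V = "coord d ` (dom_chart d \<inter> param c ` U)"
  let ?W = "U \<inter> coord c ` (dom_chart c \<inter> dom_chart d)"
  have oW: "open ?W" using U by (intro open_Int open_overlap c d)
  have "smooth_on ?W (\<lambda>x. FD (transition c d) x (h x))"
    by (intro smooth_on_FD_app oW smooth_on_subset[OF smooth_on_transition[OF c d]] smooth_on_subset[OF h]) auto
  then have "smooth_on ?V (\<lambda>x. FD (transition c d) (coord c (param d x)) (h (coord c (param d x))))"
    by (rule smooth_on_transition_compose[OF c d U])
  then have "smooth_on ?V (\<lambda>x. ?X (param d x) d)"
    by (subst smooth_on_cong[of _ _ "\<lambda>x. FD (transition c d) (coord c (param d x)) (h (coord c (param d x)))"])
       (auto simp: mem_coord_image[OF d] lift_def jac_def d intro!: open_coord_image open_param_image c d U)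
  moreover have "?X q d = 0" if "q \<in> dom_chart d" "q \<notin> param c ` K" for q
  proof (cases "q \<in> param c ` U")
    case True
    then have "q \<in> dom_chart c" "coord c q \<in> U" "coord c q \<notin> K"
      using that mem_param_image[OF c U(2)] mem_param_image[OF c order_trans[OF K(2) U(2)]] by auto
    then show ?thesis using h0 True that d by (simp add: lift_def linear_0[OF linear_jac] c)
  qed simp
  ultimately show "smooth_on (image_chart d) (\<lambda>x. ?X (param d x) d)"
    by (intro smooth_on_extend_by_0[OF c d U K]) (auto simp: d)
qed


lemma cutoff_exists:
  assumes "open U" "x \<in> U"
  obtains f :: "'e \<Rightarrow> real" and K V where "smooth_on UNIV f" "compact K" "K \<subseteq> U"
    "open V" "x \<in> V" "V \<subseteq> U" "\<And>y. y \<in> V \<Longrightarrow> f y = 1" "\<And>y. y \<notin> K \<Longrightarrow> f y = 0"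
proof -
  obtain r where r: "0 < r" "cball x r \<subseteq> U"
    using assms open_contains_cball by blast
  obtain f :: "'e \<Rightarrow> real" and e where f: "smooth_on UNIV f" "0 < e"
    "\<forall>y\<in>ball x e. f y = 1" "\<forall>y. y \<notin> cball x r \<longrightarrow> f y = 0"
    using bump_exists[OF r(1), of x] by blast
  show ?thesis
    using f r assms by (intro that[of f "cball x r" "ball x e \<inter> U"]) auto
qed

text \<open>The component is multiplied by a cutoff, extended by 0 and lifted back; on the set where
  the cutoff is 1 nothing has changed. This provides the witnesses for the choices in
  \<open>nab_local\<close> and \<open>field_ext\<close>.\<close>

lemma germ_extension:
  assumes c: "c \<in> \<Phi>" and U: "open U" "U \<subseteq> image_chart c" "x \<in> U"
    and Y: "\<And>y. y \<in> U \<Longrightarrow> Y (param c y) \<in> tspace \<Phi> (param c y)"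
    and Ys: "smooth_on U (\<lambda>y. Y (param c y) c)"
  shows "\<exists>Y'\<in>vector_fields \<Phi>. \<exists>N. open N \<and> param c x \<in> N \<and> (\<forall>q\<in>N. Y' q = Y q)"
proof -
  obtain f :: "'e \<Rightarrow> real" and K V where f: "smooth_on UNIV f" and K: "compact K" "K \<subseteq> U"
    and V: "open V" "x \<in> V" "V \<subseteq> U" and f1: "\<And>y. y \<in> V \<Longrightarrow> f y = 1" and f0: "\<And>y. y \<notin> K \<Longrightarrow> f y = 0"
    using cutoff_exists[OF U(1,3)] by metis
  let ?h = "\<lambda>y. f y *\<^sub>R Y (param c y) c"
  let ?X = "\<lambda>q. if q \<in> param c ` U then lift c q (?h (coord c q)) else 0"
  have "?X \<in> vector_fields \<Phi>"
    by (intro extend_field[OF c U(1,2) K] smooth_on_scaleR[OF U(1)] Ys smooth_on_subset[OF f])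
       (simp_all add: f0)
  moreover have eq: "?X q = Y q" if q: "q \<in> param c ` V" for q
  proof -
    obtain y where y: "y \<in> V" "q = param c y" using q by (elim imageE)
    then have "q \<in> param c ` U" "coord c q = y" "q \<in> dom_chart c"
      using V U c by auto
    then show ?thesis
      using y V Y[of y] c by (simp add: f1 lift_component subset_iff)
  qed
  moreover have "open (param c ` V)"
    using V U by (intro open_param_image c) auto
  ultimately show ?thesis
    using imageI[OF V(2)] eq by (intro bexI[of _ ?X] exI[of _ "param c ` V"] conjI ballI)
qed

lemma field_ext_props:
  assumes x: "x \<in> tspace \<Phi> p"
  shows "field_ext \<Phi> p x \<in> vector_fields \<Phi>" "field_ext \<Phi> p x p = x"
proof -
  obtain c where c: "c \<in> \<Phi>" "p \<in> dom_chart c" using chart_exists by blast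
  \<comment> \<open>The local field to be extended has the constant component \<open>x c\<close> in
    the chart.\<close>
  have "\<exists>Y'\<in>vector_fields \<Phi>. \<exists>N. open N \<and> param c (coord c p) \<in> N \<and> (\<forall>q\<in>N. Y' q = lift c q (x c))"
  proof (rule germ_extension[OF c(1) open_image_chart[OF c(1)]])
    show "smooth_on (image_chart c) (\<lambda>y. lift c (param c y) (x c) c)"
      using smooth_on_cong[OF open_image_chart[OF c(1)], of "\<lambda>y. lift c (param c y) (x c) c" "\<lambda>_. x c"]
      by (simp add: lift_self c smooth_on_const open_image_chart)
  qed (auto simp: c intro: lift_in_tspace)
  then obtain Y where "Y \<in> vector_fields \<Phi>" "Y p = x"
    using lift_component[OF x c] c by auto
  then have "\<exists>X. X \<in> vector_fields \<Phi> \<and> X p = x" by blast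
  then have "field_ext \<Phi> p x \<in> vector_fields \<Phi> \<and> field_ext \<Phi> p x p = x"
    unfolding field_ext_def by (rule someI_ex)
  then show "field_ext \<Phi> p x \<in> vector_fields \<Phi>" "field_ext \<Phi> p x p = x" by auto
qed

lemma vector_field_has_derivative:
  assumes "X \<in> vector_fields \<Phi>" "c \<in> \<Phi>" "q \<in> dom_chart c"
  shows "((\<lambda>x. X (param c x) c) has_derivative FD (\<lambda>x. X (param c x) c) (coord c q)) (at (coord c q))"
  using assms by (intro smooth_on_has_derivative[OF vector_field_smooth]) auto

text \<open>The chart in the definition is selected by \<open>SOME\<close>. By the chain rule, the
  Jacobian in the change of charts for \<open>f\<close> is absorbed by the transformation of
  \<open>x\<close>.\<close>

lemma dir_deriv_chart:
  assumes f: "f \<in> smooth_functions \<Phi>" and c: "c \<in> \<Phi>" "p \<in> dom_chart c" and x: "x \<in> tspace \<Phi> p"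
  shows "dir_deriv \<Phi> p x f = FD (f \<circ> param c) (coord c p) (x c)"
proof -
  define d where "d = (SOME d. d \<in> \<Phi> \<and> p \<in> dom_chart d)"
  have "\<exists>d. d \<in> \<Phi> \<and> p \<in> dom_chart d" using c by blast
  then have d: "d \<in> \<Phi>" "p \<in> dom_chart d" unfolding d_def by (metis (mono_tags, lifting) someI_ex)+
  have "smooth_on (image_chart d) (f \<circ> param d)"
    using f d unfolding smooth_functions_def by blast
  then have "((f \<circ> param d) has_derivative FD (f \<circ> param d) (coord d p)) (at (transition c d (coord c p)))"
    using d c by (simp add: transition_coord smooth_on_has_derivative)
  then have "((\<lambda>x. (f \<circ> param d) (transition c d x)) has_derivative
      (\<lambda>a. FD (f \<circ> param d) (coord d p) (jac c d p a))) (at (coord c p))"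
    by (rule has_derivative_compose[where f = "transition c d", OF transition_has_derivative[OF c(1) d(1) c(2) d(2)]])
  moreover have "(f \<circ> param c) y = (f \<circ> param d) (transition c d y)"
    if "y \<in> coord c ` (dom_chart c \<inter> dom_chart d)" for y
    using that c d by (auto simp: transition_coord)
  moreover have "coord c p \<in> coord c ` (dom_chart c \<inter> dom_chart d)" using c d by auto
  ultimately have "((f \<circ> param c) has_derivative
      (\<lambda>a. FD (f \<circ> param d) (coord d p) (jac c d p a))) (at (coord c p))"
    using has_derivative_cong_open[OF open_overlap[OF c(1) d(1)], of "coord c p" "f \<circ> param c"] by simp
  then have "FD (f \<circ> param c) (coord c p) (x c) = FD (f \<circ> param d) (coord d p) (x d)"
    using tspace_transform[OF x c(1) d(1) c(2) d(2)] by (simp add: FD_eqI)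
  then show ?thesis by (simp add: dir_deriv_def Let_def flip: d_def)
qed

subsection \<open>The Lie bracket\<close>

text \<open>Obtained by differentiating the transformation law of \<open>X\<close>, in which both
  the Jacobian and the component vary. The first summand, a second derivative of the transition map,
  is what keeps the derivative of a field from being a tensor.\<close>

lemma vector_field_derivative_transform:
  assumes X: "X \<in> vector_fields \<Phi>" and c: "c \<in> \<Phi>" "q \<in> dom_chart c" and d: "d \<in> \<Phi>" "q \<in> dom_chart d"
  shows "FD (\<lambda>x. X (param d x) d) (coord d q) (jac c d q a)
    = FD (\<lambda>x. FD (transition c d) x (X q c)) (coord c q) a
      + jac c d q (FD (\<lambda>x. X (param c x) c) (coord c q) a)"
proof -
  let ?U = "coord c ` (dom_chart c \<inter> dom_chart d)"
  have U: "open ?U" "coord c q \<in> ?U" using open_overlap c d by auto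
  have tr: "smooth_on ?U (transition c d)" by (rule smooth_on_transition[OF c(1) d(1)])
  have "((\<lambda>x. X (param d x) d) has_derivative FD (\<lambda>x. X (param d x) d) (coord d q)) (at (transition c d (coord c q)))"
    using vector_field_has_derivative[OF X d] by (simp add: transition_coord c)
  then have "((\<lambda>x. X (param d (transition c d x)) d) has_derivative
      (\<lambda>a. FD (\<lambda>x. X (param d x) d) (coord d q) (jac c d q a))) (at (coord c q))"
    by (rule has_derivative_compose[where f = "transition c d" and g = "\<lambda>x. X (param d x) d",
          OF transition_has_derivative[OF c(1) d(1) c(2) d(2)]])
  moreover have "X (param d (transition c d x)) d = FD (transition c d) x (X (param c x) c)" if x: "x \<in> ?U" for x
  proof -
    obtain q' where "x = coord c q'" "q' \<in> dom_chart c" "q' \<in> dom_chart d" using x by (elim imageE IntE)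
    then show ?thesis
      using tspace_transform[OF vector_field_tspace[OF X] c(1) d(1), of q'] c d
      by (simp add: transition_coord jac_def)
  qed
  ultimately have "((\<lambda>x. FD (transition c d) x (X (param c x) c)) has_derivative
      (\<lambda>a. FD (\<lambda>x. X (param d x) d) (coord d q) (jac c d q a))) (at (coord c q))"
    using has_derivative_cong_open[OF U, of "\<lambda>x. X (param d (transition c d x)) d"] by simp
  moreover have "((\<lambda>x. FD (transition c d) x (X (param c x) c)) has_derivative
      (\<lambda>a. FD (\<lambda>x. FD (transition c d) x (X (param c (coord c q)) c)) (coord c q) a
        + FD (transition c d) (coord c q) (FD (\<lambda>x. X (param c x) c) (coord c q) a))) (at (coord c q))"
    by (intro has_derivative_linear_family[OF U] linear_FD[OF tr]
        smooth_on_has_derivative[OF smooth_on_FD[OF tr]] vector_field_has_derivative X c U)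
  ultimately have "(\<lambda>a. FD (\<lambda>x. X (param d x) d) (coord d q) (jac c d q a)) =
      (\<lambda>a. FD (\<lambda>x. FD (transition c d) x (X (param c (coord c q)) c)) (coord c q) a
        + FD (transition c d) (coord c q) (FD (\<lambda>x. X (param c x) c) (coord c q) a))"
    by (rule has_derivative_unique)
  from fun_cong[OF this, of a] show ?thesis by (simp only: param_coord[OF c] jac_def)
qed

lemma lie_bracket_component:
  "c \<in> \<Phi> \<Longrightarrow> q \<in> dom_chart c \<Longrightarrow> lie_bracket \<Phi> X Y q c =
    FD (\<lambda>x. Y (param c x) c) (coord c q) (X q c) - FD (\<lambda>x. X (param c x) c) (coord c q) (Y q c)"
  by (simp add: lie_bracket_def)

lemma lie_bracket_vector_field:
  assumes X: "X \<in> vector_fields \<Phi>" and Y: "Y \<in> vector_fields \<Phi>"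
  shows "lie_bracket \<Phi> X Y \<in> vector_fields \<Phi>"
  unfolding mem_vector_fields
proof (intro conjI allI ballI)
  fix q show "lie_bracket \<Phi> X Y q \<in> tspace \<Phi> q"
  proof (rule tspaceI)
    fix c d assume cd: "c \<in> \<Phi>" "d \<in> \<Phi>" "q \<in> dom_chart c" "q \<in> dom_chart d"
    \<comment> \<open>These are the two non-tensorial terms in the transformation of the bracket;
      being equal, they cancel in the difference.\<close>
    have "FD (\<lambda>x. FD (transition c d) x (Y q c)) (coord c q) (X q c)
        = FD (\<lambda>x. FD (transition c d) x (X q c)) (coord c q) (Y q c)"
      using cd by (intro second_FD_symmetric[OF open_overlap smooth_on_transition]) auto
    then show "lie_bracket \<Phi> X Y q d = jac c d q (lie_bracket \<Phi> X Y q c)"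
      using vector_field_derivative_transform[OF Y cd(1,3,2,4), of "X q c"]
        vector_field_derivative_transform[OF X cd(1,3,2,4), of "Y q c"]
        tspace_transform[OF vector_field_tspace[OF X] cd] tspace_transform[OF vector_field_tspace[OF Y] cd]
      by (simp add: lie_bracket_component cd linear_diff[OF linear_jac[OF cd]])
  qed (auto simp: lie_bracket_def)
next
  fix c assume c: "c \<in> \<Phi>"
  have "smooth_on (image_chart c) (\<lambda>x. FD (\<lambda>x. Y (param c x) c) x (X (param c x) c)
      - FD (\<lambda>x. X (param c x) c) x (Y (param c x) c))"
    by (intro smooth_on_diff smooth_on_FD_app open_image_chart c vector_field_smooth X Y)
  then show "smooth_on (image_chart c) (\<lambda>x. lie_bracket \<Phi> X Y (param c x) c)"
    by (subst smooth_on_cong[OF open_image_chart[OF c], of _ "\<lambda>x. FD (\<lambda>x. Y (param c x) c) x (X (param c x) c)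
      - FD (\<lambda>x. X (param c x) c) x (Y (param c x) c)"])
       (simp_all add: lie_bracket_component c)
qed

end

section \<open>Algebraic consequences of the connection axioms\<close>

locale anisotropic = smooth_manifold \<Phi>
  for \<Phi> :: "('m::{t2_space, second_countable_topology}, 'e::euclidean_space) chart set" +
  fixes A :: "('m \<times> ('m, 'e) tvec) set" and nab :: "('m, 'e) aconn"
  assumes open_A: "open_in_TM \<Phi> A"
    and connection: "anisotropic_connection \<Phi> A nab"
begin

lemma A_tspace: "v \<in> A \<Longrightarrow> snd v \<in> tspace \<Phi> (fst v)"
  using open_A by (auto simp: open_in_TM_def tangent_bundle_def)

lemma open_in_chart: "c \<in> \<Phi> \<Longrightarrow> open (in_chart \<Phi> c A)"
  using open_A by (simp add: open_in_TM_def)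

lemma mem_in_chart:
  "v \<in> A \<Longrightarrow> c \<in> \<Phi> \<Longrightarrow> fst v \<in> dom_chart c \<Longrightarrow> (coord c (fst v), snd v c) \<in> in_chart \<Phi> c A"
  using tparam_coord[OF A_tspace] by (simp add: in_chart_def)

lemma nab_aniso_field:
  "X \<in> vector_fields \<Phi> \<Longrightarrow> Y \<in> vector_fields \<Phi> \<Longrightarrow> (\<lambda>v. nab v X Y) \<in> aniso_fields \<Phi> A"
  using connection by (simp add: anisotropic_connection_def)

lemma nab_tspace:
  "v \<in> A \<Longrightarrow> X \<in> vector_fields \<Phi> \<Longrightarrow> Y \<in> vector_fields \<Phi> \<Longrightarrow> nab v X Y \<in> tspace \<Phi> (fst v)"
  using nab_aniso_field by (simp add: aniso_fields_def)

lemma nab_add: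
  "v \<in> A \<Longrightarrow> X \<in> vector_fields \<Phi> \<Longrightarrow> Y \<in> vector_fields \<Phi> \<Longrightarrow> Z \<in> vector_fields \<Phi> \<Longrightarrow>
    nab v X (Y + Z) = nab v X Y + nab v X Z"
  using connection by (simp add: anisotropic_connection_def)

lemma nab_Leibniz:
  "v \<in> A \<Longrightarrow> X \<in> vector_fields \<Phi> \<Longrightarrow> Y \<in> vector_fields \<Phi> \<Longrightarrow> f \<in> smooth_functions \<Phi> \<Longrightarrow>
    nab v X (\<lambda>p. f p *\<^sub>R Y p) =
      dir_deriv \<Phi> (fst v) (X (fst v)) f *\<^sub>R Y (fst v) + f (fst v) *\<^sub>R nab v X Y"
  using connection by (simp add: anisotropic_connection_def)

lemma nab_linear:
  "v \<in> A \<Longrightarrow> X \<in> vector_fields \<Phi> \<Longrightarrow> Y \<in> vector_fields \<Phi> \<Longrightarrow> Z \<in> vector_fields \<Phi> \<Longrightarrow>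
    f \<in> smooth_functions \<Phi> \<Longrightarrow> h \<in> smooth_functions \<Phi> \<Longrightarrow>
    nab v (\<lambda>p. f p *\<^sub>R X p + h p *\<^sub>R Y p) Z = f (fst v) *\<^sub>R nab v X Z + h (fst v) *\<^sub>R nab v Y Z"
  using connection by (simp add: anisotropic_connection_def)

lemma nab_sum_right:
  assumes "finite I" "\<And>i. i \<in> I \<Longrightarrow> g i \<in> smooth_functions \<Phi>" "\<And>i. i \<in> I \<Longrightarrow> F i \<in> vector_fields \<Phi>"
    and v: "v \<in> A" and X: "X \<in> vector_fields \<Phi>"
  shows "nab v X (\<lambda>q. \<Sum>i\<in>I. g i q *\<^sub>R F i q) = (\<Sum>i\<in>I.
    dir_deriv \<Phi> (fst v) (X (fst v)) (g i) *\<^sub>R F i (fst v) + g i (fst v) *\<^sub>R nab v X (F i))"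
  using assms(1-3)
proof (induction I rule: finite_induct)
  case empty
  have "nab v X (\<lambda>q. 0) + nab v X (\<lambda>q. 0) = nab v X (\<lambda>q. 0)"
    unfolding nab_add[OF v X vector_fields_0 vector_fields_0, symmetric]
    by (simp add: plus_fun_def[of "\<lambda>q::'m. 0::('m, 'e) tvec"] del: zero_fun_apply)
  then have "nab v X (\<lambda>q. 0) = 0" by (metis add_cancel_right_right)
  then show ?case by (simp only: sum.empty)
next
  case (insert a I)
  have "nab v X (\<lambda>q. \<Sum>i\<in>insert a I. g i q *\<^sub>R F i q)
      = nab v X ((\<lambda>q. g a q *\<^sub>R F a q) + (\<lambda>q. \<Sum>i\<in>I. g i q *\<^sub>R F i q))"
    using insert.hyps by (simp add: plus_fun_def[of "\<lambda>q. g a q *\<^sub>R F a q"])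
  also have "\<dots> = nab v X (\<lambda>q. g a q *\<^sub>R F a q) + nab v X (\<lambda>q. \<Sum>i\<in>I. g i q *\<^sub>R F i q)"
    using insert by (intro nab_add v X vector_fields_scaleR vector_fields_sum) auto
  also have "nab v X (\<lambda>q. g a q *\<^sub>R F a q) =
      dir_deriv \<Phi> (fst v) (X (fst v)) (g a) *\<^sub>R F a (fst v) + g a (fst v) *\<^sub>R nab v X (F a)"
    using insert.prems by (intro nab_Leibniz v X) auto
  also have "nab v X (\<lambda>q. \<Sum>i\<in>I. g i q *\<^sub>R F i q) = (\<Sum>i\<in>I.
      dir_deriv \<Phi> (fst v) (X (fst v)) (g i) *\<^sub>R F i (fst v) + g i (fst v) *\<^sub>R nab v X (F i))"
    using insert.prems by (intro insert.IH) auto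
  finally show ?case by (simp only: sum.insert[OF insert.hyps])
qed

text \<open>The axiom for the first slot combines two fields with two coefficient functions. Both
  coefficients 0 give the empty sum, and the constant coefficient 1 for the second field gives the
  induction step.\<close>

lemma nab_sum_left:
  assumes "finite I" "\<And>i. i \<in> I \<Longrightarrow> g i \<in> smooth_functions \<Phi>" "\<And>i. i \<in> I \<Longrightarrow> F i \<in> vector_fields \<Phi>"
    and v: "v \<in> A" and Z: "Z \<in> vector_fields \<Phi>"
  shows "nab v (\<lambda>q. \<Sum>i\<in>I. g i q *\<^sub>R F i q) Z = (\<Sum>i\<in>I. g i (fst v) *\<^sub>R nab v (F i) Z)"
  using assms(1-3)
proof (induction I rule: finite_induct)
  case empty
  show ?case
    using nab_linear[OF v Z Z Z smooth_functions_const[of 0] smooth_functions_const[of 0]]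
    by (simp only: sum.empty scaleR_zero_left add_0)
next
  case (insert a I)
  have "nab v (\<lambda>q. g a q *\<^sub>R F a q + 1 *\<^sub>R (\<Sum>i\<in>I. g i q *\<^sub>R F i q)) Z
      = g a (fst v) *\<^sub>R nab v (F a) Z + 1 *\<^sub>R nab v (\<lambda>q. \<Sum>i\<in>I. g i q *\<^sub>R F i q) Z"
    using insert
    by (intro nab_linear[where h = "\<lambda>q. 1"] v Z vector_fields_sum smooth_functions_const) auto
  also have "nab v (\<lambda>q. \<Sum>i\<in>I. g i q *\<^sub>R F i q) Z = (\<Sum>i\<in>I. g i (fst v) *\<^sub>R nab v (F i) Z)"
    using insert.prems by (intro insert.IH) auto
  finally show ?case by (simp only: sum.insert[OF insert.hyps] scaleR_one)
qed

lemma nab_scaleR_left: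
  assumes "v \<in> A" "f \<in> smooth_functions \<Phi>" "X \<in> vector_fields \<Phi>" "Z \<in> vector_fields \<Phi>"
  shows "nab v (\<lambda>q. f q *\<^sub>R X q) Z = f (fst v) *\<^sub>R nab v X Z"
  using nab_sum_left[of "{()}" "\<lambda>_. f" "\<lambda>_. X" v Z] assms by simp

subsection \<open>Christoffel symbols\<close>

text \<open>A connection is only given on global fields.  If \<open>f\<close> is a cutoff function supported in a chart,
  then \<open>f\<^sup>2 Y\<close> is a combination of the globally defined fields \<open>f \<partial>\<^sub>j\<close>, with globally defined
  coefficients \<open>f Y\<^sup>j\<close>; where \<open>f = 1\<close> this expresses \<open>\<nabla>\<^sub>X Y\<close> by the fields \<open>\<nabla>\<^bsub>f \<partial>\<^sub>i\<^esub> (f \<partial>\<^sub>j)\<close>.\<close>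

lemma christoffel_exists:
  assumes c: "c \<in> \<Phi>" and p: "p \<in> dom_chart c"
  obtains B and \<Gamma> :: "'e \<times> 'e \<Rightarrow> 'e \<Rightarrow> 'e \<Rightarrow> 'e"
  where "open B" "p \<in> B" "B \<subseteq> dom_chart c" "\<And>\<xi>. bilinear (\<Gamma> \<xi>)"
    "\<And>a b. smooth_on (in_chart \<Phi> c A) (\<lambda>\<xi>. \<Gamma> \<xi> a b)"
    "\<And>v X Y. v \<in> A \<Longrightarrow> fst v \<in> B \<Longrightarrow> X \<in> vector_fields \<Phi> \<Longrightarrow> Y \<in> vector_fields \<Phi> \<Longrightarrow>
      nab v X Y c = FD (\<lambda>x. Y (param c x) c) (coord c (fst v)) (X (fst v) c)
        + \<Gamma> (coord c (fst v), snd v c) (X (fst v) c) (Y (fst v) c)"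
proof -
  let ?D = "param c ` image_chart c"
  have U: "open (image_chart c)" "image_chart c \<subseteq> image_chart c" using open_image_chart[OF c] by auto
  have D: "q \<in> ?D \<longleftrightarrow> q \<in> dom_chart c" for q
    unfolding mem_param_image[OF c U(2)] using c by auto
  have "coord c p \<in> image_chart c" using c p by simp
  then obtain f :: "'e \<Rightarrow> real" and K V where f: "smooth_on UNIV f" and K: "compact K" "K \<subseteq> image_chart c"
    and V: "open V" "coord c p \<in> V" "V \<subseteq> image_chart c"
    and f1: "\<And>y. y \<in> V \<Longrightarrow> f y = 1" and f0: "\<And>y. y \<notin> K \<Longrightarrow> f y = 0"
    using cutoff_exists[OF U(1)] by metis
  have fU: "smooth_on (image_chart c) f" using smooth_on_subset[OF f] by auto
  \<comment> \<open>\<open>E j\<close> is the cut-off coordinate field in the direction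
    \<open>j\<close>; where \<open>f\<close> is 1 its component is the constant
    \<open>j\<close>.\<close>
  define E where "E = (\<lambda>j q. if q \<in> ?D then lift c q (f (coord c q) *\<^sub>R j) else 0)"
  \<comment> \<open>On the chart \<open>param c (coord c q)\<close> is \<open>q\<close>. The detour
    exhibits the coefficient as a function of the coordinate, which is the form that
    \<open>extend_function\<close> treats.\<close>
  define C where "C = (\<lambda>(Y :: 'm \<Rightarrow> ('m, 'e) tvec) j q. if q \<in> ?D then f (coord c q) * (Y (param c (coord c q)) c \<bullet> j) else 0)"
  define f2 where "f2 = (\<lambda>q. if q \<in> ?D then f (coord c q) * f (coord c q) else 0)"
  define B where "B = param c ` V"
  \<comment> \<open>Prescribed on basis pairs, so bilinear at every \<open>\<xi>\<close>; it is
    smooth over \<open>A\<close> because the global fields \<open>E i\<close> and \<open>E j\<close>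
    may be inserted into the connection.\<close>
  define \<Gamma> where "\<Gamma> = (\<lambda>\<xi> a b. \<Sum>i\<in>Basis. \<Sum>j\<in>Basis. (a \<bullet> i) *\<^sub>R (b \<bullet> j) *\<^sub>R nab (tparam \<Phi> c \<xi>) (E i) (E j) c)"
  have E: "E j \<in> vector_fields \<Phi>" for j
    unfolding E_def
    by (intro extend_field[OF c U K] smooth_on_scaleR smooth_on_const fU U) (simp_all add: f0)
  have C: "C Y j \<in> smooth_functions \<Phi>" if "Y \<in> vector_fields \<Phi>" for Y j
    unfolding C_def
    by (intro extend_function[OF c U K] smooth_on_mult smooth_on_inner vector_field_smooth[OF that] c fU U)
       (simp_all add: f0)
  have f2: "f2 \<in> smooth_functions \<Phi>"
    unfolding f2_def by (intro extend_function[OF c U K] smooth_on_mult fU U) (simp_all add: f0)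
  have f2Y: "(\<lambda>q. f2 q *\<^sub>R Y q) = (\<lambda>q. \<Sum>j\<in>Basis. C Y j q *\<^sub>R E j q)"
    if Y: "Y \<in> vector_fields \<Phi>" for Y
  proof
    fix q show "f2 q *\<^sub>R Y q = (\<Sum>j\<in>Basis. C Y j q *\<^sub>R E j q)"
    proof (cases "q \<in> dom_chart c")
      case True
      show ?thesis
      proof (rule tspace_eqI[OF _ _ c True])
        have "(\<Sum>j\<in>Basis. C Y j q *\<^sub>R E j q) c = (f (coord c q) * f (coord c q)) *\<^sub>R (\<Sum>j\<in>Basis. (Y q c \<bullet> j) *\<^sub>R j)"
          using True c
          by (simp add: sum_component scaleR_fun_def C_def E_def D lift_self scaleR_sum_right algebra_simps)
        then show "(f2 q *\<^sub>R Y q) c = (\<Sum>j\<in>Basis. C Y j q *\<^sub>R E j q) c"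
          using True by (simp add: scaleR_fun_def f2_def D euclidean_representation)
      qed (intro tspace_scaleR tspace_sum vector_field_tspace Y E)+
    qed (simp add: f2_def C_def D)
  qed
  have B: "open B" "p \<in> B" "B \<subseteq> dom_chart c"
    unfolding B_def using V c p mem_param_image[OF c V(3)] by (auto intro!: open_param_image)
  have bil: "bilinear (\<Gamma> \<xi>)" for \<xi>
    unfolding bilinear_def \<Gamma>_def
    by (auto intro!: linear_compose_sum linearI simp: inner_add_left algebra_simps)
  have smooth: "smooth_on (in_chart \<Phi> c A) (\<lambda>\<xi>. \<Gamma> \<xi> a b)" for a b
    unfolding \<Gamma>_def using nab_aniso_field[OF E E] c
    by (intro smooth_on_sum smooth_on_scaleR smooth_on_const open_in_chart c) (auto simp: aniso_fields_def)
  have formula: "nab v X Y c = FD (\<lambda>x. Y (param c x) c) (coord c (fst v)) (X (fst v) c)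
        + \<Gamma> (coord c (fst v), snd v c) (X (fst v) c) (Y (fst v) c)"
    if v: "v \<in> A" "fst v \<in> B" and X: "X \<in> vector_fields \<Phi>" and Y: "Y \<in> vector_fields \<Phi>" for v X Y
  proof -
    let ?q = "fst v" let ?x = "coord c (fst v)"
    have x: "?x \<in> V" "?q \<in> dom_chart c" using v(2) mem_param_image[OF c V(3)] by (auto simp: B_def)
    have f2q: "f2 ?q = 1" using x by (simp add: f2_def D f1)
    \<comment> \<open>\<open>f2\<close> is constantly 1 near the point, so the derivative term of
      the Leibniz rule drops out and \<open>Y\<close> may be replaced by
      \<open>f2 Y\<close>.\<close>
    have "FD (f2 \<circ> param c) ?x = FD (\<lambda>_. 1) ?x"
      using V c by (intro FD_cong[OF V(1) x(1)]) (auto simp: f2_def D f1 subset_iff)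
    then have "dir_deriv \<Phi> ?q (X ?q) f2 = 0"
      by (simp add: dir_deriv_chart[OF f2 c x(2) vector_field_tspace[OF X]])
    then have "nab v X Y = nab v X (\<lambda>q. f2 q *\<^sub>R Y q)"
      by (simp add: nab_Leibniz v X Y f2 f2q)
    also have "\<dots> = (\<Sum>j\<in>Basis. dir_deriv \<Phi> ?q (X ?q) (C Y j) *\<^sub>R E j ?q + C Y j ?q *\<^sub>R nab v X (E j))"
      unfolding f2Y[OF Y] by (intro nab_sum_right C E Y X v finite_Basis)
    finally have "nab v X Y c = (\<Sum>j\<in>Basis. dir_deriv \<Phi> ?q (X ?q) (C Y j) *\<^sub>R E j ?q c)
        + (\<Sum>j\<in>Basis. C Y j ?q *\<^sub>R nab v X (E j) c)"
      by (simp add: sum_component scaleR_fun_def sum.distrib)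
    moreover have "(\<Sum>j\<in>Basis. dir_deriv \<Phi> ?q (X ?q) (C Y j) *\<^sub>R E j ?q c)
        = FD (\<lambda>x. Y (param c x) c) ?x (X ?q c)"
    proof -
      have "dir_deriv \<Phi> ?q (X ?q) (C Y j) = FD (\<lambda>x. Y (param c x) c) ?x (X ?q c) \<bullet> j" for j
      proof -
        have "dir_deriv \<Phi> ?q (X ?q) (C Y j) = FD (C Y j \<circ> param c) ?x (X ?q c)"
          by (rule dir_deriv_chart[OF C[OF Y] c x(2) vector_field_tspace[OF X]])
        also have "FD (C Y j \<circ> param c) ?x = FD (\<lambda>x. Y (param c x) c \<bullet> j) ?x"
          using V c by (intro FD_cong[OF V(1) x(1)]) (auto simp: C_def D f1 subset_iff)
        also have "FD (\<lambda>x. Y (param c x) c \<bullet> j) ?x (X ?q c) = FD (\<lambda>x. Y (param c x) c) ?x (X ?q c) \<bullet> j"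
          by (intro FD_inner differentiableI[OF vector_field_has_derivative[OF Y c x(2)]])
        finally show ?thesis .
      qed
      moreover have "E j ?q c = j" for j using x c by (simp add: E_def D f1 lift_self)
      ultimately show ?thesis by (simp add: euclidean_representation)
    qed
    moreover have "(\<Sum>j\<in>Basis. C Y j ?q *\<^sub>R nab v X (E j) c) = \<Gamma> (?x, snd v c) (X ?q c) (Y ?q c)"
    proof -
      have Cq: "C Z j ?q = Z ?q c \<bullet> j" for Z j using x c by (simp add: C_def D f1)
      have "nab v X (E j) = (\<Sum>i\<in>Basis. (X ?q c \<bullet> i) *\<^sub>R nab v (E i) (E j))" for j
      proof -
        \<comment> \<open>In the first slot the connection is linear over functions, so inserting
          \<open>f2\<close> requires only its value 1 at the point.\<close>
        have "nab v X (E j) = nab v (\<lambda>q. f2 q *\<^sub>R X q) (E j)"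
          by (simp add: nab_scaleR_left v X E f2 f2q)
        also have "\<dots> = (\<Sum>i\<in>Basis. C X i ?q *\<^sub>R nab v (E i) (E j))"
          unfolding f2Y[OF X] by (intro nab_sum_left C E X v finite_Basis)
        finally show ?thesis by (simp add: Cq)
      qed
      then have "(\<Sum>j\<in>Basis. C Y j ?q *\<^sub>R nab v X (E j) c)
          = (\<Sum>j\<in>Basis. \<Sum>i\<in>Basis. (X ?q c \<bullet> i) *\<^sub>R (Y ?q c \<bullet> j) *\<^sub>R nab v (E i) (E j) c)"
        by (simp add: Cq sum_component scaleR_fun_def scaleR_sum_right mult.commute)
      also have "\<dots> = \<Gamma> (?x, snd v c) (X ?q c) (Y ?q c)"
        unfolding \<Gamma>_def using tparam_coord[OF A_tspace[OF v(1)] c x(2)]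
        by (subst sum.swap) simp
      finally show ?thesis .
    qed
    ultimately show ?thesis by simp
  qed
  show ?thesis by (rule that[OF B bil smooth formula])
qed

end

subsection \<open>Derivatives of bilinear families\<close>

locale bilinear_family =
  fixes W :: "'s::euclidean_space set" and \<Gamma> :: "'s \<Rightarrow> 'a::euclidean_space \<Rightarrow> 'b::euclidean_space \<Rightarrow> 'c::euclidean_space"
  assumes open_W: "open W"
    and bilinear_\<Gamma>: "bilinear (\<Gamma> \<xi>)"
    and smooth_\<Gamma>: "smooth_on W (\<lambda>\<xi>. \<Gamma> \<xi> a b)"
begin

definition d\<Gamma> where "d\<Gamma> \<xi> \<eta> a b = FD (\<lambda>\<xi>. \<Gamma> \<xi> a b) \<xi> \<eta>"

definition dd\<Gamma> where "dd\<Gamma> \<xi> \<eta> \<zeta> a b = FD (\<lambda>\<xi>. d\<Gamma> \<xi> \<eta> a b) \<xi> \<zeta>"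

lemma smooth_d\<Gamma>: "smooth_on W (\<lambda>\<xi>. d\<Gamma> \<xi> \<eta> a b)"
  unfolding d\<Gamma>_def by (rule smooth_on_FD[OF smooth_\<Gamma>])

lemma linear_d\<Gamma>: "\<xi> \<in> W \<Longrightarrow> linear (\<lambda>\<eta>. d\<Gamma> \<xi> \<eta> a b)"
  unfolding d\<Gamma>_def by (rule linear_FD[OF smooth_\<Gamma>])

lemma dd\<Gamma>_symmetric: "\<xi> \<in> W \<Longrightarrow> dd\<Gamma> \<xi> \<eta> \<zeta> a b = dd\<Gamma> \<xi> \<zeta> \<eta> a b"
  unfolding dd\<Gamma>_def d\<Gamma>_def by (rule second_FD_symmetric[OF open_W smooth_\<Gamma>])

lemma \<Gamma>_has_derivative: "\<xi> \<in> W \<Longrightarrow> ((\<lambda>\<xi>. \<Gamma> \<xi> a b) has_derivative (\<lambda>\<eta>. d\<Gamma> \<xi> \<eta> a b)) (at \<xi>)"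
  unfolding d\<Gamma>_def by (rule smooth_on_has_derivative[OF smooth_\<Gamma>])

lemma d\<Gamma>_has_derivative: "\<xi> \<in> W \<Longrightarrow> ((\<lambda>\<xi>. d\<Gamma> \<xi> \<eta> a b) has_derivative (\<lambda>\<zeta>. dd\<Gamma> \<xi> \<eta> \<zeta> a b)) (at \<xi>)"
  unfolding dd\<Gamma>_def by (rule smooth_on_has_derivative[OF smooth_d\<Gamma>])

lemma \<Gamma>_linear_left: "linear (\<lambda>a. \<Gamma> \<xi> a b)" and \<Gamma>_linear_right: "linear (\<Gamma> \<xi> a)"
  using bilinear_\<Gamma> by (auto simp: bilinear_def)

text \<open>Bilinearity of each \<open>\<Gamma> \<xi>\<close> passes to the derivative in
  \<open>\<xi>\<close> by uniqueness: the sum and scaling rules give one derivative, the definition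
  the other.\<close>

lemma d\<Gamma>_bilinear:
  assumes \<xi>: "\<xi> \<in> W"
  shows "bilinear (d\<Gamma> \<xi> \<eta>)"
  unfolding bilinear_def
proof (intro conjI allI)
  note D = \<Gamma>_has_derivative[OF \<xi>]
  have eq: "d\<Gamma> \<xi> \<eta> a b = D' \<eta>" if "((\<lambda>\<xi>. \<Gamma> \<xi> a b) has_derivative D') (at \<xi>)" for a b D'
    unfolding d\<Gamma>_def FD_eqI[OF that] ..
  show "linear (d\<Gamma> \<xi> \<eta> a)" for a
    by (rule linearI; rule eq)
       (simp_all only: bilinear_radd[OF bilinear_\<Gamma>] bilinear_rmul[OF bilinear_\<Gamma>]
         has_derivative_add[OF D D] has_derivative_scaleR_right[OF D])
  show "linear (\<lambda>a. d\<Gamma> \<xi> \<eta> a b)" for b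
    by (rule linearI; rule eq)
       (simp_all only: bilinear_ladd[OF bilinear_\<Gamma>] bilinear_lmul[OF bilinear_\<Gamma>]
         has_derivative_add[OF D D] has_derivative_scaleR_right[OF D])
qed

text \<open>\<open>d\<Gamma>\<close> is known to be bilinear on \<open>W\<close> only, while
  differentiating a linear family needs linearity on a whole neighbourhood of the parameter. This
  supplies the neighbourhood.\<close>

lemma preimage_nhd:
  fixes f :: "'t::real_normed_vector \<Rightarrow> 's"
  assumes f: "(f has_derivative f') (at s)" and fs: "f s \<in> W"
  obtains S where "open S" "s \<in> S" "\<And>t. t \<in> S \<Longrightarrow> f t \<in> W"
proof -
  have "isCont f s" using f by (rule has_derivative_continuous)
  then obtain S where "open S" "s \<in> S" "\<forall>t\<in>S. f t \<in> W"
    using open_W fs unfolding continuous_at_open by blast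
  then show ?thesis using that[of S] by blast
qed

lemma \<Gamma>_product_rule:
  fixes f :: "'t::real_normed_vector \<Rightarrow> 's"
  assumes f: "(f has_derivative f') (at s)" and fs: "f s \<in> W"
    and g: "(g has_derivative g') (at s)" and h: "(h has_derivative h') (at s)"
  shows "((\<lambda>s. \<Gamma> (f s) (g s) (h s)) has_derivative
    (\<lambda>d. d\<Gamma> (f s) (f' d) (g s) (h s) + \<Gamma> (f s) (g' d) (h s) + \<Gamma> (f s) (g s) (h' d))) (at s)"
proof -
  have 0: "((\<lambda>s. \<Gamma> (f s) a b) has_derivative (\<lambda>d. d\<Gamma> (f s) (f' d) a b)) (at s)" for a b
    by (rule has_derivative_compose[where g = "\<lambda>\<xi>. \<Gamma> \<xi> a b", OF f \<Gamma>_has_derivative[OF fs]])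
  have "((\<lambda>s. \<Gamma> (f s) (g s) b) has_derivative
      (\<lambda>d. d\<Gamma> (f s) (f' d) (g s) b + \<Gamma> (f s) (g' d) b)) (at s)" for b
    by (rule has_derivative_linear_family[where M = "\<lambda>s a. \<Gamma> (f s) a b", OF open_UNIV UNIV_I \<Gamma>_linear_left 0 g])
  from has_derivative_linear_family[where M = "\<lambda>s b. \<Gamma> (f s) (g s) b",
      OF open_UNIV UNIV_I \<Gamma>_linear_right this h]
  show ?thesis .
qed

lemma d\<Gamma>_product_rule:
  fixes f :: "'t::real_normed_vector \<Rightarrow> 's"
  assumes f: "(f has_derivative f') (at s)" and fs: "f s \<in> W"
    and k: "(k has_derivative k') (at s)"
    and g: "(g has_derivative g') (at s)" and h: "(h has_derivative h') (at s)"
  shows "((\<lambda>s. d\<Gamma> (f s) (k s) (g s) (h s)) has_derivative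
    (\<lambda>d. dd\<Gamma> (f s) (k s) (f' d) (g s) (h s) + d\<Gamma> (f s) (k' d) (g s) (h s)
      + d\<Gamma> (f s) (k s) (g' d) (h s) + d\<Gamma> (f s) (k s) (g s) (h' d))) (at s)"
proof -
  obtain S where S: "open S" "s \<in> S" and fS: "\<And>t. t \<in> S \<Longrightarrow> f t \<in> W"
    using preimage_nhd[OF f fs] by blast
  note bil = d\<Gamma>_bilinear[OF fS, unfolded bilinear_def, THEN conjunct1, rule_format]
    d\<Gamma>_bilinear[OF fS, unfolded bilinear_def, THEN conjunct2, rule_format]
  have 0: "((\<lambda>s. d\<Gamma> (f s) \<eta> a b) has_derivative (\<lambda>d. dd\<Gamma> (f s) \<eta> (f' d) a b)) (at s)" for \<eta> a b
    by (rule has_derivative_compose[where g = "\<lambda>\<xi>. d\<Gamma> \<xi> \<eta> a b", OF f d\<Gamma>_has_derivative[OF fs]])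
  have 1: "((\<lambda>s. d\<Gamma> (f s) (k s) a b) has_derivative
      (\<lambda>d. dd\<Gamma> (f s) (k s) (f' d) a b + d\<Gamma> (f s) (k' d) a b)) (at s)" for a b
    by (rule has_derivative_linear_family[where M = "\<lambda>s \<eta>. d\<Gamma> (f s) \<eta> a b", OF S linear_d\<Gamma>[OF fS] 0 k])
  have "((\<lambda>s. d\<Gamma> (f s) (k s) (g s) b) has_derivative
      (\<lambda>d. dd\<Gamma> (f s) (k s) (f' d) (g s) b + d\<Gamma> (f s) (k' d) (g s) b + d\<Gamma> (f s) (k s) (g' d) b)) (at s)" for b
    by (rule has_derivative_linear_family[where M = "\<lambda>s a. d\<Gamma> (f s) (k s) a b", OF S bil(2) 1 g])
  from has_derivative_linear_family[where M = "\<lambda>s b. d\<Gamma> (f s) (k s) (g s) b", OF S bil(1) this h]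
  show ?thesis .
qed

lemma smooth_d\<Gamma>_app:
  assumes S: "open S" and f: "smooth_on S f" "f ` S \<subseteq> W" and k: "smooth_on S k"
    and g: "smooth_on S g" and h: "smooth_on S h"
  shows "smooth_on S (\<lambda>s. d\<Gamma> (f s) (k s) (g s) (h s))"
proof -
  have fS: "s \<in> S \<Longrightarrow> f s \<in> W" for s using f(2) by blast
  note bil = d\<Gamma>_bilinear[OF fS, unfolded bilinear_def, THEN conjunct1, rule_format]
    d\<Gamma>_bilinear[OF fS, unfolded bilinear_def, THEN conjunct2, rule_format]
  have 0: "smooth_on S (\<lambda>s. d\<Gamma> (f s) \<eta> a b)" for \<eta> a b
    by (rule smooth_on_compose[OF S open_W f smooth_d\<Gamma>])
  have 1: "smooth_on S (\<lambda>s. d\<Gamma> (f s) (k s) a b)" for a b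
    by (rule smooth_on_linear_family[where M = "\<lambda>s \<eta>. d\<Gamma> (f s) \<eta> a b", OF S 0 linear_d\<Gamma>[OF fS] k])
  have "smooth_on S (\<lambda>s. d\<Gamma> (f s) (k s) (g s) b)" for b
    by (rule smooth_on_linear_family[where M = "\<lambda>s a. d\<Gamma> (f s) (k s) a b", OF S 1 bil(2) g])
  then show ?thesis
    by (rule smooth_on_linear_family[where M = "\<lambda>s b. d\<Gamma> (f s) (k s) (g s) b", OF S _ bil(1) h])
qed

end

subsection \<open>Vertical and covariant derivatives in a chart\<close>

context anisotropic
begin

abbreviation tcoord :: "('m, 'e) chart \<Rightarrow> 'm \<times> ('m, 'e) tvec \<Rightarrow> 'e \<times> 'e"
  where "tcoord c v \<equiv> (coord c (fst v), snd v c)"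

lemma aniso_field_tspace: "\<Y> \<in> aniso_fields \<Phi> A \<Longrightarrow> v \<in> A \<Longrightarrow> \<Y> v \<in> tspace \<Phi> (fst v)"
  and aniso_field_smooth:
    "\<Y> \<in> aniso_fields \<Phi> A \<Longrightarrow> c \<in> \<Phi> \<Longrightarrow> smooth_on (in_chart \<Phi> c A) (\<lambda>\<xi>. \<Y> (tparam \<Phi> c \<xi>) c)"
  by (simp_all add: aniso_fields_def)

lemma tparam_tcoord: "v \<in> A \<Longrightarrow> c \<in> \<Phi> \<Longrightarrow> fst v \<in> dom_chart c \<Longrightarrow> tparam \<Phi> c (tcoord c v) = v"
  by (simp add: tparam_coord A_tspace)

text \<open>Taking components is linear in each fibre, so straight lines in the fibre are straight
  lines in coordinates and the vertical derivative is a partial derivative in the second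
  variable.\<close>

lemma tparam_vertical_line:
  assumes "v \<in> A" "c \<in> \<Phi>" "fst v \<in> dom_chart c" "z \<in> tspace \<Phi> (fst v)"
  shows "tparam \<Phi> c (tcoord c v + t *\<^sub>R (0, z c)) = (fst v, snd v + t *\<^sub>R z)"
  using tparam_coord[OF tspace_add[OF A_tspace[OF assms(1)] tspace_scaleR[OF assms(4), of t]] assms(2,3)]
  by (simp add: scaleR_fun_def)

lemma vertical_line_has_derivative:
  "((\<lambda>t. \<xi> + t *\<^sub>R \<eta>) has_derivative (\<lambda>r. r *\<^sub>R \<eta>)) (at t)"
  by (auto intro!: derivative_eq_intros)

text \<open>Openness of \<open>A\<close> keeps the line in \<open>A\<close> for small
  \<open>t\<close>, hence tangency and component formulas, which are stated over \<open>A\<close>,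
  hold along it near \<open>t = 0\<close>.\<close>

lemma vertical_line_in_A:
  assumes "v \<in> A" "z \<in> tspace \<Phi> (fst v)"
  obtains T :: "real set" where "open T" "0 \<in> T" "\<And>t. t \<in> T \<Longrightarrow> (fst v, snd v + t *\<^sub>R z) \<in> A"
proof -
  obtain c where c: "c \<in> \<Phi>" "fst v \<in> dom_chart c" using chart_exists by blast
  let ?f = "\<lambda>t. tcoord c v + t *\<^sub>R (0, z c)"
  let ?T = "?f -` in_chart \<Phi> c A"
  have "continuous_on UNIV ?f" by (intro continuous_intros)
  then have "open ?T" using open_in_chart[OF c(1)] by (simp add: continuous_on_open_vimage)
  moreover have "0 \<in> ?T" using mem_in_chart[OF assms(1) c] by simp
  moreover have "(fst v, snd v + t *\<^sub>R z) \<in> A" if "t \<in> ?T" for t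
  proof -
    have "tparam \<Phi> c (?f t) \<in> A" using that by (simp only: in_chart_def vimage_def mem_Collect_eq)
    then show ?thesis by (simp only: tparam_vertical_line[OF assms(1) c assms(2)])
  qed
  ultimately show ?thesis by (rule that)
qed

lemma vert_deriv_component_derivative:
  assumes \<Y>: "\<Y> \<in> aniso_fields \<Phi> A" and v: "v \<in> A" and c: "c \<in> \<Phi>" "fst v \<in> dom_chart c"
    and z: "z \<in> tspace \<Phi> (fst v)"
  shows "((\<lambda>t. \<Y> (fst v, snd v + t *\<^sub>R z) c) has_vector_derivative
    FD (\<lambda>\<xi>. \<Y> (tparam \<Phi> c \<xi>) c) (tcoord c v) (0, z c)) (at 0)"
proof -
  let ?H = "\<lambda>\<xi>. \<Y> (tparam \<Phi> c \<xi>) c"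
  have W: "tcoord c v \<in> in_chart \<Phi> c A" by (rule mem_in_chart[OF v c])
  have "(?H has_derivative FD ?H (tcoord c v)) (at (tcoord c v + 0 *\<^sub>R (0, z c)))"
    using smooth_on_has_derivative[OF aniso_field_smooth[OF \<Y> c(1)] W] by simp
  from has_derivative_compose[where g = ?H, OF vertical_line_has_derivative this]
  have "((\<lambda>t. \<Y> (fst v, snd v + t *\<^sub>R z) c) has_derivative
      (\<lambda>r. FD ?H (tcoord c v) (r *\<^sub>R (0, z c)))) (at 0)"
    by (simp only: tparam_vertical_line[OF v c z])
  then show ?thesis
    unfolding has_vector_derivative_def
    by (simp only: linear_cmul[OF linear_FD[OF aniso_field_smooth[OF \<Y> c(1)] W]])
qed

lemma vert_deriv_component:
  assumes "\<Y> \<in> aniso_fields \<Phi> A" "v \<in> A" "c \<in> \<Phi>" "fst v \<in> dom_chart c" "z \<in> tspace \<Phi> (fst v)"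
  shows "vert_deriv \<Y> v z c = FD (\<lambda>\<xi>. \<Y> (tparam \<Phi> c \<xi>) c) (tcoord c v) (0, z c)"
  unfolding vert_deriv_def by (rule vector_derivative_at[OF vert_deriv_component_derivative[OF assms]])

text \<open>The hypothesis concerns one fibre only, so that the lemma also covers the curvature
  evaluated at fixed tangent vectors, which makes sense only over their base point.\<close>

lemma vert_deriv_component_outside:
  assumes \<Y>: "\<And>y. (fst v, y) \<in> A \<Longrightarrow> \<Y> (fst v, y) \<in> tspace \<Phi> (fst v)"
    and v: "v \<in> A" and z: "z \<in> tspace \<Phi> (fst v)"
    and c: "\<not> (c \<in> \<Phi> \<and> fst v \<in> dom_chart c)"
  shows "vert_deriv \<Y> v z c = 0"
proof -
  obtain T :: "real set" where T: "open T" "0 \<in> T" and TA: "\<And>t. t \<in> T \<Longrightarrow> (fst v, snd v + t *\<^sub>R z) \<in> A"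
    using vertical_line_in_A[OF v z] by blast
  have "((\<lambda>t. \<Y> (fst v, snd v + t *\<^sub>R z) c) has_vector_derivative 0) (at 0)"
  proof (rule has_vector_derivative_transform_within_open[OF has_vector_derivative_const T])
    fix t assume "t \<in> T"
    from tspace_zero[OF \<Y>[OF TA[OF this]] c] show "0 = \<Y> (fst v, snd v + t *\<^sub>R z) c" ..
  qed
  then show ?thesis unfolding vert_deriv_def by (rule vector_derivative_at)
qed

text \<open>The base point stays fixed along a vertical line, so the Jacobian is a constant linear
  map and commutes with the derivative in \<open>t\<close>.\<close>

lemma vert_deriv_tspace:
  assumes \<Y>: "\<Y> \<in> aniso_fields \<Phi> A" and v: "v \<in> A" and z: "z \<in> tspace \<Phi> (fst v)"
  shows "vert_deriv \<Y> v z \<in> tspace \<Phi> (fst v)"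
proof (rule tspaceI)
  fix c d assume cd: "c \<in> \<Phi>" "d \<in> \<Phi>" "fst v \<in> dom_chart c" "fst v \<in> dom_chart d"
  obtain T :: "real set" where T: "open T" "0 \<in> T" and TA: "\<And>t. t \<in> T \<Longrightarrow> (fst v, snd v + t *\<^sub>R z) \<in> A"
    using vertical_line_in_A[OF v z] by blast
  note D = vert_deriv_component_derivative[OF \<Y> v _ _ z]
  have "((\<lambda>t. jac c d (fst v) (\<Y> (fst v, snd v + t *\<^sub>R z) c)) has_vector_derivative
      jac c d (fst v) (FD (\<lambda>\<xi>. \<Y> (tparam \<Phi> c \<xi>) c) (tcoord c v) (0, z c))) (at 0)"
    by (rule bounded_linear.has_vector_derivative[OF linear_jac[OF cd, unfolded linear_conv_bounded_linear] D[OF cd(1,3)]])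
  then have "((\<lambda>t. \<Y> (fst v, snd v + t *\<^sub>R z) d) has_vector_derivative
      jac c d (fst v) (FD (\<lambda>\<xi>. \<Y> (tparam \<Phi> c \<xi>) c) (tcoord c v) (0, z c))) (at 0)"
  proof (rule has_vector_derivative_transform_within_open[OF _ T])
    fix t assume "t \<in> T"
    from aniso_field_tspace[OF \<Y> TA[OF this]]
    have "\<Y> (fst v, snd v + t *\<^sub>R z) \<in> tspace \<Phi> (fst v)" by (simp only: fst_conv)
    from tspace_transform[OF this cd]
    show "jac c d (fst v) (\<Y> (fst v, snd v + t *\<^sub>R z) c) = \<Y> (fst v, snd v + t *\<^sub>R z) d" ..
  qed
  then show "vert_deriv \<Y> v z d = jac c d (fst v) (vert_deriv \<Y> v z c)"
    unfolding vert_deriv_component[OF \<Y> v cd(1,3) z] unfolding vert_deriv_def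
    by (rule vector_derivative_at)
next
  fix c assume c: "\<not> (c \<in> \<Phi> \<and> fst v \<in> dom_chart c)"
  have "\<Y> (fst v, y) \<in> tspace \<Phi> (fst v)" if "(fst v, y) \<in> A" for y
    using aniso_field_tspace[OF \<Y> that] by simp
  then show "vert_deriv \<Y> v z c = 0" by (rule vert_deriv_component_outside[OF _ v z c])
qed

text \<open>A global extension of \<open>v\<close> remains in \<open>A\<close> near the base point,
  since its component is continuous and \<open>A\<close> is open in coordinates; it is restricted to
  that neighbourhood.\<close>

lemma admissible_extension_exists:
  assumes v: "v \<in> A"
  shows "\<exists>V \<Omega>. admissible_extension \<Phi> A v \<Omega> V"
proof -
  obtain c where c: "c \<in> \<Phi>" "fst v \<in> dom_chart c" using chart_exists by blast
  define V where "V = field_ext \<Phi> (fst v) (snd v)"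
  have V: "V \<in> vector_fields \<Phi>" "V (fst v) = snd v"
    unfolding V_def by (rule field_ext_props[OF A_tspace[OF v]])+
  let ?f = "\<lambda>x. (x, V (param c x) c)"
  let ?U = "image_chart c \<inter> ?f -` in_chart \<Phi> c A"
  have "continuous_on (image_chart c) ?f"
    by (intro continuous_intros smooth_on_continuous_on[OF vector_field_smooth[OF V(1) c(1)]])
  then have U: "open ?U" "?U \<subseteq> image_chart c"
    using continuous_open_preimage[OF _ open_image_chart[OF c(1)] open_in_chart[OF c(1)]] by auto
  have \<Omega>: "open (param c ` ?U)" by (rule open_param_image[OF c(1) U])
  have "fst v \<in> param c ` ?U"
    unfolding mem_param_image[OF c(1) U(2)] using c mem_in_chart[OF v c] V(2) by simp
  moreover have "(q, V q) \<in> A" if "q \<in> param c ` ?U" for q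
  proof -
    have q: "q \<in> dom_chart c" "(coord c q, V q c) \<in> in_chart \<Phi> c A"
      using that c unfolding mem_param_image[OF c(1) U(2)] by auto
    then have "tparam \<Phi> c (coord c q, V q c) \<in> A" by (simp add: in_chart_def)
    then show ?thesis using tparam_coord[OF vector_field_tspace[OF V(1)] c(1) q(1)] by simp
  qed
  moreover have "V \<in> vector_fields_on \<Phi> (param c ` ?U)"
    using V(1) unfolding vector_fields_on_def by (auto intro: smooth_on_subset)
  ultimately show ?thesis
    using V(2) \<Omega> unfolding admissible_extension_def by blast
qed

end

section \<open>Coordinate formulas for the connection, \<open>P\<close>, the torsion and the
  curvature\<close>

locale christoffel = anisotropic \<Phi> A nab + bilinear_family "in_chart \<Phi> c A" \<Gamma>
  for \<Phi> :: "('m::{t2_space, second_countable_topology}, 'e::euclidean_space) chart set"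
    and A :: "('m \<times> ('m, 'e) tvec) set" and nab :: "('m, 'e) aconn"
    and c :: "('m, 'e) chart" and \<Gamma> :: "'e \<times> 'e \<Rightarrow> 'e \<Rightarrow> 'e \<Rightarrow> 'e" +
  fixes B :: "'m set"
  assumes chart: "c \<in> \<Phi>" and open_B: "open B" and B_dom: "B \<subseteq> dom_chart c"
    and nab_component: "\<And>v X Y. v \<in> A \<Longrightarrow> fst v \<in> B \<Longrightarrow> X \<in> vector_fields \<Phi> \<Longrightarrow> Y \<in> vector_fields \<Phi> \<Longrightarrow>
      nab v X Y c = FD (\<lambda>x. Y (param c x) c) (coord c (fst v)) (X (fst v) c)
        + \<Gamma> (coord c (fst v), snd v c) (X (fst v) c) (Y (fst v) c)"

lemma (in anisotropic) christoffel_locale: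
  assumes "c \<in> \<Phi>" "p \<in> dom_chart c"
  obtains B \<Gamma> where "christoffel \<Phi> A nab c \<Gamma> B" "p \<in> B"
proof -
  obtain B \<Gamma> where "open B" "p \<in> B" "B \<subseteq> dom_chart c" "\<And>\<xi>. bilinear (\<Gamma> \<xi>)"
    "\<And>a b. smooth_on (in_chart \<Phi> c A) (\<lambda>\<xi>. \<Gamma> \<xi> a b)"
    "\<And>v X Y. v \<in> A \<Longrightarrow> fst v \<in> B \<Longrightarrow> X \<in> vector_fields \<Phi> \<Longrightarrow> Y \<in> vector_fields \<Phi> \<Longrightarrow>
      nab v X Y c = FD (\<lambda>x. Y (param c x) c) (coord c (fst v)) (X (fst v) c)
        + \<Gamma> (coord c (fst v), snd v c) (X (fst v) c) (Y (fst v) c)"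
    using christoffel_exists[OF assms] by metis
  then have "christoffel \<Phi> A nab c \<Gamma> B"
    using open_in_chart[OF assms(1)] assms(1) by unfold_locales auto
  then show ?thesis using that \<open>p \<in> B\<close> by blast
qed

context christoffel
begin

abbreviation rep :: "('m \<Rightarrow> ('m, 'e) tvec) \<Rightarrow> 'e \<Rightarrow> 'e"
  where "rep X \<equiv> \<lambda>x. X (param c x) c"

lemma B_chart: "q \<in> B \<Longrightarrow> q \<in> dom_chart c"
  using B_dom by blast

lemma tcoord_in: "v \<in> A \<Longrightarrow> fst v \<in> B \<Longrightarrow> tcoord c v \<in> in_chart \<Phi> c A"
  by (simp add: mem_in_chart chart B_chart)

lemma rep_has_derivative:
  "X \<in> vector_fields \<Phi> \<Longrightarrow> q \<in> B \<Longrightarrow> (rep X has_derivative FD (rep X) (coord c q)) (at (coord c q))"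
  by (simp add: vector_field_has_derivative chart B_chart)

lemma rep_coord: "q \<in> B \<Longrightarrow> rep X (coord c q) = X q c"
  by (simp add: chart B_chart)

text \<open>The coordinate formula involves only the value and the first derivative of the field at
  the point, so the global field selected in \<open>nab_local\<close> may be exchanged for
  \<open>Y\<close>, which has the same germ.\<close>

lemma nab_local_component:
  assumes v: "v \<in> A" "fst v \<in> B" and X: "X \<in> vector_fields \<Phi>"
    and U: "open U" "U \<subseteq> image_chart c" "coord c (fst v) \<in> U"
    and Y: "\<And>x. x \<in> U \<Longrightarrow> Y (param c x) \<in> tspace \<Phi> (param c x)"
    and Ys: "smooth_on U (rep Y)"
  shows "nab_local \<Phi> nab v X Y \<in> tspace \<Phi> (fst v)"
    and "nab_local \<Phi> nab v X Y c = FD (rep Y) (coord c (fst v)) (X (fst v) c)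
      + \<Gamma> (tcoord c v) (X (fst v) c) (Y (fst v) c)"
proof -
  let ?P = "\<lambda>Y'. Y' \<in> vector_fields \<Phi> \<and> (\<exists>N. open N \<and> fst v \<in> N \<and> (\<forall>q\<in>N. Y' q = Y q))"
  define Y' where "Y' = (SOME Y'. ?P Y')"
  have "param c (coord c (fst v)) = fst v" using chart B_chart[OF v(2)] by simp
  with germ_extension[where Y = Y, OF chart U Y Ys] have "\<exists>Y'. ?P Y'" by auto
  then have "?P Y'" unfolding Y'_def by (rule someI_ex)
  then obtain N where Y': "Y' \<in> vector_fields \<Phi>" and N: "open N" "fst v \<in> N" and eq: "\<And>q. q \<in> N \<Longrightarrow> Y' q = Y q"
    by blast
  have "FD (rep Y') (coord c (fst v)) = FD (rep Y) (coord c (fst v))"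
  proof (rule FD_cong)
    show "open (coord c ` (dom_chart c \<inter> N))" by (rule open_coord_image[OF chart N(1)])
    show "coord c (fst v) \<in> coord c ` (dom_chart c \<inter> N)" using N B_chart[OF v(2)] by blast
    show "rep Y' x = rep Y x" if "x \<in> coord c ` (dom_chart c \<inter> N)" for x
      using that eq unfolding mem_coord_image[OF chart] by simp
  qed
  then show "nab_local \<Phi> nab v X Y c = FD (rep Y) (coord c (fst v)) (X (fst v) c)
      + \<Gamma> (tcoord c v) (X (fst v) c) (Y (fst v) c)"
    using nab_component[OF v X Y'] eq[OF N(2)] unfolding nab_local_def Y'_def[symmetric] by simp
  show "nab_local \<Phi> nab v X Y \<in> tspace \<Phi> (fst v)"
    unfolding nab_local_def Y'_def[symmetric] by (rule nab_tspace[OF v(1) X Y'])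
qed

text \<open>Along \<open>x \<mapsto> (x, V x)\<close> the chain rule yields
  \<open>FD H (a, DV a)\<close>, and the vertical correction subtracts
  \<open>FD H (0, DV a + \<Gamma>(a, y))\<close>. The derivative of \<open>V\<close> cancels, which
  is the independence of the selected extension.\<close>

lemma nab_aniso_component:
  assumes v: "v \<in> A" "fst v \<in> B" and X: "X \<in> vector_fields \<Phi>" and \<Y>: "\<Y> \<in> aniso_fields \<Phi> A"
  defines "H \<equiv> \<lambda>\<xi>. \<Y> (tparam \<Phi> c \<xi>) c"
  shows "nab_aniso \<Phi> A nab v X \<Y> \<in> tspace \<Phi> (fst v)"
    and "nab_aniso \<Phi> A nab v X \<Y> c = FD H (tcoord c v) (X (fst v) c, 0)
      + \<Gamma> (tcoord c v) (X (fst v) c) (\<Y> v c)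
      - FD H (tcoord c v) (0, \<Gamma> (tcoord c v) (X (fst v) c) (snd v c))"
proof -
  let ?q = "fst v" let ?x = "coord c ?q"
  have q: "?q \<in> dom_chart c" by (rule B_chart[OF v(2)])
  define V where "V = (SOME V. \<exists>\<Omega>. admissible_extension \<Phi> A v \<Omega> V)"
  have "\<exists>\<Omega>. admissible_extension \<Phi> A v \<Omega> V"
    unfolding V_def by (rule someI_ex[OF admissible_extension_exists[OF v(1)]])
  then obtain \<Omega> where \<Omega>: "open \<Omega>" "?q \<in> \<Omega>" and V: "V \<in> vector_fields_on \<Phi> \<Omega>"
    and VA: "\<And>p. p \<in> \<Omega> \<Longrightarrow> (p, V p) \<in> A" and Vq: "V ?q = snd v"
    unfolding admissible_extension_def by blast
  let ?U = "coord c ` (dom_chart c \<inter> \<Omega>)"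
  have U: "open ?U" "?U \<subseteq> image_chart c" "?x \<in> ?U"
    using open_coord_image[OF chart \<Omega>(1)] \<Omega> q by (auto simp: image_chart_def)
  have Vs: "smooth_on ?U (rep V)" using V chart unfolding vector_fields_on_def by blast
  have mem: "param c x \<in> \<Omega>" "param c x \<in> dom_chart c" "coord c (param c x) = x" if "x \<in> ?U" for x
    using that chart unfolding mem_coord_image[OF chart] by auto
  have VU: "V (param c x) \<in> tspace \<Phi> (param c x)" if "x \<in> ?U" for x
    using A_tspace[OF VA[OF mem(1)[OF that]]] by simp
  have tc: "(x, rep V x) \<in> in_chart \<Phi> c A" "tparam \<Phi> c (x, rep V x) = (param c x, V (param c x))"
    if "x \<in> ?U" for x
    using mem_in_chart[OF VA[OF mem(1)[OF that]] chart] tparam_tcoord[OF VA[OF mem(1)[OF that]] chart]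
      mem[OF that] by simp_all
  note Hs = aniso_field_smooth[OF \<Y> chart, folded H_def]
  have rep\<Y>: "\<Y> (param c x, V (param c x)) c = H (x, rep V x)" if "x \<in> ?U" for x
    using tc(2)[OF that] by (simp add: H_def)
  have s: "smooth_on ?U (\<lambda>x. H (x, rep V x))"
    by (rule smooth_on_compose[where g = H, OF U(1) open_in_chart[OF chart] _ _ Hs])
       (use tc(1) in \<open>auto intro!: smooth_on_Pair smooth_on_ident U Vs\<close>)
  have \<Y>s: "smooth_on ?U (\<lambda>x. \<Y> (param c x, V (param c x)) c)"
    using s smooth_on_cong[OF U(1), of "\<lambda>x. \<Y> (param c x, V (param c x)) c", OF rep\<Y>] by simp
  have \<Y>t: "\<Y> (param c x, V (param c x)) \<in> tspace \<Phi> (param c x)" if "x \<in> ?U" for x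
    using aniso_field_tspace[OF \<Y> VA[OF mem(1)[OF that]]] by simp
  have nabV: "nab_local \<Phi> nab v X V \<in> tspace \<Phi> ?q"
      "nab_local \<Phi> nab v X V c = FD (rep V) ?x (X ?q c) + \<Gamma> (tcoord c v) (X ?q c) (V ?q c)"
    by (rule nab_local_component(1)[OF v X U VU Vs] nab_local_component(2)[OF v X U VU Vs]; assumption)+
  note nab\<Y> = nab_local_component[where Y = "\<lambda>p. \<Y> (p, V p)", OF v X U \<Y>t \<Y>s]
  have def: "nab_aniso \<Phi> A nab v X \<Y> = nab_local \<Phi> nab v X (\<lambda>p. \<Y> (p, V p))
      - vert_deriv \<Y> v (nab_local \<Phi> nab v X V)"
    unfolding nab_aniso_def V_def[symmetric] Let_def ..
  show "nab_aniso \<Phi> A nab v X \<Y> \<in> tspace \<Phi> ?q"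
    unfolding def by (intro tspace_diff nab\<Y>(1) vert_deriv_tspace \<Y> v nabV(1))
  let ?a = "X ?q c"
  have W: "tcoord c v \<in> in_chart \<Phi> c A" by (rule tcoord_in[OF v])
  have lin: "linear (FD H (tcoord c v))" by (rule linear_FD[OF Hs W])
  have xV: "(?x, rep V ?x) = tcoord c v" using chart q Vq by simp
  have "((\<lambda>x. (x, rep V x)) has_derivative (\<lambda>a. (a, FD (rep V) ?x a))) (at ?x)"
    by (intro has_derivative_Pair has_derivative_ident smooth_on_has_derivative[OF Vs U(3)])
  moreover have "(H has_derivative FD H (tcoord c v)) (at (?x, rep V ?x))"
    unfolding xV by (rule smooth_on_has_derivative[OF Hs W])
  ultimately have "((\<lambda>x. H (x, rep V x)) has_derivative (\<lambda>a. FD H (tcoord c v) (a, FD (rep V) ?x a))) (at ?x)"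
    by (rule has_derivative_compose[where g = H and f = "\<lambda>x. (x, rep V x)"])
  moreover have "FD (\<lambda>x. \<Y> (param c x, V (param c x)) c) ?x = FD (\<lambda>x. H (x, rep V x)) ?x"
    by (rule FD_cong[OF U(1,3) rep\<Y>])
  ultimately have "FD (\<lambda>x. \<Y> (param c x, V (param c x)) c) ?x ?a = FD H (tcoord c v) (?a, FD (rep V) ?x ?a)"
    by (simp add: FD_eqI)
  moreover have "vert_deriv \<Y> v (nab_local \<Phi> nab v X V) c
      = FD H (tcoord c v) (0, FD (rep V) ?x ?a + \<Gamma> (tcoord c v) ?a (snd v c))"
    using vert_deriv_component[OF \<Y> v(1) chart q nabV(1)] unfolding nabV(2) H_def Vq .
  moreover have "\<Y> (?q, V ?q) = \<Y> v" using Vq by simp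
  ultimately have "nab_aniso \<Phi> A nab v X \<Y> c =
      FD H (tcoord c v) (?a, FD (rep V) ?x ?a) + \<Gamma> (tcoord c v) ?a (\<Y> v c)
      - FD H (tcoord c v) (0, FD (rep V) ?x ?a + \<Gamma> (tcoord c v) ?a (snd v c))"
    unfolding def using nab\<Y>(2) by simp
  \<comment> \<open>The two values of the linear map \<open>FD H\<close> are joined into one, so
    that the cancellation takes place in its argument.\<close>
  also have "\<dots> = \<Gamma> (tcoord c v) ?a (\<Y> v c) + FD H (tcoord c v)
      ((?a, FD (rep V) ?x ?a) - (0, FD (rep V) ?x ?a + \<Gamma> (tcoord c v) ?a (snd v c)))"
    unfolding linear_diff[OF lin] by simp
  also have "(?a, FD (rep V) ?x ?a) - (0, FD (rep V) ?x ?a + \<Gamma> (tcoord c v) ?a (snd v c))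
      = (?a, 0) - (0, \<Gamma> (tcoord c v) ?a (snd v c))"
    by simp
  finally show "nab_aniso \<Phi> A nab v X \<Y> c = FD H (tcoord c v) (?a, 0)
      + \<Gamma> (tcoord c v) ?a (\<Y> v c) - FD H (tcoord c v) (0, \<Gamma> (tcoord c v) ?a (snd v c))"
    unfolding linear_diff[OF lin] by simp
qed

text \<open>The total derivative of \<open>DY(X) + \<Gamma>(X, Y)\<close> in the point of
  \<open>A\<close>. Vertical directions will give \<open>P\<close>, horizontal ones the derivative
  terms of the curvature.\<close>

lemma nab_chart_derivative:
  assumes v: "v \<in> A" "fst v \<in> B" and X: "X \<in> vector_fields \<Phi>" and Y: "Y \<in> vector_fields \<Phi>"
  shows "((\<lambda>\<xi>. nab (tparam \<Phi> c \<xi>) X Y c) has_derivative (\<lambda>\<eta>.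
      FD (\<lambda>x. FD (rep Y) x (X (fst v) c)) (coord c (fst v)) (fst \<eta>)
      + FD (rep Y) (coord c (fst v)) (FD (rep X) (coord c (fst v)) (fst \<eta>))
      + (d\<Gamma> (tcoord c v) \<eta> (X (fst v) c) (Y (fst v) c)
      + \<Gamma> (tcoord c v) (FD (rep X) (coord c (fst v)) (fst \<eta>)) (Y (fst v) c)
      + \<Gamma> (tcoord c v) (X (fst v) c) (FD (rep Y) (coord c (fst v)) (fst \<eta>))))) (at (tcoord c v))"
    (is "(_ has_derivative ?D) _")
proof -
  \<comment> \<open>The coordinate formula for the connection is available over \<open>B\<close>
    only; this is the corresponding open set of coordinates.\<close>
  let ?W = "in_chart \<Phi> c A \<inter> (coord c ` (dom_chart c \<inter> B)) \<times> UNIV"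
  let ?f = "\<lambda>\<xi>. FD (rep Y) (fst \<xi>) (rep X (fst \<xi>)) + \<Gamma> \<xi> (rep X (fst \<xi>)) (rep Y (fst \<xi>))"
  let ?x = "coord c (fst v)"
  have W: "open ?W" "tcoord c v \<in> ?W"
    using tcoord_in[OF v] B_chart[OF v(2)] v(2) open_coord_image[OF chart open_B]
    by (auto intro!: open_Int open_in_chart chart open_Times)
  have eq: "?f \<xi> = nab (tparam \<Phi> c \<xi>) X Y c" if \<xi>: "\<xi> \<in> ?W" for \<xi>
  proof -
    obtain q where q: "q \<in> B" "q \<in> dom_chart c" "fst \<xi> = coord c q" using \<xi> by auto
    have t: "tparam \<Phi> c \<xi> = (q, lift c q (snd \<xi>))"
      using tparam_eq[OF chart, of "fst \<xi>" "snd \<xi>"] q chart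
      unfolding prod.collapse by simp
    moreover have "tparam \<Phi> c \<xi> \<in> A" using \<xi> by (auto simp: in_chart_def)
    ultimately have "nab (tparam \<Phi> c \<xi>) X Y c
        = FD (rep Y) (coord c q) (X q c) + \<Gamma> (coord c q, lift c q (snd \<xi>) c) (X q c) (Y q c)"
      using nab_component[OF _ _ X Y, of "(q, lift c q (snd \<xi>))"] q(1) by (simp only: fst_conv snd_conv)
    moreover have "(coord c q, lift c q (snd \<xi>) c) = \<xi>"
      unfolding lift_self[OF chart q(2)] q(3)[symmetric] by (rule prod.collapse)
    ultimately show ?thesis by (simp only: q(3) rep_coord[OF q(1)])
  qed
  have x: "?x \<in> image_chart c" using B_chart[OF v(2)] chart by simp
  have fst_D: "(fst has_derivative fst) (at (tcoord c v))"
    by (rule bounded_linear_imp_has_derivative[OF bounded_linear_fst])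
  have repD: "((\<lambda>\<xi>. rep Z (fst \<xi>)) has_derivative (\<lambda>\<eta>. FD (rep Z) ?x (fst \<eta>))) (at (tcoord c v))"
    if "Z \<in> vector_fields \<Phi>" for Z
    using has_derivative_compose[where g = "rep Z", OF fst_D] rep_has_derivative[OF that v(2)] by simp
  have repv: "rep Z (fst (tcoord c v)) = Z (fst v) c" for Z by (simp add: rep_coord v(2))
  note Ys = vector_field_smooth[OF Y chart]
  have "((\<lambda>x. FD (rep Y) x (rep X x)) has_derivative (\<lambda>d.
      FD (\<lambda>x. FD (rep Y) x (rep X ?x)) ?x d + FD (rep Y) ?x (FD (rep X) ?x d))) (at ?x)"
    by (rule has_derivative_linear_family[where M = "FD (rep Y)", OF open_image_chart[OF chart] x
        linear_FD[OF Ys] smooth_on_has_derivative[OF smooth_on_FD[OF Ys] x] rep_has_derivative[OF X v(2)]])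
  then have "((\<lambda>x. FD (rep Y) x (rep X x)) has_derivative (\<lambda>d.
      FD (\<lambda>x. FD (rep Y) x (X (fst v) c)) ?x d + FD (rep Y) ?x (FD (rep X) ?x d))) (at (fst (tcoord c v)))"
    by (simp only: rep_coord[OF v(2)] fst_conv)
  from has_derivative_compose[where g = "\<lambda>x. FD (rep Y) x (rep X x)", OF fst_D this]
    \<Gamma>_product_rule[OF has_derivative_ident tcoord_in[OF v] repD[OF X] repD[OF Y]]
  have "(?f has_derivative ?D) (at (tcoord c v))"
    unfolding repv by (rule has_derivative_add)
  then show ?thesis by (rule has_derivative_transform_within_open[OF _ W eq])
qed

lemma linear_FD_rep: "Z \<in> vector_fields \<Phi> \<Longrightarrow> q \<in> B \<Longrightarrow> linear (FD (rep Z) (coord c q))"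
  by (simp add: linear_FD[OF vector_field_smooth] chart B_chart)

lemma linear_FD_FD_rep:
  "Z \<in> vector_fields \<Phi> \<Longrightarrow> q \<in> B \<Longrightarrow> linear (FD (\<lambda>x. FD (rep Z) x a) (coord c q))"
  by (simp add: linear_FD[OF smooth_on_FD[OF vector_field_smooth]] chart B_chart)

lemmas \<Gamma>_bilinear_simps = bilinear_ladd[OF bilinear_\<Gamma>] bilinear_radd[OF bilinear_\<Gamma>]
  bilinear_lsub[OF bilinear_\<Gamma>] bilinear_rsub[OF bilinear_\<Gamma>]
  bilinear_lzero[OF bilinear_\<Gamma>] bilinear_rzero[OF bilinear_\<Gamma>]

text \<open>A vertical direction has first component 0, which removes every term with a derivative
  of \<open>X\<close> or \<open>Y\<close>. Hence only the values at the base point remain and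
  \<open>P\<close> does not depend on the chosen fields.\<close>

lemma conn_vert_deriv_fields:
  assumes v: "v \<in> A" "fst v \<in> B" and z: "z \<in> tspace \<Phi> (fst v)"
    and X: "X \<in> vector_fields \<Phi>" and Y: "Y \<in> vector_fields \<Phi>"
  shows "vert_deriv (\<lambda>v. nab v X Y) v z c = d\<Gamma> (tcoord c v) (0, z c) (X (fst v) c) (Y (fst v) c)"
proof -
  note 0 = linear_0[OF linear_FD_rep[OF X v(2)]] linear_0[OF linear_FD_rep[OF Y v(2)]]
    linear_0[OF linear_FD_FD_rep[OF Y v(2)]]
  have "vert_deriv (\<lambda>v. nab v X Y) v z c = FD (\<lambda>\<xi>. nab (tparam \<Phi> c \<xi>) X Y c) (tcoord c v) (0, z c)"
    by (rule vert_deriv_component[OF nab_aniso_field[OF X Y] v(1) chart B_chart[OF v(2)] z])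
  also have "\<dots> = d\<Gamma> (tcoord c v) (0, z c) (X (fst v) c) (Y (fst v) c)"
    unfolding FD_eqI[OF nab_chart_derivative[OF v X Y]] by (simp add: 0 \<Gamma>_bilinear_simps)
  finally show ?thesis .
qed

lemma P_component:
  assumes v: "v \<in> A" "fst v \<in> B" and x: "x \<in> tspace \<Phi> (fst v)" and y: "y \<in> tspace \<Phi> (fst v)"
    and z: "z \<in> tspace \<Phi> (fst v)"
  shows "conn_vert_deriv \<Phi> nab v x y z c = d\<Gamma> (tcoord c v) (0, z c) (x c) (y c)"
  unfolding conn_vert_deriv_def Let_def
    conn_vert_deriv_fields[OF v z field_ext_props(1)[OF x] field_ext_props(1)[OF y]]
    field_ext_props(2)[OF x] field_ext_props(2)[OF y] ..

text \<open>The first derivatives of the two fields are exactly the Lie bracket and cancel against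
  it.\<close>

lemma torsion_component:
  assumes v: "v \<in> A" "fst v \<in> B" and x: "x \<in> tspace \<Phi> (fst v)" and y: "y \<in> tspace \<Phi> (fst v)"
  shows "torsion \<Phi> nab v x y c = \<Gamma> (tcoord c v) (x c) (y c) - \<Gamma> (tcoord c v) (y c) (x c)"
  using nab_component[OF v field_ext_props(1)[OF x] field_ext_props(1)[OF y]]
    nab_component[OF v field_ext_props(1)[OF y] field_ext_props(1)[OF x]]
  by (simp add: torsion_def Let_def lie_bracket_component[OF chart B_chart[OF v(2)]]
      field_ext_props(2)[OF x] field_ext_props(2)[OF y])

lemma nab_aniso_nab_component:
  assumes v: "v \<in> A" "fst v \<in> B" and X: "X \<in> vector_fields \<Phi>" and Y: "Y \<in> vector_fields \<Phi>"
    and Z: "Z \<in> vector_fields \<Phi>"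
  shows "nab_aniso \<Phi> A nab v X (\<lambda>v. nab v Y Z) c =
      FD (\<lambda>x. FD (rep Z) x (Y (fst v) c)) (coord c (fst v)) (X (fst v) c)
      + FD (rep Z) (coord c (fst v)) (FD (rep Y) (coord c (fst v)) (X (fst v) c))
      + d\<Gamma> (tcoord c v) (X (fst v) c, 0) (Y (fst v) c) (Z (fst v) c)
      + \<Gamma> (tcoord c v) (FD (rep Y) (coord c (fst v)) (X (fst v) c)) (Z (fst v) c)
      + \<Gamma> (tcoord c v) (Y (fst v) c) (FD (rep Z) (coord c (fst v)) (X (fst v) c))
      + \<Gamma> (tcoord c v) (X (fst v) c) (FD (rep Z) (coord c (fst v)) (Y (fst v) c))
      + \<Gamma> (tcoord c v) (X (fst v) c) (\<Gamma> (tcoord c v) (Y (fst v) c) (Z (fst v) c))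
      - d\<Gamma> (tcoord c v) (0, \<Gamma> (tcoord c v) (X (fst v) c) (snd v c)) (Y (fst v) c) (Z (fst v) c)"
proof -
  note 0 = linear_0[OF linear_FD_rep[OF Y v(2)]] linear_0[OF linear_FD_rep[OF Z v(2)]]
    linear_0[OF linear_FD_FD_rep[OF Z v(2)]]
  show ?thesis
    unfolding nab_aniso_component(2)[OF v X nab_aniso_field[OF Y Z]]
      FD_eqI[OF nab_chart_derivative[OF v Y Z]] nab_component[OF v Y Z]
    by (simp add: 0 \<Gamma>_bilinear_simps algebra_simps)
qed

text \<open>Derivatives of the chosen fields disappear for three reasons: second derivatives of
  \<open>Z\<close> are symmetric, the terms \<open>\<Gamma>(Y, DZ(X))\<close> and
  \<open>\<Gamma>(X, DZ(Y))\<close> occur symmetrically, and those containing \<open>DY(X)\<close>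
  or \<open>DX(Y)\<close> are removed by the bracket term.\<close>

lemma curvature_component:
  assumes v: "v \<in> A" "fst v \<in> B" and x: "x \<in> tspace \<Phi> (fst v)" and y: "y \<in> tspace \<Phi> (fst v)"
    and z: "z \<in> tspace \<Phi> (fst v)"
  shows "curvature \<Phi> A nab v x y z c =
    (d\<Gamma> (tcoord c v) (x c, 0) (y c) (z c) + \<Gamma> (tcoord c v) (x c) (\<Gamma> (tcoord c v) (y c) (z c))
      - d\<Gamma> (tcoord c v) (0, \<Gamma> (tcoord c v) (x c) (snd v c)) (y c) (z c)) -
    (d\<Gamma> (tcoord c v) (y c, 0) (x c) (z c) + \<Gamma> (tcoord c v) (y c) (\<Gamma> (tcoord c v) (x c) (z c))
      - d\<Gamma> (tcoord c v) (0, \<Gamma> (tcoord c v) (y c) (snd v c)) (x c) (z c))"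
proof -
  let ?X = "field_ext \<Phi> (fst v) x" and ?Y = "field_ext \<Phi> (fst v) y" and ?Z = "field_ext \<Phi> (fst v) z"
  note X = field_ext_props(1)[OF x] and Y = field_ext_props(1)[OF y] and Z = field_ext_props(1)[OF z]
  have sym: "FD (\<lambda>s. FD (rep ?Z) s (y c)) (coord c (fst v)) (x c)
      = FD (\<lambda>s. FD (rep ?Z) s (x c)) (coord c (fst v)) (y c)"
    using chart B_chart[OF v(2)]
    by (intro second_FD_symmetric[OF open_image_chart vector_field_smooth[OF Z]]) auto
  show ?thesis
    unfolding curvature_def Let_def
    using nab_aniso_nab_component[OF v X Y Z] nab_aniso_nab_component[OF v Y X Z]
      nab_component[OF v lie_bracket_vector_field[OF X Y] Z] sym
    by (simp add: lie_bracket_component[OF chart B_chart[OF v(2)]] \<Gamma>_bilinear_simps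
        linear_diff[OF linear_FD_rep[OF Z v(2)]]
        field_ext_props(2)[OF x] field_ext_props(2)[OF y] field_ext_props(2)[OF z])
qed

lemma chart_region:
  assumes "\<xi> \<in> in_chart \<Phi> c A \<inter> (coord c ` (dom_chart c \<inter> B)) \<times> UNIV"
  shows "tparam \<Phi> c \<xi> \<in> A" "fst (tparam \<Phi> c \<xi>) = param c (fst \<xi>)" "param c (fst \<xi>) \<in> B"
    "tcoord c (tparam \<Phi> c \<xi>) = \<xi>"
proof -
  show "tparam \<Phi> c \<xi> \<in> A" using assms by (auto simp: in_chart_def)
  have \<xi>: "fst \<xi> \<in> coord c ` (dom_chart c \<inter> B)" using assms by (simp add: mem_Times_iff)
  then have 1: "fst \<xi> \<in> image_chart c" and 2: "param c (fst \<xi>) \<in> B"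
    unfolding mem_coord_image[OF chart] by auto
  show "param c (fst \<xi>) \<in> B" by (rule 2)
  have t: "tparam \<Phi> c \<xi> = (param c (fst \<xi>), lift c (param c (fst \<xi>)) (snd \<xi>))"
    using tparam_eq[OF chart 1, of "snd \<xi>"] unfolding prod.collapse .
  show "fst (tparam \<Phi> c \<xi>) = param c (fst \<xi>)" unfolding t fst_conv ..
  show "tcoord c (tparam \<Phi> c \<xi>) = \<xi>"
    unfolding t fst_conv snd_conv lift_self[OF chart B_chart[OF 2]] coord_param[OF chart 1]
    by (rule prod.collapse)
qed

lemma open_chart_region: "open (in_chart \<Phi> c A \<inter> (coord c ` (dom_chart c \<inter> B)) \<times> UNIV)"
  by (intro open_Int open_in_chart open_Times open_coord_image chart open_B open_UNIV)

lemma tcoord_in_region: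
  "v \<in> A \<Longrightarrow> fst v \<in> B \<Longrightarrow> tcoord c v \<in> in_chart \<Phi> c A \<inter> (coord c ` (dom_chart c \<inter> B)) \<times> UNIV"
  using tcoord_in B_chart by auto

text \<open>On the left \<open>P\<close> is computed from extensions selected separately at every
  base point; on the right stands an expression in smooth data, which can be differentiated.\<close>

lemma P_fields_chart:
  assumes \<xi>: "\<xi> \<in> in_chart \<Phi> c A \<inter> (coord c ` (dom_chart c \<inter> B)) \<times> UNIV"
    and X: "X \<in> vector_fields \<Phi>" and Y: "Y \<in> vector_fields \<Phi>" and Z: "Z \<in> vector_fields \<Phi>"
  defines "v \<equiv> tparam \<Phi> c \<xi>"
  shows "conn_vert_deriv \<Phi> nab v (X (fst v)) (Y (fst v)) (Z (fst v)) c
    = d\<Gamma> \<xi> (0, rep Z (fst \<xi>)) (rep X (fst \<xi>)) (rep Y (fst \<xi>))"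
proof -
  note r = chart_region[OF \<xi>]
  have v: "v \<in> A" "fst v \<in> B" unfolding v_def using r by simp_all
  have "conn_vert_deriv \<Phi> nab v (X (fst v)) (Y (fst v)) (Z (fst v)) c
      = d\<Gamma> (tcoord c v) (0, Z (fst v) c) (X (fst v) c) (Y (fst v) c)"
    by (rule P_component[OF v vector_field_tspace[OF X] vector_field_tspace[OF Y] vector_field_tspace[OF Z]])
  then show ?thesis unfolding v_def r(4) unfolding r(2) .
qed

lemma smooth_on_P_fields:
  assumes X: "X \<in> vector_fields \<Phi>" and Y: "Y \<in> vector_fields \<Phi>" and Z: "Z \<in> vector_fields \<Phi>"
  defines "F \<equiv> \<lambda>v. conn_vert_deriv \<Phi> nab v (X (fst v)) (Y (fst v)) (Z (fst v))"
  shows "smooth_on (in_chart \<Phi> c A \<inter> (coord c ` (dom_chart c \<inter> B)) \<times> UNIV) (\<lambda>\<xi>. F (tparam \<Phi> c \<xi>) c)"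
    (is "smooth_on ?W _")
proof -
  have s: "smooth_on ?W (\<lambda>\<xi>. rep X (fst \<xi>))" if "X \<in> vector_fields \<Phi>" for X
    by (rule smooth_on_compose[where f = fst and g = "rep X", OF open_chart_region open_image_chart[OF chart] _ _
          vector_field_smooth[OF that chart]])
       (auto simp: chart B_chart intro!: smooth_on_fst smooth_on_ident open_chart_region)
  have "smooth_on ?W (\<lambda>\<xi>. d\<Gamma> \<xi> (0, rep Z (fst \<xi>)) (rep X (fst \<xi>)) (rep Y (fst \<xi>)))"
    by (rule smooth_d\<Gamma>_app[OF open_chart_region smooth_on_ident[OF open_chart_region] _
          smooth_on_Pair[OF open_chart_region smooth_on_const[OF open_chart_region] s[OF Z]] s[OF X] s[OF Y]])
       auto
  then show ?thesis
    unfolding F_def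
    using smooth_on_cong[OF open_chart_region, of "\<lambda>\<xi>. F (tparam \<Phi> c \<xi>) c", unfolded F_def, OF P_fields_chart[OF _ X Y Z]]
    by simp
qed

end

section \<open>Tangency of all quantities, and smoothness of \<open>P\<close> along vector
  fields\<close>

context anisotropic
begin

lemma P_tspace:
  assumes "v \<in> A" "x \<in> tspace \<Phi> (fst v)" "y \<in> tspace \<Phi> (fst v)" "z \<in> tspace \<Phi> (fst v)"
  shows "conn_vert_deriv \<Phi> nab v x y z \<in> tspace \<Phi> (fst v)"
  unfolding conn_vert_deriv_def Let_def
  by (intro vert_deriv_tspace nab_aniso_field field_ext_props(1) assms)

text \<open>Needed because \<open>\<nabla>P\<close> applies the covariant derivative of anisotropic
  fields to this map. Christoffel symbols are available only near a point, so smoothness is shown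
  locally, each time with symbols adapted to the point.\<close>

lemma P_aniso_field:
  assumes X: "X \<in> vector_fields \<Phi>" and Y: "Y \<in> vector_fields \<Phi>" and Z: "Z \<in> vector_fields \<Phi>"
  shows "(\<lambda>v. conn_vert_deriv \<Phi> nab v (X (fst v)) (Y (fst v)) (Z (fst v))) \<in> aniso_fields \<Phi> A"
    (is "?F \<in> _")
  unfolding aniso_fields_def
proof (intro CollectI conjI ballI)
  show "?F v \<in> tspace \<Phi> (fst v)" if "v \<in> A" for v
    by (intro P_tspace that vector_field_tspace X Y Z)
  fix c assume c: "c \<in> \<Phi>"
  show "smooth_on (in_chart \<Phi> c A) (\<lambda>\<xi>. ?F (tparam \<Phi> c \<xi>) c)"
  proof (rule smooth_on_local)
    fix \<xi> assume \<xi>: "\<xi> \<in> in_chart \<Phi> c A"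
    then have x: "fst \<xi> \<in> image_chart c" by (auto simp: in_chart_def)
    obtain B \<Gamma> where "christoffel \<Phi> A nab c \<Gamma> B" and B: "param c (fst \<xi>) \<in> B"
      using christoffel_locale[OF c param_in_dom[OF c x]] by blast
    then interpret christoffel \<Phi> A nab c \<Gamma> B by simp
    have "fst \<xi> \<in> coord c ` (dom_chart c \<inter> B)"
      unfolding mem_coord_image[OF c] using x B by simp
    then have "\<xi> \<in> in_chart \<Phi> c A \<inter> (coord c ` (dom_chart c \<inter> B)) \<times> UNIV"
      using \<xi> by (simp add: mem_Times_iff)
    then show "\<exists>U. open U \<and> \<xi> \<in> U \<and> smooth_on U (\<lambda>\<xi>. ?F (tparam \<Phi> c \<xi>) c)"
      using open_chart_region smooth_on_P_fields[OF X Y Z] by blast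
  qed
qed

lemma nab_aniso_tspace:
  assumes "v \<in> A" "X \<in> vector_fields \<Phi>" "\<Y> \<in> aniso_fields \<Phi> A"
  shows "nab_aniso \<Phi> A nab v X \<Y> \<in> tspace \<Phi> (fst v)"
proof -
  obtain c where c: "c \<in> \<Phi>" "fst v \<in> dom_chart c" using chart_exists by blast
  obtain B \<Gamma> where "christoffel \<Phi> A nab c \<Gamma> B" and B: "fst v \<in> B"
    using christoffel_locale[OF c] by blast
  then interpret christoffel \<Phi> A nab c \<Gamma> B by simp
  show ?thesis by (rule nab_aniso_component(1)[OF assms(1) B assms(2,3)])
qed

lemma torsion_tspace:
  assumes "v \<in> A" "x \<in> tspace \<Phi> (fst v)" "y \<in> tspace \<Phi> (fst v)"
  shows "torsion \<Phi> nab v x y \<in> tspace \<Phi> (fst v)"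
  unfolding torsion_def Let_def
  by (intro tspace_diff nab_tspace vector_field_tspace[OF lie_bracket_vector_field] field_ext_props(1) assms)

lemma curvature_tspace:
  assumes "v \<in> A" "x \<in> tspace \<Phi> (fst v)" "y \<in> tspace \<Phi> (fst v)" "z \<in> tspace \<Phi> (fst v)"
  shows "curvature \<Phi> A nab v x y z \<in> tspace \<Phi> (fst v)"
  unfolding curvature_def Let_def
  by (intro tspace_diff nab_aniso_tspace nab_tspace nab_aniso_field lie_bracket_vector_field
      field_ext_props(1) assms)

lemma cov_P_tspace:
  assumes "v \<in> A" "x \<in> tspace \<Phi> (fst v)" "x1 \<in> tspace \<Phi> (fst v)" "x2 \<in> tspace \<Phi> (fst v)"
    "x3 \<in> tspace \<Phi> (fst v)"
  shows "tensor_cov_deriv \<Phi> A nab (conn_vert_deriv \<Phi> nab) v x x1 x2 x3 \<in> tspace \<Phi> (fst v)"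
  unfolding tensor_cov_deriv_def Let_def
  by (intro tspace_diff nab_aniso_tspace P_aniso_field P_tspace nab_tspace field_ext_props(1) assms)

end

section \<open>Both sides of the identity in a chart\<close>

context christoffel
begin

lemma d\<Gamma>_snd_add:
  "\<xi> \<in> in_chart \<Phi> c A \<Longrightarrow> d\<Gamma> \<xi> (0, p + q) a b = d\<Gamma> \<xi> (0, p) a b + d\<Gamma> \<xi> (0, q) a b"
  using linear_add[OF linear_d\<Gamma>, of \<xi> "(0, p)" "(0, q)" a b] by simp

text \<open>By the product rule the first term of \<open>\<nabla>P\<close> contains derivatives of
  the extensions of \<open>w\<close>, \<open>z\<close> and \<open>b\<close>. Each cancels against
  the derivative part of one of the three correction terms, whose \<open>\<Gamma>\<close> part
  survives.\<close>

lemma cov_P_component: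
  assumes v: "v \<in> A" "fst v \<in> B" and u: "u \<in> tspace \<Phi> (fst v)" and w: "w \<in> tspace \<Phi> (fst v)"
    and z: "z \<in> tspace \<Phi> (fst v)" and b: "b \<in> tspace \<Phi> (fst v)"
  defines "\<xi> \<equiv> tcoord c v"
  shows "tensor_cov_deriv \<Phi> A nab (conn_vert_deriv \<Phi> nab) v u w z b c =
    dd\<Gamma> \<xi> (0, b c) (u c, 0) (w c) (z c) + \<Gamma> \<xi> (u c) (d\<Gamma> \<xi> (0, b c) (w c) (z c))
    - dd\<Gamma> \<xi> (0, b c) (0, \<Gamma> \<xi> (u c) (snd v c)) (w c) (z c)
    - d\<Gamma> \<xi> (0, b c) (\<Gamma> \<xi> (u c) (w c)) (z c)
    - d\<Gamma> \<xi> (0, b c) (w c) (\<Gamma> \<xi> (u c) (z c))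
    - d\<Gamma> \<xi> (0, \<Gamma> \<xi> (u c) (b c)) (w c) (z c)"
proof -
  let ?W = "in_chart \<Phi> c A \<inter> (coord c ` (dom_chart c \<inter> B)) \<times> UNIV"
  let ?x = "coord c (fst v)"
  define X where "X = field_ext \<Phi> (fst v) u"
  define X1 where "X1 = field_ext \<Phi> (fst v) w"
  define X2 where "X2 = field_ext \<Phi> (fst v) z"
  define X3 where "X3 = field_ext \<Phi> (fst v) b"
  have X: "X \<in> vector_fields \<Phi>" "X (fst v) = u" and X1: "X1 \<in> vector_fields \<Phi>" "X1 (fst v) = w"
    and X2: "X2 \<in> vector_fields \<Phi>" "X2 (fst v) = z" and X3: "X3 \<in> vector_fields \<Phi>" "X3 (fst v) = b"
    unfolding X_def X1_def X2_def X3_def using field_ext_props u w z b by auto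
  have \<xi>: "\<xi> \<in> in_chart \<Phi> c A" "\<xi> \<in> ?W"
    unfolding \<xi>_def using tcoord_in[OF v] tcoord_in_region[OF v] by auto
  have fst_D: "(fst has_derivative fst) (at \<xi>)"
    by (rule bounded_linear_imp_has_derivative[OF bounded_linear_fst])
  have repD: "((\<lambda>\<xi>. rep Z (fst \<xi>)) has_derivative (\<lambda>\<eta>. FD (rep Z) ?x (fst \<eta>))) (at \<xi>)"
    if "Z \<in> vector_fields \<Phi>" for Z
    using has_derivative_compose[where g = "rep Z", OF fst_D] rep_has_derivative[OF that v(2)]
    by (simp add: \<xi>_def)
  have repv: "rep Z (fst \<xi>) = Z (fst v) c" for Z by (simp add: \<xi>_def rep_coord v(2))
  let ?F = "\<lambda>v. conn_vert_deriv \<Phi> nab v (X1 (fst v)) (X2 (fst v)) (X3 (fst v))"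
  have "((\<lambda>\<xi>. d\<Gamma> \<xi> (0, rep X3 (fst \<xi>)) (rep X1 (fst \<xi>)) (rep X2 (fst \<xi>))) has_derivative
      (\<lambda>\<eta>. dd\<Gamma> \<xi> (0, rep X3 (fst \<xi>)) \<eta> (rep X1 (fst \<xi>)) (rep X2 (fst \<xi>))
        + d\<Gamma> \<xi> (0, FD (rep X3) ?x (fst \<eta>)) (rep X1 (fst \<xi>)) (rep X2 (fst \<xi>))
        + d\<Gamma> \<xi> (0, rep X3 (fst \<xi>)) (FD (rep X1) ?x (fst \<eta>)) (rep X2 (fst \<xi>))
        + d\<Gamma> \<xi> (0, rep X3 (fst \<xi>)) (rep X1 (fst \<xi>)) (FD (rep X2) ?x (fst \<eta>)))) (at \<xi>)"
    by (intro d\<Gamma>_product_rule has_derivative_ident has_derivative_Pair has_derivative_const repD X1 X2 X3 \<xi>)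
  then have "((\<lambda>\<xi>. ?F (tparam \<Phi> c \<xi>) c) has_derivative
      (\<lambda>\<eta>. dd\<Gamma> \<xi> (0, rep X3 (fst \<xi>)) \<eta> (rep X1 (fst \<xi>)) (rep X2 (fst \<xi>))
        + d\<Gamma> \<xi> (0, FD (rep X3) ?x (fst \<eta>)) (rep X1 (fst \<xi>)) (rep X2 (fst \<xi>))
        + d\<Gamma> \<xi> (0, rep X3 (fst \<xi>)) (FD (rep X1) ?x (fst \<eta>)) (rep X2 (fst \<xi>))
        + d\<Gamma> \<xi> (0, rep X3 (fst \<xi>)) (rep X1 (fst \<xi>)) (FD (rep X2) ?x (fst \<eta>)))) (at \<xi>)"
    by (rule has_derivative_transform_within_open[OF _ open_chart_region \<xi>(2)])
       (rule P_fields_chart[OF _ X1(1) X2(1) X3(1), symmetric])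
  then have FDF: "FD (\<lambda>\<xi>. ?F (tparam \<Phi> c \<xi>) c) \<xi> = (\<lambda>\<eta>. dd\<Gamma> \<xi> (0, b c) \<eta> (w c) (z c)
        + d\<Gamma> \<xi> (0, FD (rep X3) ?x (fst \<eta>)) (w c) (z c)
        + d\<Gamma> \<xi> (0, b c) (FD (rep X1) ?x (fst \<eta>)) (z c)
        + d\<Gamma> \<xi> (0, b c) (w c) (FD (rep X2) ?x (fst \<eta>)))"
    unfolding repv X1(2) X2(2) X3(2) by (rule FD_eqI)
  note P = P_component[OF v]
  have nabX: "nab v X Z c = FD (rep Z) ?x (u c) + \<Gamma> \<xi> (u c) (Z (fst v) c)" if "Z \<in> vector_fields \<Phi>" for Z
    using nab_component[OF v X(1) that] by (simp add: X(2) \<xi>_def)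
  have nabXt: "nab v X Z \<in> tspace \<Phi> (fst v)" if "Z \<in> vector_fields \<Phi>" for Z
    by (rule nab_tspace[OF v(1) X(1) that])
  have Fv: "?F v c = d\<Gamma> \<xi> (0, b c) (w c) (z c)"
    unfolding X1(2) X2(2) X3(2) P[OF w z b] \<xi>_def ..
  have "nab_aniso \<Phi> A nab v X ?F c =
      FD (\<lambda>\<xi>. ?F (tparam \<Phi> c \<xi>) c) \<xi> (u c, 0) + \<Gamma> \<xi> (u c) (d\<Gamma> \<xi> (0, b c) (w c) (z c))
      - FD (\<lambda>\<xi>. ?F (tparam \<Phi> c \<xi>) c) \<xi> (0, \<Gamma> \<xi> (u c) (snd v c))"
    using nab_aniso_component(2)[OF v X(1) P_aniso_field[OF X1(1) X2(1) X3(1)]]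
    unfolding Fv X(2) \<xi>_def[symmetric] .
  moreover have "conn_vert_deriv \<Phi> nab v (nab v X X1) z b c
      = d\<Gamma> \<xi> (0, b c) (FD (rep X1) ?x (u c)) (z c) + d\<Gamma> \<xi> (0, b c) (\<Gamma> \<xi> (u c) (w c)) (z c)"
    unfolding P[OF nabXt[OF X1(1)] z b] nabX[OF X1(1)] X1(2) \<xi>_def[symmetric]
    by (rule bilinear_ladd[OF d\<Gamma>_bilinear[OF \<xi>(1)]])
  moreover have "conn_vert_deriv \<Phi> nab v w (nab v X X2) b c
      = d\<Gamma> \<xi> (0, b c) (w c) (FD (rep X2) ?x (u c)) + d\<Gamma> \<xi> (0, b c) (w c) (\<Gamma> \<xi> (u c) (z c))"
    unfolding P[OF w nabXt[OF X2(1)] b] nabX[OF X2(1)] X2(2) \<xi>_def[symmetric]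
    by (rule bilinear_radd[OF d\<Gamma>_bilinear[OF \<xi>(1)]])
  moreover have "conn_vert_deriv \<Phi> nab v w z (nab v X X3) c
      = d\<Gamma> \<xi> (0, FD (rep X3) ?x (u c)) (w c) (z c) + d\<Gamma> \<xi> (0, \<Gamma> \<xi> (u c) (b c)) (w c) (z c)"
    unfolding P[OF w z nabXt[OF X3(1)]] nabX[OF X3(1)] X3(2) \<xi>_def[symmetric]
    by (rule d\<Gamma>_snd_add[OF \<xi>(1)])
  \<comment> \<open>In the vertical correction of the covariant derivative the base direction is 0,
    so the derivatives of the extensions do not contribute there.\<close>
  moreover have "d\<Gamma> \<xi> (0, FD (rep X3) ?x 0) (w c) (z c) = 0"
    "d\<Gamma> \<xi> (0, b c) (FD (rep X1) ?x 0) (z c) = 0" "d\<Gamma> \<xi> (0, b c) (w c) (FD (rep X2) ?x 0) = 0"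
    unfolding linear_0[OF linear_FD_rep[OF X1(1) v(2)]] linear_0[OF linear_FD_rep[OF X2(1) v(2)]]
      linear_0[OF linear_FD_rep[OF X3(1) v(2)]] zero_prod_def[symmetric]
    by (simp_all add: bilinear_lzero[OF d\<Gamma>_bilinear[OF \<xi>(1)]] bilinear_rzero[OF d\<Gamma>_bilinear[OF \<xi>(1)]]
        linear_0[OF linear_d\<Gamma>[OF \<xi>(1)]])
  ultimately show ?thesis
    unfolding tensor_cov_deriv_def Let_def X_def[symmetric] X1_def[symmetric] X2_def[symmetric]
      X3_def[symmetric]
    by (simp add: FDF)
qed

text \<open>\<open>D a a'\<close> is the vertical derivative of one of the two antisymmetrised
  halves of the curvature. In its last line the first term is the composition of \<open>P\<close>
  with itself, and the second matches the last term of \<open>\<nabla>P\<close>.\<close>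

lemma vert_curvature_component:
  assumes v: "v \<in> A" "fst v \<in> B" and u: "u \<in> tspace \<Phi> (fst v)" and w: "w \<in> tspace \<Phi> (fst v)"
    and z: "z \<in> tspace \<Phi> (fst v)" and b: "b \<in> tspace \<Phi> (fst v)"
  defines "\<xi> \<equiv> tcoord c v"
  defines "D \<equiv> \<lambda>a a'. dd\<Gamma> \<xi> (a, 0) (0, b c) a' (z c)
      + d\<Gamma> \<xi> (0, b c) a (\<Gamma> \<xi> a' (z c)) + \<Gamma> \<xi> a (d\<Gamma> \<xi> (0, b c) a' (z c))
      - dd\<Gamma> \<xi> (0, \<Gamma> \<xi> a (snd v c)) (0, b c) a' (z c)
      - d\<Gamma> \<xi> (0, d\<Gamma> \<xi> (0, b c) a (snd v c)) a' (z c) - d\<Gamma> \<xi> (0, \<Gamma> \<xi> a (b c)) a' (z c)"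
  shows "tensor_vert_deriv (curvature \<Phi> A nab) v u w z b c = D (u c) (w c) - D (w c) (u c)"
proof -
  define f where "f = (\<lambda>t. \<xi> + t *\<^sub>R (0::'e, b c))"
  \<comment> \<open>The curvature contains the fibre coordinate not only inside
    \<open>\<Gamma>\<close> but also as an argument of it. The motion of this argument is the source
    of \<open>\<Gamma> \<xi> a (b c)\<close> in \<open>D\<close>.\<close>
  define y where "y = (\<lambda>t. snd v c + t *\<^sub>R b c)"
  define G where "G = (\<lambda>a a' t. d\<Gamma> (f t) (a, 0) a' (z c) + \<Gamma> (f t) a (\<Gamma> (f t) a' (z c))
      - d\<Gamma> (f t) (0, \<Gamma> (f t) a (y t)) a' (z c))"
  have \<xi>: "\<xi> \<in> in_chart \<Phi> c A" unfolding \<xi>_def by (rule tcoord_in[OF v])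
  have f: "(f has_derivative (\<lambda>r. r *\<^sub>R (0, b c))) (at 0)" and f0: "f 0 = \<xi>"
    unfolding f_def by (rule vertical_line_has_derivative) (simp add: zero_prod_def)
  have y: "(y has_derivative (\<lambda>r. r *\<^sub>R b c)) (at 0)" and y0: "y 0 = snd v c"
    unfolding y_def by (rule vertical_line_has_derivative) simp
  have fW: "f 0 \<in> in_chart \<Phi> c A" using f0 \<xi> by simp
  \<comment> \<open>In one real variable a derivative is determined by its value at 1.\<close>
  have vd: "(h has_vector_derivative h' 1) (at 0)" if "(h has_derivative h') (at 0)" for h and h' :: "real \<Rightarrow> 'e"
    unfolding has_vector_derivative_def
  proof (rule has_derivative_eq_rhs[OF that])
    show "h' = (\<lambda>r. r *\<^sub>R h' 1)"
    proof
      fix r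
      have "h' (r *\<^sub>R 1) = r *\<^sub>R h' 1" by (rule linear_cmul[OF has_derivative_linear[OF that]])
      then show "h' r = r *\<^sub>R h' 1" by (simp only: real_scaleR_def mult_1_right)
    qed
  qed
  have G: "(G a a' has_vector_derivative D a a') (at 0)" for a a'
  proof -
    note c0 = has_derivative_const
    note Gy = \<Gamma>_product_rule[OF f fW c0[of a] y]
    note 1 = d\<Gamma>_product_rule[OF f fW c0[of "(a, 0)"] c0[of a'] c0[of "z c"]]
    note 2 = \<Gamma>_product_rule[OF f fW c0[of a] \<Gamma>_product_rule[OF f fW c0[of a'] c0[of "z c"]]]
    note 3 = d\<Gamma>_product_rule[OF f fW has_derivative_Pair[OF c0[of "0::'e"] Gy] c0[of a'] c0[of "z c"]]
    \<comment> \<open>The product rules also list derivatives of the constant slots; these terms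
      vanish by linearity.\<close>
    have zero: "d\<Gamma> \<xi> 0 p q = 0" "d\<Gamma> \<xi> \<eta> 0 q = 0" "d\<Gamma> \<xi> \<eta> p 0 = 0" for p q \<eta>
      by (simp_all add: bilinear_lzero[OF d\<Gamma>_bilinear[OF \<xi>]] bilinear_rzero[OF d\<Gamma>_bilinear[OF \<xi>]]
          linear_0[OF linear_d\<Gamma>[OF \<xi>]])
    show ?thesis
      unfolding G_def
      using vd[OF has_derivative_diff[OF has_derivative_add[OF 1 2] 3]]
      by (simp add: D_def f0 y0 zero \<Gamma>_bilinear_simps d\<Gamma>_snd_add[OF \<xi>] algebra_simps)
  qed
  obtain T :: "real set" where T: "open T" "0 \<in> T" and TA: "\<And>t. t \<in> T \<Longrightarrow> (fst v, snd v + t *\<^sub>R b) \<in> A"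
    using vertical_line_in_A[OF v(1) b] by blast
  have "((\<lambda>t. curvature \<Phi> A nab (fst v, snd v + t *\<^sub>R b) u w z c) has_vector_derivative
      D (u c) (w c) - D (w c) (u c)) (at 0)"
  proof (rule has_vector_derivative_transform_within_open[OF has_vector_derivative_diff[OF G G] T])
    fix t assume t: "t \<in> T"
    let ?v = "(fst v, snd v + t *\<^sub>R b)"
    have tc: "tcoord c ?v = f t" "snd ?v c = y t"
      by (simp_all add: f_def y_def \<xi>_def scaleR_fun_def)
    have "fst ?v \<in> B" "u \<in> tspace \<Phi> (fst ?v)" "w \<in> tspace \<Phi> (fst ?v)" "z \<in> tspace \<Phi> (fst ?v)"
      using v(2) u w z by simp_all
    from curvature_component[OF TA[OF t] this]
    show "G (u c) (w c) t - G (w c) (u c) t = curvature \<Phi> A nab ?v u w z c"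
      unfolding G_def tc(1) unfolding tc(2) by simp
  qed
  then show ?thesis
    unfolding tensor_vert_deriv_def vert_deriv_def by (rule vector_derivative_at)
qed

end

theorem proposition2p15:
  fixes \<Phi> :: "('m::{t2_space, second_countable_topology}, 'e::euclidean_space) chart set"
    and A :: "('m \<times> ('m, 'e) tvec) set"
    and nab :: "('m, 'e) aconn"
    and v :: "'m \<times> ('m, 'e) tvec"
    and u w z b :: "('m, 'e) tvec"
  defines "P \<equiv> conn_vert_deriv \<Phi> nab"
    and "\<T> \<equiv> torsion \<Phi> nab"
    and "R \<equiv> curvature \<Phi> A nab"
  assumes "smooth_atlas \<Phi>"
    and "open_in_TM \<Phi> A"
    and "fst ` A = UNIV"
    and "anisotropic_connection \<Phi> A nab"
    and "v \<in> A"
    and "u \<in> tspace \<Phi> (fst v)"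
    and "w \<in> tspace \<Phi> (fst v)"
    and "z \<in> tspace \<Phi> (fst v)"
    and "b \<in> tspace \<Phi> (fst v)"
  shows "tensor_vert_deriv R v u w z b =
      tensor_cov_deriv \<Phi> A nab P v u w z b
    - tensor_cov_deriv \<Phi> A nab P v w u z b
    + P v (\<T> v u w) z b
    - P v w z (P v u (snd v) b)
    + P v u z (P v w (snd v) b)"
    (is "?lhs = ?rhs")
proof
  interpret anisotropic \<Phi> A nab
    using assms(4,5,7) by unfold_locales
  note v = assms(8) and u = assms(9) and w = assms(10) and z = assms(11) and b = assms(12)
  note y = A_tspace[OF v]
  note Tt = torsion_tspace[OF v u w]
  note Pu = P_tspace[OF v u y b] and Pw = P_tspace[OF v w y b]
  fix c show "?lhs c = ?rhs c"
  proof (cases "c \<in> \<Phi> \<and> fst v \<in> dom_chart c")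
    case True
    then obtain B \<Gamma> where "christoffel \<Phi> A nab c \<Gamma> B" and B: "fst v \<in> B"
      using christoffel_locale by blast
    then interpret christoffel \<Phi> A nab c \<Gamma> B by simp
    note \<xi> = tcoord_in[OF v B]
    note vB = v B
    show ?thesis
      \<comment> \<open>The torsion term cancels the antisymmetrised
        \<open>d\<Gamma> \<xi> (0, b c) (\<Gamma> \<xi> (u c) (w c)) (z c)\<close> of the two
        covariant derivatives. What remains agrees once the two directions in
        \<open>dd\<Gamma>\<close> are exchanged.\<close>
      unfolding P_def \<T>_def R_def
      using vert_curvature_component[OF vB u w z b] cov_P_component[OF vB u w z b]
        cov_P_component[OF vB w u z b] P_component[OF vB Tt z b] P_component[OF vB w z Pu]
        P_component[OF vB u z Pw] P_component[OF vB u y b] P_component[OF vB w y b]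
        torsion_component[OF vB u w] dd\<Gamma>_symmetric[OF \<xi>, of "(0, b c)"]
      by (simp add: bilinear_lsub[OF d\<Gamma>_bilinear[OF \<xi>]])
  next
    case False
    \<comment> \<open>At an index that is not a chart around the point, tangent vectors have entry
      0. On the left this applies to the curvature along the vertical line, whose derivative is then
      0 as well.\<close>
    have "?rhs \<in> tspace \<Phi> (fst v)"
      unfolding P_def \<T>_def by (intro tspace_add tspace_diff cov_P_tspace P_tspace Tt Pu Pw v u w z b)
    moreover have "?lhs c = 0"
      unfolding R_def tensor_vert_deriv_def
      using curvature_tspace[of "(fst v, y)" u w z for y] u w z
      by (intro vert_deriv_component_outside v b False) simp
    ultimately show ?thesis using tspace_zero False by metis
  qed
qed

end
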